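(* Let $K$ be a number field with ring of integers $\mathfrak{o}_K$, $R$ a subring of $K$ with fraction field $K$, $\mathscr{O}$ its integral closure, and assume the set $T$ of nonzero primes $\mathfrak{p}$ of $\mathfrak{o}_K$ such that some $x\in R$ has $\mathrm{ord}_\mathfrak{p}(x)<0$ is finite. Let $\mathfrak{f}=\{x\in K:x\mathscr{O}\subseteq R\}$, $\tilde{\mathfrak{f}}=\mathfrak{f}\cap\mathfrak{o}_K$, $\mathfrak{m}_0=\prod_{\mathfrak{p}\in T}\mathfrak{p}$. Let $J_K^{\tilde{\mathfrak{f}}\mathfrak{m}_0}$ be the group of fractional $\mathfrak{o}_K$-ideals coprime to $\tilde{\mathfrak{f}}\mathfrak{m}_0$, $P_{K,1}^{\tilde{\mathfrak{f}}\mathfrak{m}_0}$ its subgroup generated by $\alpha\mathfrak{o}_K$ with $\alpha\in\mathfrak{o}_K$, $\alpha\equiv1\pmod{\tilde{\mathfrak{f}}\mathfrak{m}_0}$, and $P_{K,R}^{\tilde{\mathfrak{f}}\mathfrak{m}_0}$ its subgroup generated by the ideals $\alpha\mathscr{O}\cap\mathfrak{o}_K$ with $\alpha\in R$, $\alpha R+\mathfrak{f}=R$. Let $J(R,\mathfrak{f})$ be the group of invertible fractional $R$-ideals generated by the nonzero primes $\mathfrak{P}$ of $R$ with $\mathfrak{P}+\mathfrak{f}=R$, $P(R,\mathfrak{f})$ its subgroup generated by $\alpha R$ with $\alpha\in R$, $\alpha R+\mathfrak{f}=R$, and $\mathrm{Pic}(R,\mathfrak{f})=J(R,\mathfrak{f})/P(R,\mathfrak{f})$.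 Then (1) $P_{K,1}^{\tilde{\mathfrak{f}}\mathfrak{m}_0}\subseteq P_{K,R}^{\tilde{\mathfrak{f}}\mathfrak{m}_0}\subseteq J_K^{\tilde{\mathfrak{f}}\mathfrak{m}_0}$, i.e. $P_{K,R}^{\tilde{\mathfrak{f}}\mathfrak{m}_0}$ is a congruence subgroup for the modulus $\tilde{\mathfrak{f}}\mathfrak{m}_0$; and (2) $\mathrm{Pic}(R,\mathfrak{f})\cong J_K^{\tilde{\mathfrak{f}}\mathfrak{m}_0}/P_{K,R}^{\tilde{\mathfrak{f}}\mathfrak{m}_0}$.
   Context: The modulus $\tilde{\mathfrak{f}}\mathfrak{m}_0$ has no infinite part. *)

theory Defs
  imports
    "HOL-Computational_Algebra.Polynomial"
    "HOL-Algebra.Generated_Groups"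
    "HOL-Algebra.Ideal_Product"
    "HOL-Algebra.Subrings"
begin

text \<open>The number field is a whole type; its subrings and their fractional ideals are sets of
  elements of that type.\<close>

definition is_number_field :: "'a::field_char_0 itself \<Rightarrow> bool" where
  "is_number_field _ \<longleftrightarrow>
     (\<exists>B. finite_dimensional_vector_space (\<lambda>(q::rat) (x::'a). of_rat q * x) B)"

definition ring_on :: "'a::field set \<Rightarrow> 'a ring" where
  "ring_on S = \<lparr>carrier = S, mult = (*), one = 1, zero = 0, add = (+)\<rparr>"

definition ring_of_integers :: "'a::field_char_0 set" (\<open>\<O>\<^sub>K\<close>) where
  "\<O>\<^sub>K = {x. algebraic_int x}"

definition has_fraction_field_K :: "'a::field set \<Rightarrow> bool" where
  "has_fraction_field_K R \<longleftrightarrow> (\<forall>x. \<exists>a\<in>R. \<exists>b\<in>R - {0}. x = a / b)"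

definition integral_closure :: "'a::field set \<Rightarrow> 'a set" where
  "integral_closure R =
     {x. \<exists>p. lead_coeff p = 1 \<and> (\<forall>i. Polynomial.coeff p i \<in> R) \<and> poly p x = 0}"


subsection \<open>Fractional ideals\<close>

definition fractional_ideal :: "'a::field set \<Rightarrow> 'a set \<Rightarrow> bool" where
  "fractional_ideal R I \<longleftrightarrow>
     additive_subgroup I (ring_on UNIV) \<and> (\<forall>r\<in>R. \<forall>x\<in>I. r * x \<in> I) \<and>
     I \<noteq> {0} \<and> (\<exists>d\<in>R - {0}. \<forall>x\<in>I. d * x \<in> R)"

text \<open>The product is formed in the ambient field: finite sums of products of elements.\<close>

definition fractional_ideals :: "'a::field set \<Rightarrow> 'a set monoid" where
  "fractional_ideals R =
     \<lparr>carrier = {I. fractional_ideal R I}, mult = ideal_prod (ring_on UNIV), one = R\<rparr>"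

abbreviation invertible_ideals :: "'a::field set \<Rightarrow> 'a set monoid" where
  "invertible_ideals R \<equiv> units_of (fractional_ideals R)"

definition principal :: "'a::field set \<Rightarrow> 'a \<Rightarrow> 'a set" where
  "principal R \<alpha> = (*) \<alpha> ` R"

definition nonzero_primes :: "'a::field set \<Rightarrow> 'a set set" where
  "nonzero_primes R = {P. primeideal P (ring_on R) \<and> P \<noteq> {0}}"

definition comaximal :: "'a::field set \<Rightarrow> 'a set \<Rightarrow> 'a set \<Rightarrow> bool" where
  "comaximal R I J \<longleftrightarrow> I <+>\<^bsub>ring_on R\<^esub> J = R"


subsection \<open>Prime factorization in the ring of integers\<close>

text \<open>The order at a prime is its exponent in the (unique) factorization of a fractional ideal of
  \<open>\<O>\<^sub>K\<close> into nonzero primes.\<close>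

definition prime_factorization_of :: "'a::field_char_0 set \<Rightarrow> ('a set \<Rightarrow> int) \<Rightarrow> bool" where
  "prime_factorization_of I v \<longleftrightarrow>
     finite {P. v P \<noteq> 0} \<and> {P. v P \<noteq> 0} \<subseteq> nonzero_primes \<O>\<^sub>K \<and>
     I = (\<Otimes>\<^bsub>fractional_ideals \<O>\<^sub>K\<^esub> P\<in>{P. v P \<noteq> 0}. P [^]\<^bsub>fractional_ideals \<O>\<^sub>K\<^esub> v P)"

definition ideal_ord :: "'a::field_char_0 set \<Rightarrow> 'a set \<Rightarrow> int" where
  "ideal_ord P I = (THE v. prime_factorization_of I v) P"

text \<open>Only meaningful for a nonzero element, the order of \<open>0\<close> being infinite.\<close>

definition elem_ord :: "'a::field_char_0 set \<Rightarrow> 'a \<Rightarrow> int" where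
  "elem_ord P x = ideal_ord P (principal \<O>\<^sub>K x)"


subsection \<open>Ideal groups for a modulus without infinite part\<close>

definition J_K :: "'a::field_char_0 set \<Rightarrow> 'a set monoid" where
  "J_K \<mm> = (fractional_ideals \<O>\<^sub>K)\<lparr>carrier :=
     {I. fractional_ideal \<O>\<^sub>K I \<and>
         (\<forall>P \<in> nonzero_primes \<O>\<^sub>K. ideal_ord P \<mm> = 0 \<or> ideal_ord P I = 0)}\<rparr>"

text \<open>In this and the other groups generated by principal ideals, \<open>\<alpha> \<noteq> 0\<close> is not automatic: if the
  modulus or the conductor is the unit ideal, \<open>\<alpha> = 0\<close> satisfies the remaining conditions.\<close>

definition P_K1 :: "'a::field_char_0 set \<Rightarrow> 'a set set" where
  "P_K1 \<mm> = generate (fractional_ideals \<O>\<^sub>K)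
     {principal \<O>\<^sub>K \<alpha> | \<alpha>. \<alpha> \<in> \<O>\<^sub>K \<and> \<alpha> \<noteq> 0 \<and> \<alpha> - 1 \<in> \<mm>}"


subsection \<open>The data attached to a subring\<close>

definition polar_primes :: "'a::field_char_0 set \<Rightarrow> 'a set set" where
  "polar_primes R = {P \<in> nonzero_primes \<O>\<^sub>K. \<exists>x\<in>R. x \<noteq> 0 \<and> elem_ord P x < 0}"

definition conductor :: "'a::field set \<Rightarrow> 'a set" where
  "conductor R = {x. \<forall>y\<in>integral_closure R. x * y \<in> R}"

definition subring_modulus :: "'a::field_char_0 set \<Rightarrow> 'a set" where
  "subring_modulus R =
     (conductor R \<inter> \<O>\<^sub>K) \<cdot>\<^bsub>ring_on UNIV\<^esub> (\<Otimes>\<^bsub>fractional_ideals \<O>\<^sub>K\<^esub> P\<in>polar_primes R. P)"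

definition P_KR :: "'a::field_char_0 set \<Rightarrow> 'a set set" where
  "P_KR R = generate (fractional_ideals \<O>\<^sub>K)
     {principal (integral_closure R) \<alpha> \<inter> \<O>\<^sub>K | \<alpha>.
        \<alpha> \<in> R \<and> \<alpha> \<noteq> 0 \<and> comaximal R (principal R \<alpha>) (conductor R)}"

definition J_R :: "'a::field set \<Rightarrow> 'a set \<Rightarrow> 'a set monoid" where
  "J_R R \<ff> = (invertible_ideals R)\<lparr>carrier :=
     generate (invertible_ideals R) {P \<in> nonzero_primes R. comaximal R P \<ff>}\<rparr>"

definition P_R :: "'a::field set \<Rightarrow> 'a set \<Rightarrow> 'a set set" where
  "P_R R \<ff> = generate (invertible_ideals R)
     {principal R \<alpha> | \<alpha>. \<alpha> \<in> R \<and> \<alpha> \<noteq> 0 \<and> comaximal R (principal R \<alpha>) \<ff>}"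

definition Pic :: "'a::field set \<Rightarrow> 'a set \<Rightarrow> 'a set set monoid" where
  "Pic R \<ff> = J_R R \<ff> Mod P_R R \<ff>"

end

theory Submission
  imports Defs "Jordan_Normal_Form.Schur_Decomposition"
begin

text \<open>
  Every subring \<open>R\<close> of \<open>K\<close> with fraction field \<open>K\<close> has finite quotients \<open>R / n R\<close>, since elements that
  are independent modulo a prime number are independent over the rationals. So only finitely many
  ideals of \<open>R\<close> contain a given nonzero element, and the usual argument shows that the ideals coprime
  to the conductor are products of invertible primes. For the ring of integers \<open>\<O>\<close> this is unique
  factorization. The conductor of \<open>R\<close> is nonzero because the trace form bounds the denominators of
  algebraic integers and because the integral closure of \<open>R\<close> is \<open>\<O> R\<close>.

  The map \<open>A \<mapsto> A \<O> R \<inter> R'\<close>, where \<open>R'\<close> is \<open>R\<close> localized at the elements congruent to \<open>1\<close> modulo the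
  conductor, is multiplicative on the fractional ideals of \<open>\<O>\<close> coprime to the modulus. It has trivial
  kernel, it maps the primes not dividing the modulus onto the primes of \<open>R\<close> coprime to the conductor,
  and it maps \<open>\<alpha> \<O> R \<inter> \<O>\<close> to \<open>\<alpha> R\<close>. Hence it induces the isomorphism of the quotients.
\<close>

subsection \<open>Algebraic integers\<close>

text \<open>\<open>R\<close> is not assumed to contain \<O> or to be finitely generated over the
  integers, so every chain condition has to come from the finiteness of \<open>R / n R\<close>. The
  polar primes shape the modulus: each of them generates the unit ideal in the integral closure, so
  extension of ideals forgets it, and an ideal can be recovered from its extension only if it is
  prime to them. The same factor of the modulus forces an \<alpha> congruent to 1 to be a unit at
  these primes, which is why \<alpha> \<O> is already the intersection of its extension with \<O>.
  The localization \<open>R'\<close> is forced by fractional ideals: intersecting with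
  \<open>R\<close> itself would send an ideal and its inverse both into \<open>R\<close>, and no
  such map could respect inverses. On integral elements the localization changes nothing, because a
  denominator congruent to 1 modulo the conductor can be removed there. Multiplicativity rests on
  splitting 1 into an element of the conductor and an element lying in the ideals under
  consideration.\<close>

definition zspan :: "'a::comm_ring_1 set \<Rightarrow> 'a set" where
  "zspan B = range (\<lambda>c. \<Sum>b\<in>B. of_int (c b) * b)"

lemma zspan_0: "0 \<in> zspan B"
  unfolding zspan_def by (rule range_eqI[of _ _ "\<lambda>_. 0"]) simp

lemma zspan_add: "x \<in> zspan B \<Longrightarrow> y \<in> zspan B \<Longrightarrow> x + y \<in> zspan B"
proof -
  assume "x \<in> zspan B" "y \<in> zspan B"
  then obtain c d where "x = (\<Sum>b\<in>B. of_int (c b) * b)" "y = (\<Sum>b\<in>B. of_int (d b) * b)"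
    unfolding zspan_def by auto
  then show ?thesis unfolding zspan_def
    by (intro range_eqI[of _ _ "\<lambda>b. c b + d b"]) (simp add: distrib_right sum.distrib)
qed

lemma zspan_of_int: "x \<in> zspan B \<Longrightarrow> of_int k * x \<in> zspan B"
proof -
  assume "x \<in> zspan B"
  then obtain c where "x = (\<Sum>b\<in>B. of_int (c b) * b)"
    unfolding zspan_def by auto
  then show ?thesis unfolding zspan_def
    by (intro range_eqI[of _ _ "\<lambda>b. k * c b"]) (simp add: sum_distrib_left mult.assoc)
qed

lemma zspan_sum: "(\<And>i. i \<in> I \<Longrightarrow> f i \<in> zspan B) \<Longrightarrow> (\<Sum>i\<in>I. f i) \<in> zspan B"
  by (induction I rule: infinite_finite_induct) (auto intro: zspan_0 zspan_add)

lemma zspan_base: "finite B \<Longrightarrow> b \<in> B \<Longrightarrow> b \<in> zspan B"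
  unfolding zspan_def
  by (rule range_eqI[of _ _ "\<lambda>x. if x = b then 1 else 0"])
     (simp add: if_distrib[where f = "\<lambda>x. x * _"] if_distrib[where f = of_int] cong: if_cong)

lemma zspan_minimal:
  assumes "0 \<in> M" "\<And>x y. x \<in> M \<Longrightarrow> y \<in> M \<Longrightarrow> x + y \<in> M"
    and "\<And>k b. b \<in> B \<Longrightarrow> of_int k * b \<in> M"
  shows "zspan B \<subseteq> M"
proof -
  have "(\<Sum>b\<in>A. of_int (c b) * b) \<in> M" if "A \<subseteq> B" for c A
    using that by (induction A rule: infinite_finite_induct) (auto intro: assms)
  then show ?thesis unfolding zspan_def by auto
qed

lemma zspan_mult_closed:
  assumes "\<And>b. b \<in> B \<Longrightarrow> x * b \<in> zspan D" "y \<in> zspan B"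
  shows "x * y \<in> zspan D"
proof -
  obtain c where y: "y = (\<Sum>b\<in>B. of_int (c b) * b)"
    using assms(2) unfolding zspan_def by auto
  have "x * y = (\<Sum>b\<in>B. of_int (c b) * (x * b))"
    unfolding y sum_distrib_left by (intro sum.cong) (auto simp: ac_simps)
  then show ?thesis using assms(1) by (auto intro: zspan_sum zspan_of_int)
qed

text \<open>\<open>z\<close> is an eigenvalue of an integer matrix.\<close>

lemma algebraic_int_if_zspan_stable:
  fixes z :: "'a::field_char_0"
  assumes fin: "finite B" and b0: "b0 \<in> B" "b0 \<noteq> 0"
    and stable: "\<And>b. b \<in> B \<Longrightarrow> z * b \<in> zspan B"
  shows "algebraic_int z"
proof -
  define n where "n = card B"
  obtain h where h: "bij_betw h {0..<n} B"
    using ex_bij_betw_nat_finite[OF fin] unfolding n_def by auto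
  have "\<exists>c. z * b = (\<Sum>b'\<in>B. of_int (c b') * b')" if "b \<in> B" for b
    using stable[OF that] unfolding zspan_def by auto
  then obtain c where c: "\<And>b. b \<in> B \<Longrightarrow> z * b = (\<Sum>b'\<in>B. of_int (c b b') * b')"
    by metis
  define A :: "int mat" where "A = mat n n (\<lambda>(i,j). c (h i) (h j))"
  define A' :: "'a mat" where "A' = map_mat of_int A"
  define v where "v = vec n h"
  have A: "A \<in> carrier_mat n n" and A': "A' \<in> carrier_mat n n"
    by (auto simp: A_def A'_def)
  have hB: "h i \<in> B" if "i < n" for i
    using h that by (auto simp: bij_betw_def)
  have "A' *\<^sub>v v = z \<cdot>\<^sub>v v"
  proof (rule eq_vecI)
    fix i assume "i < dim_vec (z \<cdot>\<^sub>v v)"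
    then have i: "i < n" by (simp add: v_def)
    have "(A' *\<^sub>v v) $ i = (\<Sum>j\<in>{0..<n}. of_int (c (h i) (h j)) * h j)"
      using i by (auto simp: A'_def A_def v_def scalar_prod_def intro!: sum.cong)
    also have "\<dots> = (\<Sum>b'\<in>B. of_int (c (h i) b') * b')"
      by (rule sum.reindex_bij_betw[OF h])
    also have "\<dots> = z * h i" using c[OF hB[OF i]] by simp
    finally show "(A' *\<^sub>v v) $ i = (z \<cdot>\<^sub>v v) $ i" using i by (simp add: v_def)
  qed (simp add: A'_def A_def v_def)
  moreover have "v \<noteq> 0\<^sub>v n"
  proof
    assume "v = 0\<^sub>v n"
    moreover obtain i where "i < n" "h i = b0"
      using h b0(1) by (auto simp: bij_betw_def)
    ultimately show False using b0(2) by (metis index_vec index_zero_vec(1) v_def)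
  qed
  ultimately have "eigenvalue A' z"
    using A' unfolding eigenvalue_def eigenvector_def by (intro exI[of _ v]) (auto simp: v_def)
  then have "poly (char_poly A') z = 0"
    using eigenvalue_root_char_poly[OF A'] by simp
  then have "poly (map_poly of_int (char_poly A)) z = 0"
    unfolding A'_def of_int_hom.char_poly_hom[OF A] .
  then show ?thesis
    unfolding algebraic_int_altdef_ipoly using degree_monic_char_poly[OF A] by auto
qed

lemma algebraic_int_power_eq:
  fixes x :: "'a::field_char_0"
  assumes "algebraic_int x"
  obtains m and c :: "nat \<Rightarrow> int" where "m > 0" "x ^ m = (\<Sum>i<m. of_int (c i) * x ^ i)"
proof -
  obtain p :: "int poly" where p: "poly (map_poly of_int p) x = 0" "lead_coeff p = 1"
    using assms unfolding algebraic_int_altdef_ipoly by auto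
  define m where "m = degree p"
  have "0 = (\<Sum>i\<le>m. of_int (Polynomial.coeff p i) * x ^ i)"
    using p(1) by (simp add: poly_altdef degree_map_poly coeff_map_poly m_def)
  also have "\<dots> = (\<Sum>i<m. of_int (Polynomial.coeff p i) * x ^ i) + x ^ m"
    using p(2) by (simp add: m_def lessThan_Suc_atMost[symmetric])
  finally have eq: "x ^ m = (\<Sum>i<m. of_int (- Polynomial.coeff p i) * x ^ i)"
    by (simp add: sum_negf eq_neg_iff_add_eq_0 add.commute)
  moreover have "m > 0" using eq by (cases m) auto
  ultimately show ?thesis by (rule that[rotated])
qed

text \<open>The integer span of the monomials \<open>x ^ i * y ^ j\<close> with \<open>i < m\<close>
  and \<open>j < n\<close> is stable under multiplication by \<open>x\<close> and by
  \<open>y\<close>, since a top power can be replaced by lower ones. Hence it is stable under their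
  sum and product, and it contains 1.\<close>

lemma algebraic_int_add_mult:
  fixes x y :: "'a::field_char_0"
  assumes x: "algebraic_int x" and y: "algebraic_int y"
  shows algebraic_int_add: "algebraic_int (x + y)"
    and algebraic_int_mult: "algebraic_int (x * y)"
proof -
  obtain m c where m: "m > 0" "x ^ m = (\<Sum>i<m. of_int (c i) * x ^ i)"
    using algebraic_int_power_eq[OF x] by metis
  obtain n d where n: "n > 0" "y ^ n = (\<Sum>i<n. of_int (d i) * y ^ i)"
    using algebraic_int_power_eq[OF y] by metis
  define S where "S x y m n = (\<lambda>(i,j). x ^ i * y ^ j) ` ({..<m} \<times> {..<n})"
    for x y :: 'a and m n :: nat
  have S_mult: "x * b \<in> zspan (S x y m n)"
    if b: "b \<in> S x y m n" and x: "x ^ m = (\<Sum>i<m. of_int (c i) * x ^ i)" for x y m n c b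
  proof -
    obtain i j where ij: "i < m" "j < n" "b = x ^ i * y ^ j" using b unfolding S_def by force
    have in_span: "x ^ k * y ^ j \<in> zspan (S x y m n)" if "k < m" for k
      using that ij(2) by (intro zspan_base) (auto simp: S_def)
    show ?thesis
    proof (cases "Suc i < m")
      case True then show ?thesis using in_span[of "Suc i"] ij by (simp add: mult.assoc)
    next
      case False
      then have "m = Suc i" using ij by simp
      then have "x * b = x ^ m * y ^ j" using ij(3) by (simp add: ac_simps)
      also have "\<dots> = (\<Sum>k<m. of_int (c k) * (x ^ k * y ^ j))"
        unfolding x sum_distrib_right by (intro sum.cong) (auto simp: ac_simps)
      finally show ?thesis using in_span by (auto intro!: zspan_sum zspan_of_int)
    qed
  qed
  define B where "B = S x y m n"
  have "B = S y x n m" unfolding B_def S_def by (force simp: mult.commute)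
  then have xB: "x * b \<in> zspan B" and yB: "y * b \<in> zspan B" if "b \<in> B" for b
    using that S_mult[OF _ m(2), of b y n] S_mult[OF _ n(2), of b x m] by (auto simp: B_def)
  have fin: "finite B" by (simp add: B_def S_def)
  have one: "1 \<in> B" unfolding B_def S_def using m(1) n(1)
    by (intro image_eqI[of _ _ "(0,0)"]) auto
  show "algebraic_int (x + y)"
    using fin one by (rule algebraic_int_if_zspan_stable)
      (auto simp: distrib_right intro: zspan_add xB yB)
  show "algebraic_int (x * y)"
    using fin one by (rule algebraic_int_if_zspan_stable)
      (simp_all add: mult.assoc zspan_mult_closed[OF xB yB])
qed

lemma algebraic_int_sum:
  fixes f :: "_ \<Rightarrow> 'a::field_char_0"
  shows "(\<And>i. i \<in> I \<Longrightarrow> algebraic_int (f i)) \<Longrightarrow> algebraic_int (\<Sum>i\<in>I. f i)"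
  by (induction I rule: infinite_finite_induct) (auto intro: algebraic_int_add)

subsection \<open>The trace form\<close>

lemma sum_diag_mult_commute:
  assumes "A \<in> carrier_mat n n" "B \<in> carrier_mat n n"
  shows "(\<Sum>i<n. (A * B) $$ (i,i)) = (\<Sum>i<n. (B * A :: 'a::comm_ring_1 mat) $$ (i,i))"
proof -
  have "(\<Sum>i<n. (A * B) $$ (i,i)) = (\<Sum>i<n. \<Sum>j<n. A $$ (i,j) * B $$ (j,i))"
    using assms by (intro sum.cong) (auto simp: scalar_prod_def atLeast0LessThan intro!: sum.cong)
  also have "\<dots> = (\<Sum>j<n. \<Sum>i<n. B $$ (j,i) * A $$ (i,j))"
    by (subst sum.swap) (simp add: mult.commute)
  also have "\<dots> = (\<Sum>i<n. (B * A) $$ (i,i))"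
    using assms by (intro sum.cong) (auto simp: scalar_prod_def atLeast0LessThan intro!: sum.cong)
  finally show ?thesis .
qed

text \<open>Schur triangularization conjugates \<open>A\<close> to a matrix whose diagonal lists the
  eigenvalues with multiplicity, and the diagonal sum is invariant under conjugation.\<close>

lemma sum_diag_algebraic_int:
  fixes A :: "complex mat"
  assumes A: "A \<in> carrier_mat n n" and ev: "\<And>e. eigenvalue A e \<Longrightarrow> algebraic_int e"
  shows "algebraic_int (\<Sum>i<n. A $$ (i,i))"
proof -
  obtain es where es: "char_poly A = (\<Prod>e\<leftarrow>es. [:- e, 1:])"
    using char_poly_factorized[OF A] by auto
  obtain B P Q where sd: "schur_decomposition A es = (B,P,Q)" by (cases "schur_decomposition A es")
  have sim: "similar_mat_wit A B P Q" and diag: "diag_mat B = es"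
    using schur_decomposition[OF A es sd] by auto
  have car: "B \<in> carrier_mat n n" "P \<in> carrier_mat n n" "Q \<in> carrier_mat n n"
    and eq: "A = P * B * Q" "Q * P = 1\<^sub>m n"
    using similar_mat_witD2[OF A sim] by auto
  have "(\<Sum>i<n. A $$ (i,i)) = (\<Sum>i<n. (Q * (P * B)) $$ (i,i))"
    unfolding eq(1) by (rule sum_diag_mult_commute) (use car in auto)
  also have "Q * (P * B) = B"
    using car eq(2) by (metis assoc_mult_mat left_mult_one_mat)
  finally have "(\<Sum>i<n. A $$ (i,i)) = (\<Sum>i<n. B $$ (i,i))" .
  moreover have "algebraic_int (B $$ (i,i))" if "i < n" for i
  proof (rule ev)
    have "B $$ (i,i) \<in> set es"
      using that car(1) unfolding diag[symmetric] diag_mat_def by auto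
    then show "eigenvalue A (B $$ (i,i))"
      unfolding eigenvalue_root_char_poly[OF A] es by (auto simp: poly_prod_list prod_list_zero_iff)
  qed
  ultimately show ?thesis by (auto intro: algebraic_int_sum)
qed

lemma rat_common_denominator:
  assumes "finite A"
  shows "\<exists>D::int. D > 0 \<and> (\<forall>q\<in>A. of_int D * q \<in> (\<int> :: rat set))"
  using assms
proof (induction A)
  case empty then show ?case by (auto intro: exI[of _ 1])
next
  case (insert q A)
  then obtain D :: int where D: "D > 0" "\<forall>q\<in>A. of_int D * q \<in> \<int>" by auto
  obtain a b where ab: "b > 0" "q = of_int a / of_int b"
    by (metis quotient_of_denom_pos quotient_of_div surj_pair)
  have "of_int (D * b) * r \<in> \<int>" if "r \<in> insert q A" for r
  proof (cases "r = q")
    case True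
    then have "of_int (D * b) * r = of_int (D * a)" using ab by simp
    then show ?thesis by (metis Ints_of_int)
  next
    case False
    then have "of_int b * (of_int D * r) \<in> \<int>" using that D by (intro Ints_mult[of "of_int b"]) auto
    then show ?thesis by (simp add: ac_simps)
  qed
  then show ?case using D ab by (intro exI[of _ "D * b"]) auto
qed

text \<open>\<open>co x b\<close> is the coordinate of \<open>x\<close> at the basis element \<open>b\<close>.\<close>

locale rat_basis =
  fixes \<B> :: "'a::field_char_0 set" and co :: "'a \<Rightarrow> 'a \<Rightarrow> rat"
  assumes fin: "finite \<B>"
    and expand: "x = (\<Sum>b\<in>\<B>. of_rat (co x b) * b)"
    and co_add: "co (x + y) b = co x b + co y b"
    and co_scale: "co (of_rat q * x) b = q * co x b"
    and co_base: "b \<in> \<B> \<Longrightarrow> b' \<in> \<B> \<Longrightarrow> co b b' = (if b = b' then 1 else 0)"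
    and dependent: "finite (S :: 'a set) \<Longrightarrow> card S > card \<B> \<Longrightarrow>
      \<exists>u. (\<Sum>s\<in>S. of_rat (u s) * s) = 0 \<and> (\<exists>s\<in>S. u s \<noteq> 0)"
    and inj_imp_surj: "(\<And>x y. (f :: 'a \<Rightarrow> 'a) (x + y) = f x + f y) \<Longrightarrow> (\<And>q x. f (of_rat q * x) = of_rat q * f x)
      \<Longrightarrow> inj f \<Longrightarrow> surj f"

text \<open>All use of abstract linear algebra over the rationals ends here. Afterwards the field is
  known only through coordinates, through the dependence of more than \<open>card \<B>\<close>
  elements, and through \<open>inj_imp_surj\<close>.\<close>

lemma number_field_rat_basis:
  assumes "is_number_field TYPE('a::field_char_0)"
  obtains \<B> co where "rat_basis (\<B> :: 'a set) co"
proof -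
  obtain \<B> where "finite_dimensional_vector_space (\<lambda>(q::rat) (x::'a). of_rat q * x) \<B>"
    using assms unfolding is_number_field_def by auto
  then interpret vs: finite_dimensional_vector_space "\<lambda>(q::rat) (x::'a). of_rat q * x" \<B> .
  have "rat_basis \<B> (vs.representation \<B>)"
  proof
    show "finite \<B>" by (rule vs.finite_Basis)
    show "x = (\<Sum>b\<in>\<B>. of_rat (vs.representation \<B> x b) * b)" for x
      using vs.sum_representation_eq[OF vs.independent_Basis, of x \<B>] vs.span_Basis vs.finite_Basis
      by auto
    show "vs.representation \<B> (x + y) b = vs.representation \<B> x b + vs.representation \<B> y b" for x y b
      using vs.representation_add[OF vs.independent_Basis] vs.span_Basis by auto
    show "vs.representation \<B> (of_rat q * x) b = q * vs.representation \<B> x b" for q x b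
      using vs.representation_scale[OF vs.independent_Basis] vs.span_Basis by auto
    show "vs.representation \<B> b b' = (if b = b' then 1 else 0)" if "b \<in> \<B>" "b' \<in> \<B>" for b b'
      using vs.representation_basis[OF vs.independent_Basis that(1)] by auto
    show "\<exists>u. (\<Sum>s\<in>S. of_rat (u s) * s) = 0 \<and> (\<exists>s\<in>S. u s \<noteq> 0)"
      if "finite S" "card S > card \<B>" for S :: "'a set"
    proof -
      have "vs.dependent S"
        using that vs.independent_card_le_dim[of S UNIV] vs.dim_UNIV by (auto simp: vs.dimension_def)
      then show ?thesis using vs.dependent_finite[OF that(1)] by auto
    qed
    show "surj f" if "\<And>x y. f (x + y) = f x + f y" "\<And>q x. f (of_rat q * x) = of_rat q * f x" "inj f"
      for f :: "'a \<Rightarrow> 'a"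
    proof (rule vs.linear_inj_imp_surj)
      show "Vector_Spaces.linear (\<lambda>q x. of_rat q * x) (\<lambda>q x. of_rat q * x) f"
        by unfold_locales (use that in \<open>auto simp: algebra_simps\<close>)
    qed (rule that)
  qed
  then show ?thesis by (rule that)
qed

context rat_basis
begin

lemma co_sum: "co (\<Sum>i\<in>I. f i) b = (\<Sum>i\<in>I. co (f i) b)"
proof -
  have "co 0 b = 0" using co_scale[of 0 0 b] by simp
  then show ?thesis by (induction I rule: infinite_finite_induct) (auto simp: co_add)
qed

text \<open>The trace of the field over the rationals, read off the matrix of multiplication by
  \<open>x\<close>.\<close>

definition tr :: "'a \<Rightarrow> rat" where
  "tr x = (\<Sum>b\<in>\<B>. co (x * b) b)"

lemma tr_add: "tr (x + y) = tr x + tr y"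
  by (simp add: tr_def distrib_right co_add sum.distrib)

lemma tr_scale: "tr (of_rat q * x) = q * tr x"
  by (simp add: tr_def mult.assoc co_scale sum_distrib_left)

lemma tr_1: "tr 1 = of_nat (card \<B>)"
  by (simp add: tr_def co_base)

lemma card_basis_pos: "card \<B> > 0"
proof (rule ccontr)
  assume "\<not> card \<B> > 0"
  then have "\<B> = {}" using fin by auto
  then show False using expand[of 1] by simp
qed

text \<open>Every complex eigenvalue of the matrix of multiplication by \<open>x\<close> is a root
  of the monic integer polynomial of \<open>x\<close>. So the trace is both rational and a sum of
  algebraic integers.\<close>

lemma tr_Ints:
  assumes x: "algebraic_int x"
  shows "tr x \<in> \<int>"
proof -
  define n where "n = card \<B>"
  obtain h where h: "bij_betw h {0..<n} \<B>"
    using ex_bij_betw_nat_finite[OF fin] unfolding n_def by auto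
  have hB: "h i \<in> \<B>" if "i < n" for i
    using h that by (auto simp: bij_betw_def)
  define A :: "complex mat" where "A = mat n n (\<lambda>(i,j). of_rat (co (x * h i) (h j)))"
  have A: "A \<in> carrier_mat n n" by (simp add: A_def)
  have "(\<Sum>i<n. A $$ (i,i)) = (\<Sum>i\<in>{0..<n}. of_rat (co (x * h i) (h i)))"
    by (auto simp: A_def intro!: sum.cong)
  also have "\<dots> = (\<Sum>b\<in>\<B>. of_rat (co (x * b) b))"
    by (rule sum.reindex_bij_betw[OF h])
  also have "\<dots> = of_rat (tr x)" by (simp add: tr_def of_rat_sum)
  finally have trA: "(\<Sum>i<n. A $$ (i,i)) = of_rat (tr x)" .
  have "algebraic_int (\<Sum>i<n. A $$ (i,i))"
  proof (rule sum_diag_algebraic_int[OF A])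
    fix e assume "eigenvalue A e"
    then obtain v where v: "v \<in> carrier_vec n" "v \<noteq> 0\<^sub>v n" "A *\<^sub>v v = e \<cdot>\<^sub>v v"
      using A unfolding eigenvalue_def eigenvector_def by auto
    \<comment> \<open>The eigenvector becomes a linear functional on the field, and the eigenvalue
      equation becomes \<open>\<phi> (x * y) = e * \<phi> y\<close>; polynomial relations of
      \<open>x\<close> thus pass to \<open>e\<close>.\<close>
    define \<phi> where "\<phi> y = (\<Sum>j<n. of_rat (co y (h j)) * v $ j)" for y
    have \<phi>_add: "\<phi> (y + z) = \<phi> y + \<phi> z" for y z
      by (simp add: \<phi>_def co_add of_rat_add distrib_right sum.distrib)
    have \<phi>_scale: "\<phi> (of_rat q * y) = of_rat q * \<phi> y" for q y
      by (simp add: \<phi>_def co_scale of_rat_mult mult.assoc sum_distrib_left)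
    have \<phi>_0: "\<phi> 0 = 0" using \<phi>_scale[of 0 0] by simp
    have \<phi>_sum: "\<phi> (\<Sum>i\<in>I. f i) = (\<Sum>i\<in>I. \<phi> (f i))" for f and I :: "'x set"
      by (induction I rule: infinite_finite_induct) (auto simp: \<phi>_add \<phi>_0)
    have \<phi>_int: "\<phi> (of_int k * y) = of_int k * \<phi> y" for k y
      using \<phi>_scale[of "of_int k" y] by simp
    have \<phi>_base: "\<phi> (h i) = v $ i" if i: "i < n" for i
    proof -
      have "\<phi> (h i) = (\<Sum>j<n. if j = i then v $ j else 0)"
        unfolding \<phi>_def
      proof (rule sum.cong)
        fix j assume "j \<in> {..<n}"
        then have "(h i = h j) = (j = i)"
          using h i by (auto simp: bij_betw_def inj_on_def)
        then show "of_rat (co (h i) (h j)) * v $ j = (if j = i then v $ j else 0)"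
          using co_base[OF hB hB] i \<open>j \<in> {..<n}\<close> by auto
      qed simp
      then show ?thesis using i by simp
    qed
    have \<phi>_ev_base: "\<phi> (x * h i) = e * v $ i" if i: "i < n" for i
    proof -
      have "(A *\<^sub>v v) $ i = (\<Sum>j<n. of_rat (co (x * h i) (h j)) * v $ j)"
        using i v(1) by (auto simp: A_def scalar_prod_def atLeast0LessThan intro!: sum.cong)
      then show ?thesis using v i by (simp add: \<phi>_def)
    qed
    have \<phi>_ev: "\<phi> (x * y) = e * \<phi> y" for y
    proof -
      have y: "y = (\<Sum>j\<in>{0..<n}. of_rat (co y (h j)) * h j)"
        using expand[of y] sum.reindex_bij_betw[OF h, of "\<lambda>b. of_rat (co y b) * b"] by simp
      have "\<phi> (x * y) = \<phi> (\<Sum>j\<in>{0..<n}. of_rat (co y (h j)) * (x * h j))"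
        by (subst y) (simp add: sum_distrib_left ac_simps)
      also have "\<dots> = (\<Sum>j\<in>{0..<n}. of_rat (co y (h j)) * (e * v $ j))"
        unfolding \<phi>_sum \<phi>_scale using \<phi>_ev_base by (intro sum.cong) auto
      also have "\<dots> = e * \<phi> y"
        by (simp add: \<phi>_def sum_distrib_left ac_simps atLeast0LessThan)
      finally show ?thesis .
    qed
    have \<phi>_pow: "\<phi> (x ^ k * y) = e ^ k * \<phi> y" for k y
      by (induction k) (auto simp: \<phi>_ev mult.assoc)
    obtain p :: "int poly" where p: "poly (map_poly of_int p) x = 0" "lead_coeff p = 1"
      using x unfolding algebraic_int_altdef_ipoly by auto
    \<comment> \<open>A nonzero entry of \<open>v\<close> gives a basis element at which
      \<open>\<phi>\<close> does not vanish, so this value can be cancelled.\<close>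
    obtain i where i: "i < n" "v $ i \<noteq> 0"
      using v(1,2) by (metis carrier_vecD dim_vec eq_vecI index_zero_vec)
    have "0 = \<phi> (poly (map_poly of_int p) x * h i)" by (simp add: p \<phi>_0)
    also have "\<dots> = \<phi> (\<Sum>k\<le>degree p. of_int (Polynomial.coeff p k) * (x ^ k * h i))"
      by (simp add: poly_altdef degree_map_poly coeff_map_poly sum_distrib_right mult.assoc)
    also have "\<dots> = (\<Sum>k\<le>degree p. of_int (Polynomial.coeff p k) * (e ^ k * v $ i))"
      unfolding \<phi>_sum \<phi>_int \<phi>_pow using \<phi>_base[OF i(1)] by simp
    also have "\<dots> = poly (map_poly of_int p) e * v $ i"
      by (simp add: poly_altdef degree_map_poly coeff_map_poly sum_distrib_right mult.assoc)
    finally have "poly (map_poly of_int p) e = 0" using i by simp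
    then show "algebraic_int e" using p(2) unfolding algebraic_int_altdef_ipoly by auto
  qed
  then have "(of_rat (tr x) :: complex) \<in> \<int>"
    unfolding trA by (intro rational_algebraic_int_is_int) auto
  then obtain k where "(of_rat (tr x) :: complex) = of_rat (of_int k)"
    by (auto elim: Ints_cases)
  then show ?thesis by (simp only: of_rat_eq_iff) simp
qed

text \<open>A common denominator \<open>D\<close> of the matrix of multiplication by
  \<open>x\<close> makes the integer span of the basis stable under \<open>D * x\<close>.\<close>

lemma ex_int_multiple_algebraic_int:
  fixes x :: 'a
  obtains N :: int where "N > 0" "algebraic_int (of_int N * x)"
proof -
  obtain D :: int where D: "D > 0" "\<forall>q\<in>(\<lambda>(b,b'). co (x * b) b') ` (\<B> \<times> \<B>). of_int D * q \<in> \<int>"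
    using rat_common_denominator[of "(\<lambda>(b,b'). co (x * b) b') ` (\<B> \<times> \<B>)"] fin by auto
  have "of_int D * x * b \<in> zspan \<B>" if b: "b \<in> \<B>" for b
  proof -
    have "of_int D * (of_rat (co (x * b) b') * b') \<in> zspan \<B>" if b': "b' \<in> \<B>" for b'
    proof -
      obtain k where "of_int D * co (x * b) b' = of_int k" using D(2) b b' by (force elim: Ints_cases)
      then have "(of_rat (of_int D * co (x * b) b') :: 'a) = of_int k" by simp
      then have "of_int D * (of_rat (co (x * b) b') * b') = of_int k * b'"
        by (simp only: of_rat_mult of_rat_of_int_eq mult.assoc[symmetric])
      then show ?thesis by (simp only: zspan_of_int[OF zspan_base[OF fin b']])
    qed
    then have "(\<Sum>b'\<in>\<B>. of_int D * (of_rat (co (x * b) b') * b')) \<in> zspan \<B>" by (rule zspan_sum)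
    then show ?thesis using expand[of "x * b"] by (simp add: sum_distrib_left[symmetric] mult.assoc)
  qed
  moreover obtain b where "b \<in> \<B>" "b \<noteq> 0" using expand[of 1] by (metis mult_zero_right sum.neutral zero_neq_one)
  ultimately have "algebraic_int (of_int D * x)" by (intro algebraic_int_if_zspan_stable[OF fin])
  then show ?thesis using that D(1) by blast
qed

lemma ex_common_int_multiple:
  assumes "finite S" and "\<And>x. \<exists>N::int. N > 0 \<and> of_int N * x \<in> M"
    and "\<And>k x. x \<in> M \<Longrightarrow> of_int k * x \<in> M"
  shows "\<exists>N::int. N > 0 \<and> (\<forall>x\<in>S. of_int N * x \<in> (M :: 'a set))"
  using assms(1)
proof (induction S)
  case empty then show ?case by (auto intro: exI[of _ 1])
next
  case (insert x S)
  then obtain N where N: "N > 0" "\<forall>x\<in>S. of_int N * x \<in> M" by auto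
  obtain N' where N': "N' > 0" "of_int N' * x \<in> M" using assms(2) by auto
  have "of_int (N * N') * y \<in> M" if "y \<in> insert x S" for y
    using that assms(3)[of "of_int N' * y" N] assms(3)[of "of_int N * y" N'] N N'
    by (auto simp: ac_simps)
  then show ?case using N N' by (intro exI[of _ "N * N'"]) auto
qed

text \<open>Nondegeneracy of the trace form needs only \<open>tr 1 \<noteq> 0\<close>; dualizing with respect to it bounds the
  denominators of the algebraic integers.\<close>

lemma algebraic_ints_in_zspan:
  obtains C :: "'a set" where "finite C" "{x. algebraic_int x} \<subseteq> zspan C"
proof -
  \<comment> \<open>\<open>f\<close> encodes the trace pairing with the basis; its injectivity is
    the nondegeneracy of the trace form.\<close>
  define f where "f y = (\<Sum>b\<in>\<B>. of_rat (tr (y * b)) * b)" for y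
  have f_add: "f (x + y) = f x + f y" for x y
    by (simp add: f_def distrib_right tr_add of_rat_add sum.distrib)
  have f_scale: "f (of_rat q * x) = of_rat q * f x" for q x
    by (simp add: f_def mult.assoc tr_scale of_rat_mult sum_distrib_left)
  have tr_sum: "tr (\<Sum>i\<in>I. g i) = (\<Sum>i\<in>I. tr (g i))" for g and I :: "'a set"
    using tr_scale[of 0 0] by (induction I rule: infinite_finite_induct) (auto simp: tr_add)
  have f_0: "y = 0" if "f y = 0" for y
  proof (rule ccontr)
    assume y: "y \<noteq> 0"
    have tr0: "tr (y * b) = 0" if b: "b \<in> \<B>" for b
    proof -
      have "co (f y) b = (\<Sum>b'\<in>\<B>. if b' = b then tr (y * b') else 0)"
        unfolding f_def co_sum co_scale using co_base b by (intro sum.cong) auto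
      then have "co (f y) b = tr (y * b)" using b fin by simp
      then show ?thesis using \<open>f y = 0\<close> co_scale[of 0 0 b] by simp
    qed
    \<comment> \<open>A \<open>y\<close> orthogonal to the basis is orthogonal to its own inverse,
      so \<open>tr 1\<close> would vanish.\<close>
    have "y * inverse y = (\<Sum>b\<in>\<B>. of_rat (co (inverse y) b) * (y * b))"
      by (subst expand[of "inverse y"]) (simp add: sum_distrib_left ac_simps)
    then have "tr (y * inverse y) = (\<Sum>b\<in>\<B>. co (inverse y) b * tr (y * b))"
      by (simp only: tr_sum tr_scale)
    then have "tr 1 = (\<Sum>b\<in>\<B>. co (inverse y) b * tr (y * b))" using y by simp
    then show False using tr0 tr_1 card_basis_pos by simp
  qed
  have "inj f"
  proof (rule injI)
    fix x y assume "f x = f y"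
    then have "f (x + of_rat (-1) * y) = 0" unfolding f_add f_scale by simp
    then show "x = y" using f_0[of "x + of_rat (-1) * y"] by simp
  qed
  then have "surj f" using inj_imp_surj[of f] f_add f_scale by blast
  \<comment> \<open>\<open>d\<close> is the basis dual to \<open>\<B>\<close> for the trace form:
    the coordinates of \<open>y\<close> with respect to it are the numbers
    \<open>tr (y * b)\<close>.\<close>
  then obtain d where d: "f (d b) = b" for b by (metis surjD)
  obtain M :: int where M: "M > 0" "\<forall>b\<in>\<B>. algebraic_int (of_int M * b)"
  proof -
    have "\<exists>N::int. N > 0 \<and> (\<forall>b\<in>\<B>. of_int N * b \<in> {x. algebraic_int x})"
    proof (rule ex_common_int_multiple[OF fin])
      show "\<exists>N::int. N > 0 \<and> of_int N * x \<in> {x. algebraic_int x}" for x :: 'a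
        using ex_int_multiple_algebraic_int[of x] by (metis mem_Collect_eq)
    qed (auto intro: algebraic_int_mult int_imp_algebraic_int)
    then show ?thesis using that by auto
  qed
  \<comment> \<open>As \<open>of_int M * b\<close> is integral, \<open>tr (y * b)\<close> has a
    denominator dividing \<open>M\<close> for every integral \<open>y\<close>. Dividing the dual
    basis by \<open>M\<close> turns the coordinates into integers.\<close>
  define C where "C = (\<lambda>b. d b / of_int M) ` \<B>"
  have "y \<in> zspan C" if y: "algebraic_int y" for y
  proof -
    have "f (\<Sum>b\<in>B'. of_rat (u b) * d b) = (\<Sum>b\<in>B'. of_rat (u b) * b)" if "finite B'" for u B'
      using that f_scale[of 0 0] by (induction B') (auto simp: f_add f_scale d)
    then have "f (\<Sum>b\<in>\<B>. of_rat (tr (y * b)) * d b) = f y"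
      using fin by (simp add: f_def)
    then have eq: "y = (\<Sum>b\<in>\<B>. of_rat (tr (y * b)) * d b)"
      using \<open>inj f\<close> by (metis injD)
    have "of_rat (tr (y * b)) * d b \<in> zspan C" if b: "b \<in> \<B>" for b
    proof -
      have "tr (y * (of_int M * b)) \<in> \<int>"
        using M(2) b y by (intro tr_Ints[OF algebraic_int_mult[OF y]]) auto
      moreover have "tr (y * (of_int M * b)) = of_int M * tr (y * b)"
        using tr_scale[of "of_int M" "y * b"] by (simp add: ac_simps)
      ultimately obtain k where "of_int M * tr (y * b) = of_int k" by (auto elim: Ints_cases)
      then have "tr (y * b) = of_int k / of_int M" using M(1) by (simp add: field_simps)
      then have "of_rat (tr (y * b)) * d b = of_int k * (d b / of_int M)"
        by (simp add: of_rat_divide)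
      moreover have "d b / of_int M \<in> zspan C"
        using b fin by (intro zspan_base) (auto simp: C_def)
      ultimately show ?thesis by (simp only: zspan_of_int)
    qed
    then show ?thesis by (subst eq) (rule zspan_sum)
  qed
  then show ?thesis using fin by (intro that[of C]) (auto simp: C_def)
qed

end

subsection \<open>Finite quotients\<close>

locale subring_set =
  fixes R :: "'a::field_char_0 set"
  assumes R0: "0 \<in> R" and R1: "1 \<in> R"
    and R_add: "x \<in> R \<Longrightarrow> y \<in> R \<Longrightarrow> x + y \<in> R"
    and R_mult: "x \<in> R \<Longrightarrow> y \<in> R \<Longrightarrow> x * y \<in> R"
    and R_minus: "x \<in> R \<Longrightarrow> - x \<in> R"
begin

lemma R_diff: "x \<in> R \<Longrightarrow> y \<in> R \<Longrightarrow> x - y \<in> R"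
  using R_add[of x "- y"] R_minus by simp

lemma R_of_nat: "of_nat n \<in> R"
  by (induction n) (auto intro: R0 R1 R_add)

lemma R_of_int: "of_int k \<in> R"
  by (cases k rule: int_diff_cases) (auto intro: R_diff R_of_nat)

lemma R_power: "x \<in> R \<Longrightarrow> x ^ n \<in> R"
  by (induction n) (auto intro: R1 R_mult)

lemma R_sum: "(\<And>i. i \<in> I \<Longrightarrow> f i \<in> R) \<Longrightarrow> (\<Sum>i\<in>I. f i) \<in> R"
  by (induction I rule: infinite_finite_induct) (auto intro: R0 R_add)

lemmas R_intros = R0 R1 R_add R_mult R_minus R_diff R_of_nat R_of_int R_power R_sum

end

text \<open>Negatives come from multiplication by \<open>-1\<close> when \<open>R\<close> is a ring
  (\<open>submod_diff\<close>). The scalars are a parameter because modules over \<open>R\<close>,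
  over the integers, over the integral closure and over local rings occur side by side.\<close>

definition submod :: "'a::field set \<Rightarrow> 'a set \<Rightarrow> bool" where
  "submod R M \<longleftrightarrow> 0 \<in> M \<and> (\<forall>x\<in>M. \<forall>y\<in>M. x + y \<in> M) \<and> (\<forall>r\<in>R. \<forall>x\<in>M. r * x \<in> M)"

lemma submod_0: "submod R M \<Longrightarrow> 0 \<in> M"
  and submod_add: "submod R M \<Longrightarrow> x \<in> M \<Longrightarrow> y \<in> M \<Longrightarrow> x + y \<in> M"
  and submod_mult: "submod R M \<Longrightarrow> r \<in> R \<Longrightarrow> x \<in> M \<Longrightarrow> r * x \<in> M"
  by (auto simp: submod_def)

lemma submod_diff:
  assumes "subring_set R" "submod R M" "x \<in> M" "y \<in> M" shows "x - y \<in> M"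
proof -
  interpret subring_set R by fact
  show ?thesis using submod_add[OF assms(2,3) submod_mult[OF assms(2) R_minus[OF R1] assms(4)]] by simp
qed

lemma submod_Int: "submod R M \<Longrightarrow> submod R N \<Longrightarrow> submod R (M \<inter> N)"
  by (auto simp: submod_def)

lemma submod_mono: "submod R M \<Longrightarrow> S \<subseteq> R \<Longrightarrow> submod S M"
  by (auto simp: submod_def)

definition ideal_of :: "'a::field set \<Rightarrow> 'a set \<Rightarrow> bool" where
  "ideal_of R I \<longleftrightarrow> submod R I \<and> I \<subseteq> R"

definition prime_of :: "'a::field set \<Rightarrow> 'a set \<Rightarrow> bool" where
  "prime_of R P \<longleftrightarrow> ideal_of R P \<and> P \<noteq> {0} \<and> 1 \<notin> P \<and>
     (\<forall>x\<in>R. \<forall>y\<in>R. x * y \<in> P \<longrightarrow> x \<in> P \<or> y \<in> P)"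

locale nf_subring = rat_basis \<B> co + subring_set R
  for \<B> :: "'a::field_char_0 set" and co and R :: "'a set" +
  assumes frac: "\<exists>a\<in>R. \<exists>b\<in>R - {0}. x = a / b"
begin

lemma ideal_of_eq_iff: "ideal_of R I \<Longrightarrow> 1 \<in> I \<longleftrightarrow> I = R"
  using R1 by (auto simp: ideal_of_def submod_def) (metis mult.right_neutral)

text \<open>For a suitable integer \<open>k\<close> the quotient \<open>k / b\<close> is an
  algebraic integer. Its monic equation multiplied by \<open>b ^ m\<close> reads
  \<open>k ^ m = b * r\<close>, where \<open>r\<close> is an integer polynomial in \<open>b\<close>
  and therefore stays in \<open>R\<close>.\<close>

lemma ex_int_multiple_of:
  assumes b: "b \<in> R" "b \<noteq> 0"
  obtains n :: nat and r where "n > 0" "r \<in> R" "of_nat n = b * r"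
proof -
  obtain k :: int where k: "k > 0" "algebraic_int (of_int k * inverse b)"
    using ex_int_multiple_algebraic_int by auto
  obtain m and c :: "nat \<Rightarrow> int"
    where m: "m > 0" "(of_int k * inverse b) ^ m = (\<Sum>i<m. of_int (c i) * (of_int k * inverse b) ^ i)"
    using algebraic_int_power_eq[OF k(2)] by metis
  define r where "r = (\<Sum>i<m. of_int (c i) * of_int k ^ i * b ^ (m - 1 - i))"
  have "of_int k ^ m = (of_int k * inverse b) ^ m * b ^ m"
    using b by (simp add: power_mult_distrib[symmetric] mult.assoc)
  also have "\<dots> = (\<Sum>i<m. of_int (c i) * (of_int k * inverse b) ^ i * b ^ m)"
    unfolding m(2) by (simp add: sum_distrib_right)
  also have "\<dots> = (\<Sum>i<m. b * (of_int (c i) * of_int k ^ i * b ^ (m - 1 - i)))"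
  proof (rule sum.cong)
    fix i assume "i \<in> {..<m}"
    then have "m = i + Suc (m - 1 - i)" by simp
    then have "b ^ m = b ^ i * (b * b ^ (m - 1 - i))" by (metis power_add power_Suc)
    moreover have "inverse b ^ i * b ^ i = 1" using b by (simp add: power_mult_distrib[symmetric])
    ultimately show "of_int (c i) * (of_int k * inverse b) ^ i * b ^ m =
        b * (of_int (c i) * of_int k ^ i * b ^ (m - 1 - i))"
      by (simp add: power_mult_distrib)
  qed simp
  also have "\<dots> = b * r" by (simp add: r_def sum_distrib_left)
  finally have eq: "of_int k ^ m = b * r" .
  have "of_nat (nat (k ^ m)) = b * r"
    using k(1) eq by (simp flip: of_int_power add: of_nat_nat)
  moreover have "r \<in> R" unfolding r_def using b by (intro R_intros)
  ultimately show ?thesis using k(1) by (intro that[of "nat (k ^ m)" r]) auto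
qed

lemma ex_int_multiple_in_R: "\<exists>N::int. N > 0 \<and> of_int N * x \<in> R"
proof -
  obtain a b where ab: "a \<in> R" "b \<in> R" "b \<noteq> 0" "x = a / b" using frac[of x] by auto
  obtain n :: nat and r where n: "n > 0" "r \<in> R" "of_nat n = b * r"
    using ex_int_multiple_of[OF ab(2,3)] by metis
  have "of_nat n * x = a * r" unfolding n(3) using ab by simp
  then show ?thesis using n ab by (intro exI[of _ "int n"]) (auto intro: R_intros)
qed

text \<open>Denominators exist element by element because the field is the fraction field of
  \<open>R\<close>; finite generation of the algebraic integers makes one of them uniform.\<close>

lemma ex_int_conductor: "\<exists>N::int. N > 0 \<and> (\<forall>y. algebraic_int y \<longrightarrow> of_int N * y \<in> R)"
proof -
  obtain C where C: "finite C" "{x::'a. algebraic_int x} \<subseteq> zspan C" by (rule algebraic_ints_in_zspan)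
  obtain N :: int where N: "N > 0" "\<forall>x\<in>C. of_int N * x \<in> R"
    using ex_common_int_multiple[OF C(1) ex_int_multiple_in_R R_mult[OF R_of_int]] by auto
  have "zspan C \<subseteq> {x. of_int N * x \<in> R}"
  proof (rule zspan_minimal)
    fix k :: int and b assume "b \<in> C"
    then have "of_int k * (of_int N * b) \<in> R" using N by (auto intro: R_mult[OF R_of_int])
    then show "of_int k * b \<in> {x. of_int N * x \<in> R}" by (simp add: ac_simps)
  qed (auto simp: distrib_left intro: R_intros)
  then show ?thesis using N(1) C(2) by blast
qed

section \<open>The rank of \<open>R\<close> modulo a prime number\<close>

text \<open>Linear independence in \<open>R / p R\<close> over the field with \<open>p\<close>
  elements, expressed with integer coefficients.\<close>

definition indep_mod :: "nat \<Rightarrow> 'a set \<Rightarrow> bool" where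
  "indep_mod p S \<longleftrightarrow> finite S \<and> S \<subseteq> R \<and>
     (\<forall>c::'a \<Rightarrow> int. (\<exists>r\<in>R. (\<Sum>s\<in>S. of_int (c s) * s) = of_nat p * r) \<longrightarrow> (\<forall>s\<in>S. int p dvd c s))"

text \<open>More than \<open>card \<B>\<close> elements satisfy a rational relation, which scales to
  an integral one with value 0. Independence modulo \<open>p\<close> makes its coefficients
  divisible by \<open>p\<close>; dividing and repeating makes them divisible by every power of
  \<open>p\<close>, so they vanish.\<close>

lemma indep_mod_card:
  assumes p: "prime p" and S: "indep_mod p S"
  shows "card S \<le> card \<B>"
proof (rule ccontr)
  assume "\<not> card S \<le> card \<B>"
  have fS: "finite S" using S by (simp add: indep_mod_def)
  then obtain u where u: "(\<Sum>s\<in>S. of_rat (u s) * s) = 0" "\<exists>s\<in>S. u s \<noteq> 0"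
    using dependent[of S] \<open>\<not> card S \<le> card \<B>\<close> by auto
  have "\<exists>D::int. D > 0 \<and> (\<forall>s\<in>S. of_int D * u s \<in> \<int>)"
    using rat_common_denominator[of "u ` S"] fS by auto
  then obtain D :: int where D: "D > 0" "\<forall>s\<in>S. \<exists>k. of_int D * u s = of_int k"
    by (metis Ints_cases)
  then obtain c where c: "\<forall>s\<in>S. of_int D * u s = of_int (c s)" by metis
  have c': "of_int (c s) = (of_int D :: 'a) * of_rat (u s)" if "s \<in> S" for s
    using c that by (metis of_rat_mult of_rat_of_int_eq)
  have c0: "(\<Sum>s\<in>S. of_int (c s) * s) = 0"
  proof -
    have "(\<Sum>s\<in>S. of_int (c s) * s) = of_int D * (\<Sum>s\<in>S. of_rat (u s) * s)"
      unfolding sum_distrib_left by (intro sum.cong) (auto simp: c')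
    then show ?thesis using u by simp
  qed
  have "\<forall>s\<in>S. int p ^ k dvd c s" for k
  proof (induction k)
    case (Suc k)
    have "of_nat p ^ k * (\<Sum>s\<in>S. of_int (c s div int p ^ k) * s) = (\<Sum>s\<in>S. of_int (c s) * s)"
      unfolding sum_distrib_left
    proof (rule sum.cong)
      fix s assume "s \<in> S"
      then have "int p ^ k * (c s div int p ^ k) = c s" using Suc by simp
      then have "(of_int (int p ^ k * (c s div int p ^ k)) :: 'a) = of_int (c s)" by (rule arg_cong)
      then show "of_nat p ^ k * (of_int (c s div int p ^ k) * s) = of_int (c s) * s"
        by (simp add: mult.assoc[symmetric])
    qed simp
    then have "(\<Sum>s\<in>S. of_int (c s div int p ^ k) * s) = of_nat p * 0"
      using c0 p by (auto simp: prime_gt_0_nat dest: prime_gt_0_nat)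
    then have "\<forall>s\<in>S. int p dvd c s div int p ^ k"
      using S R0 unfolding indep_mod_def by meson
    show ?case
    proof
      fix s assume "s \<in> S"
      then have "int p ^ k * int p dvd int p ^ k * (c s div int p ^ k)"
        using \<open>\<forall>s\<in>S. int p dvd c s div int p ^ k\<close> by (intro mult_dvd_mono) auto
      moreover have "int p ^ k * (c s div int p ^ k) = c s" using Suc \<open>s \<in> S\<close> by simp
      ultimately show "int p ^ Suc k dvd c s" by (simp add: mult.commute)
    qed
  qed simp
  then have "c s = 0" if "s \<in> S" for s
  proof -
    \<comment> \<open>With the absolute value itself as exponent, \<open>2 ^ k > k\<close> already
      makes \<open>p ^ k\<close> too large to divide a nonzero \<open>c s\<close>.\<close>
    define k where "k = nat \<bar>c s\<bar>"
    have "k < 2 ^ k" by (rule less_exp)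
    also have "(2::nat) ^ k \<le> p ^ k" using prime_ge_2_nat[OF p] by (rule power_mono) simp
    finally have "int k < int (p ^ k)" by (simp only: of_nat_less_iff)
    then have "\<bar>c s\<bar> < int p ^ k" by (simp add: k_def)
    moreover have "int p ^ k dvd \<bar>c s\<bar>"
      using \<open>\<And>k. \<forall>s\<in>S. int p ^ k dvd c s\<close> that by simp
    ultimately have "\<not> \<bar>c s\<bar> > 0" using zdvd_imp_le by fastforce
    then show ?thesis by simp
  qed
  then show False using u(2) c D(1) by fastforce
qed

text \<open>A maximal independent set spans \<open>R / p R\<close>, so its combinations with
  coefficients from 0 to \<open>p - 1\<close> meet every class.\<close>

lemma finite_reps_prime:
  assumes p: "prime p"
  shows "\<exists>F. finite F \<and> F \<subseteq> R \<and> (\<forall>x\<in>R. \<exists>y\<in>F. \<exists>r\<in>R. x = y + of_nat p * r)"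
proof -
  have "indep_mod p {}" by (simp add: indep_mod_def)
  then obtain S where S: "indep_mod p S" "\<And>S'. indep_mod p S' \<Longrightarrow> card S' \<le> card S"
    using ex_has_greatest_nat[of "indep_mod p" "{}" card "Suc (card \<B>)"] indep_mod_card[OF p]
    by (metis less_Suc_eq_le)
  have fS: "finite S" and SR: "S \<subseteq> R" using S by (auto simp: indep_mod_def)
  define F where "F = (\<lambda>c. \<Sum>s\<in>S. of_int (c s) * s) ` (S \<rightarrow>\<^sub>E {0..<int p})"
  have "finite F" using fS by (auto simp: F_def intro!: finite_PiE)
  moreover have "F \<subseteq> R" using SR by (auto simp: F_def intro!: R_intros)
  moreover have comb: "\<exists>y\<in>F. \<exists>r\<in>R. (\<Sum>s\<in>S. of_int (c s) * s) = y + of_nat p * r" for c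
  proof -
    define y where "y = (\<Sum>s\<in>S. of_int (c s mod int p) * s)"
    define r where "r = (\<Sum>s\<in>S. of_int (c s div int p) * s)"
    have "(\<Sum>s\<in>S. of_int (c s) * s) = (\<Sum>s\<in>S. of_int (c s mod int p) * s + of_nat p * (of_int (c s div int p) * s))"
    proof (rule sum.cong)
      fix s assume "s \<in> S"
      have "of_int (c s) = (of_int (c s mod int p + int p * (c s div int p)) :: 'a)" by simp
      then have "of_int (c s) = of_int (c s mod int p) + (of_nat p * of_int (c s div int p) :: 'a)"
        by (simp only: of_int_add of_int_mult of_int_of_nat_eq)
      then show "of_int (c s) * s = of_int (c s mod int p) * s + of_nat p * (of_int (c s div int p) * s)"
        by (simp add: algebra_simps)
    qed simp
    then have "(\<Sum>s\<in>S. of_int (c s) * s) = y + of_nat p * r"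
      by (simp add: y_def r_def sum.distrib sum_distrib_left)
    moreover have "y \<in> F" unfolding y_def F_def
      by (intro image_eqI[of _ _ "\<lambda>s\<in>S. c s mod int p"]) (use p in \<open>auto simp: prime_gt_0_nat intro!: sum.cong\<close>)
    moreover have "r \<in> R" using SR by (auto simp: r_def intro!: R_intros)
    ultimately show ?thesis by blast
  qed
  moreover have "\<exists>y\<in>F. \<exists>r\<in>R. x = y + of_nat p * r" if x: "x \<in> R" for x
  proof (cases "x \<in> S")
    case True
    have "x = (\<Sum>s\<in>S. of_int (if s = x then 1 else 0) * s)"
      using True fS by (simp add: if_distrib[where f = "\<lambda>x. x * _"] if_distrib[where f = of_int] cong: if_cong)
    then show ?thesis using comb by metis
  next
    case False
    \<comment> \<open>Maximality gives a relation involving \<open>x\<close>. Its coefficient at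
      \<open>x\<close> is prime to \<open>p\<close>, since otherwise \<open>S\<close> itself would
      be dependent, and Bezout then solves for \<open>x\<close> modulo \<open>p\<close>.\<close>
    have "\<not> indep_mod p (insert x S)"
      using S(2)[of "insert x S"] False fS by auto
    then obtain c r where c: "r \<in> R" "(\<Sum>s\<in>insert x S. of_int (c s) * s) = of_nat p * r"
        "\<not> (\<forall>s\<in>insert x S. int p dvd c s)"
      using x fS SR unfolding indep_mod_def by auto
    have eq: "of_int (c x) * x = of_nat p * r - (\<Sum>s\<in>S. of_int (c s) * s)"
      using c(2) False fS by (simp add: eq_diff_eq)
    have "\<not> int p dvd c x"
    proof
      assume d: "int p dvd c x"
      then obtain k where k: "c x = int p * k" by blast
      have "(\<Sum>s\<in>S. of_int (c s) * s) = of_nat p * (r - of_int k * x)"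
        using eq by (simp add: k algebra_simps)
      moreover have "r - of_int k * x \<in> R" using c(1) x by (intro R_intros)
      ultimately have "\<forall>s\<in>S. int p dvd c s" using S(1) unfolding indep_mod_def by blast
      then show False using c(3) d by auto
    qed
    then have "coprime (int p) (c x)" using p by (simp add: prime_imp_coprime)
    then have "gcd (int p) (c x) = 1" by simp
    then obtain t e where "t * int p + e * c x = 1"
      using bezout_int[of "int p" "c x"] by auto
    then have "c x * e + int p * t = 1" by (simp add: ac_simps)
    then have "(of_int (c x * e + int p * t) :: 'a) = 1" by simp
    then have et: "of_int (c x) * of_int e + of_nat p * of_int t = (1::'a)" by simp
    have "x = (of_int (c x) * of_int e + of_nat p * of_int t) * x" by (simp add: et)
    also have "\<dots> = of_int e * (of_int (c x) * x) + of_nat p * (of_int t * x)" by (simp add: algebra_simps)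
    also have "\<dots> = (\<Sum>s\<in>S. of_int (- e * c s) * s) + of_nat p * (of_int e * r + of_int t * x)"
      unfolding eq by (simp add: algebra_simps sum_distrib_left sum_negf)
    finally have x': "x = (\<Sum>s\<in>S. of_int (- e * c s) * s) + of_nat p * (of_int e * r + of_int t * x)" .
    obtain y r' where "y \<in> F" "r' \<in> R" "(\<Sum>s\<in>S. of_int (- e * c s) * s) = y + of_nat p * r'"
      using comb[of "\<lambda>s. - e * c s"] by auto
    then have "x = y + of_nat p * (r' + (of_int e * r + of_int t * x))"
      using x' by (simp add: distrib_left add.assoc)
    moreover have "r' + (of_int e * r + of_int t * x) \<in> R"
      using c(1) x \<open>r' \<in> R\<close> by (intro R_intros)
    ultimately show ?thesis using \<open>y \<in> F\<close> by blast
  qed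
  ultimately show ?thesis by (intro exI[of _ F]) simp
qed

text \<open>Modulo \<open>n = p * m\<close> the two-digit expansions \<open>y + p * z\<close> are
  representatives, with \<open>y\<close> taken modulo \<open>p\<close> and \<open>z\<close> modulo
  \<open>m\<close>.\<close>

lemma finite_reps:
  "n > 0 \<Longrightarrow> \<exists>F. finite F \<and> F \<subseteq> R \<and> (\<forall>x\<in>R. \<exists>y\<in>F. \<exists>r\<in>R. x = y + of_nat n * r)"
proof (induction n rule: less_induct)
  case (less n)
  show ?case
  proof (cases "n = 1")
    case True
    then show ?thesis by (intro exI[of _ "{0}"]) (auto intro: R_intros)
  next
    case False
    then obtain p where p: "prime p" "p dvd n" using prime_factor_nat by blast
    then obtain m where m: "n = p * m" by blast
    then have "m > 0" "m < n" using less.prems prime_gt_1_nat[OF p(1)] by auto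
    then obtain F where F: "finite F" "F \<subseteq> R" "\<forall>x\<in>R. \<exists>y\<in>F. \<exists>r\<in>R. x = y + of_nat m * r"
      using less.IH[of m] by auto
    obtain G where G: "finite G" "G \<subseteq> R" "\<forall>x\<in>R. \<exists>y\<in>G. \<exists>r\<in>R. x = y + of_nat p * r"
      using finite_reps_prime[OF p(1)] by auto
    define H where "H = (\<lambda>(y,z). y + of_nat p * z) ` (G \<times> F)"
    have "\<exists>y\<in>H. \<exists>r\<in>R. x = y + of_nat n * r" if x: "x \<in> R" for x
    proof -
      obtain y r where y: "y \<in> G" "r \<in> R" "x = y + of_nat p * r" using G x by blast
      obtain z s where z: "z \<in> F" "s \<in> R" "r = z + of_nat m * s" using F y by blast
      have "x = (y + of_nat p * z) + of_nat n * s" using y z m by (simp add: algebra_simps)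
      moreover have "y + of_nat p * z \<in> H" using y z by (auto simp: H_def)
      ultimately show ?thesis using z by blast
    qed
    moreover have "finite H" using F G by (auto simp: H_def)
    moreover have "H \<subseteq> R" using F G unfolding H_def by (auto intro!: R_add R_mult R_of_nat)
    ultimately show ?thesis by (intro exI[of _ H]) simp
  qed
qed

end

subsection \<open>Products of ideals\<close>

text \<open>The factors are arbitrary subsets of the field, so the extension of an ideal to a larger
  ring is its product with that ring.\<close>

abbreviation imul :: "'a::field set \<Rightarrow> 'a set \<Rightarrow> 'a set" (infixl \<open>\<star>\<close> 70) where
  "I \<star> J \<equiv> ideal_prod (ring_on UNIV) I J"

lemma imulI: "x \<in> I \<Longrightarrow> y \<in> J \<Longrightarrow> x * y \<in> I \<star> J"
  using ideal_prod.prod[of x I y J "ring_on UNIV"] by (simp add: ring_on_def)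

lemma imul_add: "x \<in> I \<star> J \<Longrightarrow> y \<in> I \<star> J \<Longrightarrow> x + y \<in> I \<star> J"
  using ideal_prod.sum[of x "ring_on UNIV" I J y] by (simp add: ring_on_def)

lemma imul_induct [consumes 1, case_names prod add]:
  assumes "x \<in> I \<star> J" "\<And>a b. a \<in> I \<Longrightarrow> b \<in> J \<Longrightarrow> Q (a * b)"
    and "\<And>x y. x \<in> I \<star> J \<Longrightarrow> y \<in> I \<star> J \<Longrightarrow> Q x \<Longrightarrow> Q y \<Longrightarrow> Q (x + y)"
  shows "Q x"
  using assms(1) by (induction rule: ideal_prod.induct) (use assms in \<open>auto simp: ring_on_def\<close>)

lemma imul_subset:
  assumes "submod R M" "\<And>a b. a \<in> I \<Longrightarrow> b \<in> J \<Longrightarrow> a * b \<in> M"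
  shows "I \<star> J \<subseteq> M"
proof
  fix x assume "x \<in> I \<star> J"
  then show "x \<in> M" by (induction rule: imul_induct) (use assms in \<open>auto intro: submod_add\<close>)
qed

lemma imul_mono: "I \<subseteq> I' \<Longrightarrow> J \<subseteq> J' \<Longrightarrow> I \<star> J \<subseteq> I' \<star> J'"
proof
  fix x assume "I \<subseteq> I'" "J \<subseteq> J'" "x \<in> I \<star> J"
  from this(3,1,2) show "x \<in> I' \<star> J'"
    by (induction rule: imul_induct) (auto intro: imulI imul_add)
qed

lemma imul_commute: "I \<star> J = J \<star> I"
proof -
  have "A \<star> B \<subseteq> B \<star> A" for A B :: "'a set"
  proof
    fix x assume "x \<in> A \<star> B" then show "x \<in> B \<star> A"
    proof (induction rule: imul_induct)
      case (prod a b) then show ?case using imulI[of b B a A] by (simp add: mult.commute)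
    qed (auto intro: imul_add)
  qed
  then show ?thesis by blast
qed

text \<open>One inclusion suffices: reversing the three factors by commutativity turns it into the
  other.\<close>

lemma imul_assoc: "I \<star> J \<star> K = I \<star> (J \<star> K)"
proof -
  have le: "A \<star> B \<star> C \<subseteq> A \<star> (B \<star> C)" for A B C :: "'a set"
  proof
    fix x assume "x \<in> A \<star> B \<star> C" then show "x \<in> A \<star> (B \<star> C)"
    proof (induction rule: imul_induct)
      case (prod y c)
      from prod(1) show ?case
      proof (induction rule: imul_induct)
        case (prod a b)
        then show ?case using imulI[of a A "b * c" "B \<star> C"] imulI[of b B c C] \<open>c \<in> C\<close>
          by (simp add: mult.assoc)
      qed (simp add: distrib_right imul_add)
    qed (auto intro: imul_add)
  qed
  moreover have "I \<star> (J \<star> K) = K \<star> J \<star> I" "I \<star> J \<star> K = K \<star> (J \<star> I)"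
    by (metis imul_commute)+
  ultimately show ?thesis using le[of I J K] le[of K J I] by auto
qed

lemma imul_left_commute: "I \<star> (J \<star> K) = J \<star> (I \<star> K)"
  by (metis imul_assoc imul_commute)

lemmas imul_ac = imul_assoc imul_commute imul_left_commute

lemma submod_imul: "submod R I \<Longrightarrow> 0 \<in> J \<Longrightarrow> submod R (I \<star> J)"
  unfolding submod_def
proof (intro conjI ballI)
  assume I: "0 \<in> I \<and> (\<forall>x\<in>I. \<forall>y\<in>I. x + y \<in> I) \<and> (\<forall>r\<in>R. \<forall>x\<in>I. r * x \<in> I)" and J: "0 \<in> J"
  show "0 \<in> I \<star> J" using imulI[of 0 I 0 J] I J by simp
  fix r x assume r: "r \<in> R" and "x \<in> I \<star> J"
  from this(2) show "r * x \<in> I \<star> J"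
  proof (induction rule: imul_induct)
    case (prod a b)
    then show ?case using imulI[of "r * a" I b J] r I by (simp add: mult.assoc)
  qed (simp add: distrib_left imul_add)
qed (rule imul_add)

lemma submod_imul2: "submod R I \<Longrightarrow> submod R J \<Longrightarrow> submod R (I \<star> J)"
  by (rule submod_imul) (auto simp: submod_def)

context subring_set
begin

lemma submod_R: "submod R R"
  by (auto simp: submod_def intro: R_intros)

lemma ideal_R: "ideal_of R R"
  by (auto simp: ideal_of_def submod_R)

lemma imul_R: "submod R I \<Longrightarrow> R \<star> I = I"
proof
  assume I: "submod R I"
  show "R \<star> I \<subseteq> I" by (rule imul_subset[OF I]) (auto intro: submod_mult[OF I])
  show "I \<subseteq> R \<star> I" using imulI[OF R1] by fastforce
qed

lemma submod_principal: "submod R (principal R x)"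
  unfolding submod_def principal_def
proof (intro conjI ballI)
  show "0 \<in> (*) x ` R" using R0 by (intro image_eqI[of _ _ 0]) auto
qed (auto simp: distrib_left[symmetric] mult.left_commute[of _ x] intro: R_intros)

lemma self_in_principal: "x \<in> principal R x"
  using R1 by (auto simp: principal_def intro!: image_eqI[of _ _ 1])

lemma submod_plus:
  assumes I: "submod R I" and J: "submod R J" shows "submod R {i + j | i j. i \<in> I \<and> j \<in> J}"
  unfolding submod_def
proof (safe, goal_cases)
  case 1 then show ?case using submod_0[OF I] submod_0[OF J] by force
next
  case (2 _ _ i i' j j')
  then show ?case using submod_add[OF I, of i i'] submod_add[OF J, of j j']
    by (intro exI[of _ "i + i'"] exI[of _ "j + j'"]) (simp add: ac_simps)
next
  case (3 r _ i j)
  then show ?case using submod_mult[OF I, of r i] submod_mult[OF J, of r j]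
    by (intro exI[of _ "r * i"] exI[of _ "r * j"]) (simp add: distrib_left)
qed

end

context nf_subring
begin

subsection \<open>Primes\<close>

text \<open>Such an ideal contains a positive integer multiple \<open>n\<close> of \<open>b\<close>,
  hence \<open>n R\<close>, and is determined by its intersection with a finite set of
  representatives modulo \<open>n\<close>.\<close>

lemma finite_ideals_containing:
  assumes b: "b \<in> R" "b \<noteq> 0"
  shows "finite {I. ideal_of R I \<and> b \<in> I}"
proof -
  obtain n :: nat and r where n: "n > 0" "r \<in> R" "of_nat n = b * r"
    using ex_int_multiple_of[OF b] by metis
  obtain F where F: "finite F" "F \<subseteq> R" "\<forall>x\<in>R. \<exists>y\<in>F. \<exists>r\<in>R. x = y + of_nat n * r"
    using finite_reps[OF n(1)] by auto
  have "inj_on (\<lambda>I. I \<inter> F) {I. ideal_of R I \<and> b \<in> I}"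
  proof (rule inj_onI)
    fix I J assume IJ: "I \<in> {I. ideal_of R I \<and> b \<in> I}" "J \<in> {I. ideal_of R I \<and> b \<in> I}" "I \<inter> F = J \<inter> F"
    have "I \<subseteq> J" if I: "ideal_of R I" "b \<in> I" and J: "ideal_of R J" "b \<in> J" and eq: "I \<inter> F = J \<inter> F" for I J
    proof
      fix x assume x: "x \<in> I"
      then obtain y s where y: "y \<in> F" "s \<in> R" "x = y + of_nat n * s"
        using F I(1) unfolding ideal_of_def by blast
      have nI: "of_nat n * s \<in> K" if "ideal_of R K" "b \<in> K" for K
        using that submod_mult[of R K "r * s" b] y(2) n R_mult by (auto simp: ideal_of_def ac_simps)
      have "y = x - of_nat n * s" using y by simp
      then have "y \<in> I" using submod_diff[OF subring_set_axioms, of I x] I x nI[OF I] by (auto simp: ideal_of_def)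
      then have "y \<in> J" using y eq by auto
      then show "x \<in> J" using nI[OF J] J y(3) by (auto simp: ideal_of_def intro: submod_add)
    qed
    then show "I = J" using IJ by blast
  qed
  moreover have "finite ((\<lambda>I. I \<inter> F) ` {I. ideal_of R I \<and> b \<in> I})"
    by (rule finite_subset[of _ "Pow F"]) (use F in auto)
  ultimately show ?thesis by (rule finite_imageD[rotated])
qed

text \<open>The pigeonhole principle stands in for chain conditions: the sequence is descending in
  \<open>prime_unit\<close> and ascending in \<open>bounded_powers_imp_integral\<close>.\<close>

lemma ideal_sequence_repeats:
  fixes I :: "nat \<Rightarrow> 'a set"
  assumes "b \<in> R" "b \<noteq> 0" "\<And>i. ideal_of R (I i)" "\<And>i. b \<in> I i"
  obtains i j where "i < j" "I i = I j"
proof -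
  have "range I \<subseteq> {I. ideal_of R I \<and> b \<in> I}" using assms by auto
  then have "\<not> inj I"
    using finite_ideals_containing[OF assms(1,2)] finite_subset by (metis finite_imageD infinite_UNIV_nat)
  then show ?thesis using that by (metis injI linorder_neqE_nat)
qed

lemma nonzero_ideal_elem: "submod R I \<Longrightarrow> I \<noteq> {0} \<Longrightarrow> \<exists>b\<in>I. b \<noteq> 0"
  using submod_0 by blast

text \<open>Noetherian induction: the number of ideals above a nonzero \<open>I\<close> is finite
  and drops strictly when \<open>I\<close> grows.\<close>

lemma ideal_psubset_induct [consumes 2, case_names step]:
  assumes "ideal_of R I" "I \<noteq> {0}"
    and step: "\<And>I. ideal_of R I \<Longrightarrow> I \<noteq> {0} \<Longrightarrow> (\<And>J. ideal_of R J \<Longrightarrow> I \<subset> J \<Longrightarrow> Q J) \<Longrightarrow> Q I"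
  shows "Q I"
  using assms(1,2)
proof (induction "card {J. ideal_of R J \<and> I \<subseteq> J}" arbitrary: I rule: less_induct)
  case less
  obtain b where b: "b \<in> I" "b \<noteq> 0" using less.prems nonzero_ideal_elem unfolding ideal_of_def by blast
  have "b \<in> R" using b less.prems unfolding ideal_of_def by auto
  have fin: "finite {J. ideal_of R J \<and> I \<subseteq> J}"
    by (rule finite_subset[OF _ finite_ideals_containing[OF \<open>b \<in> R\<close> b(2)]]) (use b in auto)
  show ?case
  proof (rule step[OF less.prems])
    fix J assume J: "ideal_of R J" "I \<subset> J"
    have "{J'. ideal_of R J' \<and> J \<subseteq> J'} \<subset> {J. ideal_of R J \<and> I \<subseteq> J}"
      using J less.prems by blast
    then have "card {J'. ideal_of R J' \<and> J \<subseteq> J'} < card {J. ideal_of R J \<and> I \<subseteq> J}"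
      using fin by (rule psubset_card_mono[rotated])
    moreover have "J \<noteq> {0}" using J b by blast
    ultimately show "Q J" using less.hyps J(1) by blast
  qed
qed

lemma prime_subset_R: "prime_of R P \<Longrightarrow> P \<subseteq> R"
  and prime_submod: "prime_of R P \<Longrightarrow> submod R P"
  and prime_ideal: "prime_of R P \<Longrightarrow> ideal_of R P"
  and prime_1: "prime_of R P \<Longrightarrow> 1 \<notin> P"
  by (auto simp: prime_of_def ideal_of_def)

lemma prime_mult: "prime_of R P \<Longrightarrow> x \<in> R \<Longrightarrow> y \<in> R \<Longrightarrow> x * y \<in> P \<longleftrightarrow> x \<in> P \<or> y \<in> P"
  using submod_mult[of R P x y] submod_mult[of R P y x]
  by (auto simp: prime_of_def ideal_of_def mult.commute)

text \<open>The ideals \<open>P + R x ^ i\<close> share a nonzero element of \<open>P\<close>, so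
  two of them agree. This gives \<open>x ^ i = r * x ^ j\<close> modulo \<open>P\<close> with
  \<open>i < j\<close>, and cancelling \<open>x ^ i\<close> produces an inverse of \<open>x\<close>.
  Thus \<open>R / P\<close> is a field.\<close>

lemma prime_unit:
  assumes P: "prime_of R P" and x: "x \<in> R" "x \<notin> P"
  obtains r where "r \<in> R" "1 - r * x \<in> P"
proof -
  obtain b where b: "b \<in> P" "b \<noteq> 0"
    using P nonzero_ideal_elem unfolding prime_of_def ideal_of_def by blast
  have bR: "b \<in> R" using b prime_subset_R[OF P] by auto
  define I where "I i = {p + j | p j. p \<in> P \<and> j \<in> principal R (x ^ i)}" for i
  have xI: "x ^ i \<in> I i" for i unfolding I_def using submod_0[OF prime_submod[OF P]] self_in_principal[of "x ^ i"] by force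
  have "ideal_of R (I i)" for i
    unfolding ideal_of_def I_def
    using submod_plus[OF prime_submod[OF P] submod_principal] x(1) prime_subset_R[OF P]
    by (auto simp: principal_def intro!: R_intros)
  moreover have "b \<in> I i" for i unfolding I_def using b submod_0[OF submod_principal] by force
  ultimately obtain i j where ij: "i < j" "I i = I j" using ideal_sequence_repeats[OF bR b(2)] by blast
  then obtain p r where pr: "p \<in> P" "r \<in> R" "x ^ i = p + r * x ^ j"
    using xI[of i] unfolding I_def principal_def by (auto simp: mult.commute)
  define k where "k = j - i - 1"
  have "j = i + Suc k" using ij by (simp add: k_def)
  then have "x ^ i * (1 - r * x ^ k * x) = p"
    using pr(3) by (simp add: power_add algebra_simps)
  moreover have "x ^ i \<notin> P"
    by (induction i) (use x R_power prime_1[OF P] prime_mult[OF P] in auto)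
  moreover have "1 - r * x ^ k * x \<in> R" using pr x by (intro R_intros)
  ultimately have "1 - r * x ^ k * x \<in> P" using pr(1) x prime_mult[OF P] R_power by metis
  then show ?thesis using that[of "r * x ^ k"] pr x by (auto intro: R_intros)
qed

lemma prime_maximal:
  assumes P: "prime_of R P" and I: "ideal_of R I" "P \<subseteq> I"
  shows "I = P \<or> I = R"
proof (cases "I \<subseteq> P")
  case True then show ?thesis using I by auto
next
  case False
  then obtain x where x: "x \<in> I" "x \<notin> P" by auto
  then have "x \<in> R" using I by (auto simp: ideal_of_def)
  obtain r where r: "r \<in> R" "1 - r * x \<in> P" using prime_unit[OF P \<open>x \<in> R\<close> x(2)] by auto
  have "(1 - r * x) + r * x \<in> I"
    using I r x by (intro submod_add[of R] submod_mult[of R]) (auto simp: ideal_of_def)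
  then show ?thesis using ideal_of_eq_iff[OF I(1)] by simp
qed

lemma prime_subset_eq: "prime_of R P \<Longrightarrow> prime_of R Q \<Longrightarrow> P \<subseteq> Q \<Longrightarrow> P = Q"
  using prime_maximal[of P Q] prime_ideal prime_1 R1 by blast

lemma prime_contains_nat:
  assumes P: "prime_of R P" obtains n :: nat where "n > 0" "of_nat n \<in> P"
proof -
  obtain b where b: "b \<in> P" "b \<noteq> 0"
    using P nonzero_ideal_elem unfolding prime_of_def ideal_of_def by blast
  then obtain n :: nat and r where n: "n > 0" "r \<in> R" "of_nat n = b * r"
    using ex_int_multiple_of[of b] prime_subset_R[OF P] by blast
  have "of_nat n \<in> P" unfolding n(3) using submod_mult[OF prime_submod[OF P] n(2) b(1)] by (simp add: mult.commute)
  then show ?thesis using that n(1) by blast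
qed

lemma prime_not_both: "prime_of R P \<Longrightarrow> x \<in> P \<Longrightarrow> 1 - x \<in> P \<Longrightarrow> False"
  using submod_add[OF prime_submod, of P x "1 - x"] prime_1 by simp

text \<open>An ideal maximal among the proper ones is prime, and the induction climbs until such an
  ideal is reached.\<close>

lemma ex_prime_containing:
  assumes "ideal_of R I" "I \<noteq> {0}" "1 \<notin> I"
  shows "\<exists>P. prime_of R P \<and> I \<subseteq> P"
  using assms
proof (induction rule: ideal_psubset_induct)
  case (step I)
  show ?case
  proof (cases "\<exists>J. ideal_of R J \<and> I \<subset> J \<and> 1 \<notin> J")
    case True
    then obtain J where J: "ideal_of R J" "I \<subset> J" "1 \<notin> J" by auto
    then show ?thesis using step.IH[of J] by blast
  next
    case False
    have sI: "submod R I" using step by (simp add: ideal_of_def)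
    have "x \<in> I \<or> y \<in> I" if xy: "x \<in> R" "y \<in> R" "x * y \<in> I" for x y
    proof (rule ccontr)
      assume neg: "\<not> (x \<in> I \<or> y \<in> I)"
      define J where "J = {i + j | i j. i \<in> I \<and> j \<in> principal R x}"
      have "submod R J" unfolding J_def by (rule submod_plus[OF sI submod_principal])
      moreover have "J \<subseteq> R" using step xy by (auto simp: J_def ideal_of_def principal_def intro!: R_intros)
      moreover have "I \<subset> J"
      proof
        show "I \<subseteq> J" unfolding J_def using submod_0[OF submod_principal] by force
        have "x \<in> J" unfolding J_def using submod_0[OF sI] self_in_principal[of x] by force
        then show "I \<noteq> J" using neg by auto
      qed
      ultimately have "1 \<in> J" using False by (auto simp: ideal_of_def)
      \<comment> \<open>Multiplying \<open>1 = i + r * x\<close> by \<open>y\<close> puts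
        \<open>y\<close> into \<open>I\<close>.\<close>
      then obtain i r where ir: "i \<in> I" "r \<in> R" "1 = i + r * x"
        by (auto simp: J_def principal_def mult.commute)
      then have "y = y * i + r * (x * y)" by (metis distrib_left mult.commute mult.left_commute mult.right_neutral)
      moreover have "y * i + r * (x * y) \<in> I"
        using submod_add[OF sI submod_mult[OF sI xy(2) ir(1)] submod_mult[OF sI ir(2) xy(3)]] .
      ultimately show False using neg by auto
    qed
    then have "prime_of R I" using step by (auto simp: prime_of_def)
    then show ?thesis by auto
  qed
qed

subsection \<open>Integral elements\<close>

text \<open>If \<open>b\<close> is a denominator of \<open>x\<close> and \<open>m\<close> the degree
  of its equation, then \<open>b ^ m\<close> clears \<open>x ^ n\<close> for \<open>n < m\<close>,
  and the monic equation reduces the higher powers to these.\<close>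

lemma integral_imp_bounded_powers:
  assumes "x \<in> integral_closure R"
  obtains d where "d \<in> R" "d \<noteq> 0" "\<And>n. d * x ^ n \<in> R"
proof -
  obtain p where p: "lead_coeff p = 1" "\<And>i. Polynomial.coeff p i \<in> R" "poly p x = 0"
    using assms by (auto simp: integral_closure_def)
  obtain a b where ab: "a \<in> R" "b \<in> R" "b \<noteq> 0" "x = a / b" using frac[of x] by auto
  define m where "m = degree p"
  have "0 = (\<Sum>i<m. Polynomial.coeff p i * x ^ i) + x ^ m"
    using p(1,3) by (simp add: poly_altdef m_def lessThan_Suc_atMost[symmetric])
  then have xm: "x ^ m = - (\<Sum>i<m. Polynomial.coeff p i * x ^ i)" by (simp add: eq_neg_iff_add_eq_0 add.commute)
  have "b ^ m * x ^ n \<in> R" for n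
  proof (induction n rule: less_induct)
    case (less n)
    show ?case
    proof (cases "n < m")
      case True
      then have "b ^ m = b ^ (m - n) * b ^ n" by (simp add: power_add[symmetric])
      then have "b ^ m * x ^ n = b ^ (m - n) * a ^ n"
        using ab by (simp add: power_divide)
      then show ?thesis using ab by (auto intro: R_intros)
    next
      case False
      then have "x ^ n = x ^ (n - m) * x ^ m" by (simp add: power_add[symmetric])
      then have "b ^ m * x ^ n = - (\<Sum>i<m. Polynomial.coeff p i * (b ^ m * x ^ (n - m + i)))"
        unfolding xm by (simp add: sum_distrib_left power_add ac_simps)
      moreover have "(\<Sum>i<m. Polynomial.coeff p i * (b ^ m * x ^ (n - m + i))) \<in> R"
        using False p(2) by (intro R_sum R_mult less.IH) auto
      ultimately show ?thesis by (auto intro: R_intros)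
    qed
  qed
  then show ?thesis using ab that[of "b ^ m"] by (auto intro: R_intros)
qed

text \<open>The ideals \<open>d (R + R x + ... + R x ^ j)\<close> all contain \<open>d\<close>, so
  two of them coincide. Then \<open>d * x ^ Suc i\<close> is a combination of the lower terms, and
  cancelling \<open>d\<close> leaves a monic equation.\<close>

lemma bounded_powers_imp_integral:
  assumes d: "d \<noteq> 0" "\<And>n. d * x ^ n \<in> R"
  shows "x \<in> integral_closure R"
proof -
  define I where "I j = {d * (\<Sum>i\<le>j. r i * x ^ i) | r :: nat \<Rightarrow> 'a. \<forall>i. r i \<in> R}" for j
  have dR: "d \<in> R" using d(2)[of 0] by simp
  have mem: "d * x ^ i \<in> I j" if "i \<le> j" for i j
  proof -
    have "x ^ i = (\<Sum>k\<le>j. (if k = i then 1 else 0) * x ^ k)"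
      using that by (simp add: if_distrib[where f = "\<lambda>x. x * _"] cong: if_cong)
    then show ?thesis unfolding I_def using R0 R1
      by (intro CollectI exI[of _ "\<lambda>k. if k = i then 1 else 0"]) auto
  qed
  have "ideal_of R (I j)" for j unfolding ideal_of_def
  proof
    show "submod R (I j)" unfolding submod_def I_def
    proof (safe, goal_cases)
      case 1 then show ?case by (intro exI[of _ "\<lambda>_. 0"]) (simp add: R0)
    next
      case (2 _ _ r s)
      then show ?case by (intro exI[of _ "\<lambda>i. r i + s i"]) (auto simp: algebra_simps sum.distrib intro: R_intros)
    next
      case (3 t _ r)
      then show ?case by (intro exI[of _ "\<lambda>i. t * r i"]) (auto simp: sum_distrib_left ac_simps intro: R_intros)
    qed
    show "I j \<subseteq> R"
    proof
      fix y assume "y \<in> I j"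
      then obtain r where r: "\<forall>i. r i \<in> R" "y = d * (\<Sum>i\<le>j. r i * x ^ i)" by (auto simp: I_def)
      have "y = (\<Sum>i\<le>j. r i * (d * x ^ i))" unfolding r(2) sum_distrib_left by (simp add: ac_simps)
      then show "y \<in> R" using r d by (auto intro: R_sum R_mult)
    qed
  qed
  moreover have "d \<in> I j" for j using mem[of 0 j] by simp
  ultimately obtain i j where ij: "i < j" "I i = I j" using ideal_sequence_repeats[OF dR d(1)] by blast
  then have "d * x ^ Suc i \<in> I i" using mem[of "Suc i" j] by simp
  then obtain r where r: "\<forall>i. r i \<in> R" "d * x ^ Suc i = d * (\<Sum>k\<le>i. r k * x ^ k)" by (auto simp: I_def)
  then have eq: "x ^ Suc i = (\<Sum>k\<le>i. r k * x ^ k)" using d(1) by simp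
  define p where "p = Polynomial.monom 1 (Suc i) - (\<Sum>k\<le>i. Polynomial.monom (r k) k)"
  have c: "Polynomial.coeff p k = (if k = Suc i then 1 else if k \<le> i then - r k else 0)" for k
    by (auto simp: p_def coeff_sum)
  have deg: "degree p = Suc i" by (rule antisym[OF degree_le le_degree]) (auto simp: c)
  have "poly p x = 0" using eq by (simp add: p_def poly_sum poly_monom)
  moreover have "Polynomial.coeff p k \<in> R" for k using r(1) by (auto simp: c intro: R_intros)
  moreover have "lead_coeff p = 1" by (simp add: deg c)
  ultimately show ?thesis unfolding integral_closure_def by blast
qed

text \<open>A nonzero element of \<open>I\<close> is a common denominator of the powers of
  \<open>x\<close>, so \<open>x\<close> is integral over \<open>R\<close> and the conductor
  multiplies it into \<open>R\<close>. As \<open>R\<close> need not be integrally closed, this is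
  the substitute for \<open>x\<close> lying in \<open>R\<close>.\<close>

lemma stable_ideal_conductor:
  assumes I: "submod R I" "I \<subseteq> R" "I \<noteq> {0}" and x: "\<And>y. y \<in> I \<Longrightarrow> x * y \<in> I" and c: "c \<in> conductor R"
  shows "c * x \<in> R"
proof -
  obtain d where d: "d \<in> I" "d \<noteq> 0" using I nonzero_ideal_elem by blast
  have "x ^ n * d \<in> I" for n
    by (induction n) (use d x in \<open>auto simp: mult.assoc\<close>)
  then have "x \<in> integral_closure R"
    using d I by (intro bounded_powers_imp_integral[of d]) (auto simp: mult.commute)
  then show ?thesis using c by (auto simp: conductor_def)
qed

lemma R_subset_integral_closure: "R \<subseteq> integral_closure R"
  using R1 by (auto intro!: bounded_powers_imp_integral[of 1] R_intros)

lemma conductor_subset: "conductor R \<subseteq> R"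
proof
  fix x assume "x \<in> conductor R"
  then have "x * 1 \<in> R" using R_subset_integral_closure R1 unfolding conductor_def by blast
  then show "x \<in> R" by simp
qed

lemma submod_conductor: "submod R (conductor R)"
  by (auto simp: submod_def conductor_def distrib_right mult.assoc intro: R_intros)

subsection \<open>Invertibility\<close>

definition inv_of :: "'a set \<Rightarrow> 'a set" where
  "inv_of I = {x. \<forall>y\<in>I. x * y \<in> R}"

lemma submod_inv_of: "submod R (inv_of I)"
  by (auto simp: submod_def inv_of_def distrib_right mult.assoc intro: R_intros)

text \<open>By \<open>reg_prime_iff\<close> these primes are the generators of \<open>J_R\<close>
  for the conductor.\<close>

definition reg_prime :: "'a set \<Rightarrow> bool" where
  "reg_prime P \<longleftrightarrow> prime_of R P \<and> \<not> conductor R \<subseteq> P"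

text \<open>For a nonzero \<open>a\<close> in \<open>P\<close>, the prime \<open>P\<close> is
  associated to \<open>R / a R\<close>: it is the annihilator of the class of some \<open>y\<close>.
  Then \<open>y / a\<close> multiplies \<open>P\<close> into \<open>R\<close> without lying in
  \<open>R\<close>.\<close>

lemma prime_colon_proper:
  assumes P: "prime_of R P"
  obtains x where "x \<notin> R" "\<And>p. p \<in> P \<Longrightarrow> x * p \<in> R"
proof -
  obtain a where a: "a \<in> P" "a \<noteq> 0"
    using P nonzero_ideal_elem unfolding prime_of_def ideal_of_def by blast
  have aR: "a \<in> R" using a prime_subset_R[OF P] by auto
  \<comment> \<open>The annihilator of the class of \<open>y\<close> in \<open>R / a R\<close>. It
    contains \<open>a\<close>, so only finitely many such ideals exist and a maximal one can be
    chosen.\<close>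
  define colon where "colon y = {r\<in>R. \<exists>s\<in>R. r * y = a * s}" for y
  \<comment> \<open>The class of \<open>y\<close> survives localization at \<open>P\<close>. This
    keeps the maximal annihilator inside \<open>P\<close>, and being prime it must then equal
    \<open>P\<close>.\<close>
  define good where "good y \<longleftrightarrow> y \<in> R \<and> (\<forall>s\<in>R - P. s \<notin> colon y)" for y
  have ideal: "ideal_of R (colon y)" if "y \<in> R" for y
    unfolding ideal_of_def submod_def
  proof (intro conjI ballI)
    show "0 \<in> colon y" unfolding colon_def using R0 by force
  next
    fix u v assume "u \<in> colon y" "v \<in> colon y"
    then obtain s t where st: "u \<in> R" "v \<in> R" "s \<in> R" "u * y = a * s" "t \<in> R" "v * y = a * t"
      by (auto simp: colon_def)
    then have "(u + v) * y = a * (s + t)" by (simp add: algebra_simps)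
    then show "u + v \<in> colon y" unfolding colon_def using st R_add by blast
  next
    fix r u assume "r \<in> R" "u \<in> colon y"
    then obtain s where st: "r \<in> R" "u \<in> R" "s \<in> R" "u * y = a * s"
      by (auto simp: colon_def)
    then have "(r * u) * y = a * (r * s)" by (simp add: mult.assoc mult.left_commute)
    then show "r * u \<in> colon y" unfolding colon_def using st R_mult by blast
  qed (auto simp: colon_def)
  have a_colon: "a \<in> colon y" if "y \<in> R" for y using aR that by (auto simp: colon_def)
  have "{J. \<exists>y. good y \<and> J = colon y} \<subseteq> {I. ideal_of R I \<and> a \<in> I}"
    using ideal a_colon by (auto simp: good_def)
  then have fin: "finite {J. \<exists>y. good y \<and> J = colon y}"
    using finite_ideals_containing[OF aR a(2)] finite_subset by blast
  have "good 1"
    using a submod_mult[OF prime_submod[OF P], of _ a]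
    by (auto simp: good_def colon_def R1 mult.commute)
  then have "{J. \<exists>y. good y \<and> J = colon y} \<noteq> {}" by blast
  from finite_has_maximal[OF fin this] obtain J where J: "J \<in> {J. \<exists>y. good y \<and> J = colon y}"
    "\<forall>J'\<in>{J. \<exists>y. good y \<and> J = colon y}. J \<subseteq> J' \<longrightarrow> J = J'"
    by (elim bexE)
  then obtain y where y: "good y" and max: "\<And>y'. good y' \<Longrightarrow> \<not> colon y \<subset> colon y'" by auto
  have yR: "y \<in> R" using y by (simp add: good_def)
  have sub: "colon y \<subseteq> P" using y ideal[OF yR] by (auto simp: good_def ideal_of_def)
  have mono: "colon y \<subseteq> colon (t * y)" if "t \<in> R" for t
  proof
    fix r assume "r \<in> colon y"
    then obtain s where "r \<in> R" "s \<in> R" "r * y = a * s" by (auto simp: colon_def)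
    then have "r * (t * y) = a * (t * s)" by (metis mult.left_commute)
    then show "r \<in> colon (t * y)"
      using \<open>r \<in> R\<close> R_mult[OF that \<open>s \<in> R\<close>] unfolding colon_def by blast
  qed
  have "prime_of R (colon y)"
    unfolding prime_of_def
  proof (intro conjI ballI impI)
    show "ideal_of R (colon y)" by (rule ideal[OF yR])
    show "colon y \<noteq> {0}" using a_colon[OF yR] a by auto
    show "1 \<notin> colon y" using sub prime_1[OF P] by auto
    fix r s assume rs: "r \<in> R" "s \<in> R" "r * s \<in> colon y"
    show "r \<in> colon y \<or> s \<in> colon y"
    proof (rule ccontr)
      assume neg: "\<not> (r \<in> colon y \<or> s \<in> colon y)"
      have s_in: "s \<in> colon (r * y)" using rs by (auto simp: colon_def ac_simps)
      \<comment> \<open>The annihilator of \<open>r * y\<close> gains \<open>s\<close>, so by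
        maximality some \<open>t\<close> outside \<open>P\<close> kills \<open>r * y\<close>. Then
        \<open>t * y\<close> is still good while its annihilator gains \<open>r\<close>,
        contradicting maximality.\<close>
      have "\<not> good (r * y)" using max[of "r * y"] mono[OF rs(1)] s_in neg by blast
      then obtain t where t: "t \<in> R" "t \<notin> P" "t \<in> colon (r * y)"
        using rs yR by (auto simp: good_def intro: R_mult)
      have "good (t * y)" unfolding good_def
      proof (intro conjI ballI notI)
        show "t * y \<in> R" using t yR by (intro R_mult)
        fix u assume u: "u \<in> R - P" "u \<in> colon (t * y)"
        then have "u * t \<in> colon y" using t by (auto simp: colon_def ac_simps intro: R_mult)
        then have "u * t \<in> P" using sub by auto
        then show False using u t prime_mult[OF P] by auto
      qed
      moreover have "r \<in> colon (t * y)" using t rs by (auto simp: colon_def ac_simps)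
      ultimately show False using max[of "t * y"] mono[OF t(1)] neg by blast
    qed
  qed
  then have "colon y = P" using prime_subset_eq[OF _ P sub] by blast
  then have "\<exists>s\<in>R. p * y = a * s" if "p \<in> P" for p using that by (auto simp: colon_def)
  then have "y / a * p \<in> R" if "p \<in> P" for p
    using a(2) that by (metis mult.commute nonzero_mult_div_cancel_left times_divide_eq_left)
  moreover have "y / a \<notin> R"
  proof
    assume "y / a \<in> R"
    then have "1 \<in> colon y" using a(2) R1 by (auto simp: colon_def intro!: bexI[of _ "y / a"])
    then show False using sub prime_1[OF P] by auto
  qed
  ultimately show ?thesis by (rule that[rotated])
qed

text \<open>By maximality of \<open>P\<close> the product is \<open>P\<close> or \<open>R\<close>.
  In the first case an \<open>x\<close> outside \<open>R\<close> with \<open>x P\<close> inside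
  \<open>R\<close> would stabilize \<open>P\<close>, so the conductor multiplies \<open>x\<close>
  into \<open>R\<close>; as the conductor contains a unit modulo \<open>P\<close>, this forces
  \<open>x\<close> into \<open>R\<close>.\<close>

lemma reg_prime_imul_inv:
  assumes P: "reg_prime P"
  shows "P \<star> inv_of P = R"
proof -
  have P': "prime_of R P" using P by (simp add: reg_prime_def)
  obtain c where c: "c \<in> conductor R" "c \<notin> P" using P by (auto simp: reg_prime_def)
  have cR: "c \<in> R" using c conductor_subset by auto
  obtain r where r: "r \<in> R" "1 - r * c \<in> P" using prime_unit[OF P' cR c(2)] by auto
  obtain x where x: "x \<notin> R" "\<And>p. p \<in> P \<Longrightarrow> x * p \<in> R" using prime_colon_proper[OF P'] by auto
  have sm: "submod R (P \<star> inv_of P)" by (intro submod_imul2 prime_submod[OF P'] submod_inv_of)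
  have sub: "P \<star> inv_of P \<subseteq> R"
    by (rule imul_subset[OF submod_R]) (auto simp: inv_of_def mult.commute)
  have "P \<subseteq> P \<star> inv_of P"
  proof
    fix p assume "p \<in> P"
    moreover have "1 \<in> inv_of P" using prime_subset_R[OF P'] by (auto simp: inv_of_def)
    ultimately show "p \<in> P \<star> inv_of P" using imulI[of p P 1 "inv_of P"] by simp
  qed
  then have "P \<star> inv_of P = P \<or> P \<star> inv_of P = R"
    using prime_maximal[OF P'] sm sub by (auto simp: ideal_of_def)
  moreover have "P \<star> inv_of P \<noteq> P"
  proof
    assume eq: "P \<star> inv_of P = P"
    have "x * p \<in> P" if "p \<in> P" for p
      using imulI[of p P x "inv_of P"] that x(2) eq by (auto simp: inv_of_def mult.commute)
    then have "c * x \<in> R"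
      using stable_ideal_conductor[OF prime_submod[OF P'] prime_subset_R[OF P'] _ _ c(1)] P'
      by (auto simp: prime_of_def)
    then have "r * (c * x) + x * (1 - r * c) \<in> R" using R_add[OF R_mult[OF r(1)] x(2)[OF r(2)]] by blast
    then show False using x(1) by (simp add: algebra_simps)
  qed
  ultimately show ?thesis by blast
qed

definition coprime_conductor :: "'a set \<Rightarrow> bool" where
  "coprime_conductor I \<longleftrightarrow> ideal_of R I \<and> I \<noteq> {0} \<and> (\<exists>i\<in>I. 1 - i \<in> conductor R)"

text \<open>A proper ideal of this kind lies in a prime, which is regular by coprimality. Dividing
  by that prime gives a strictly larger ideal, and coprimality to the conductor passes to larger
  ideals.\<close>

lemma coprime_conductor_induct [consumes 1, case_names unit prime]:
  assumes "coprime_conductor I" and Q_R: "Q R"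
    and Q_P: "\<And>P J. reg_prime P \<Longrightarrow> coprime_conductor J \<Longrightarrow> Q J \<Longrightarrow> Q (P \<star> J)"
  shows "Q I"
proof -
  have "ideal_of R I" "I \<noteq> {0}" "\<exists>i\<in>I. 1 - i \<in> conductor R"
    using assms(1) by (auto simp: coprime_conductor_def)
  then show ?thesis
  proof (induction rule: ideal_psubset_induct)
    case (step I)
    obtain i where i: "i \<in> I" "1 - i \<in> conductor R" using step.prems by auto
    have sI: "submod R I" "I \<subseteq> R" using step.hyps by (auto simp: ideal_of_def)
    show ?case
    proof (cases "1 \<in> I")
      case True
      then show ?thesis using ideal_of_eq_iff[OF step.hyps(1)] Q_R by simp
    next
      case False
      obtain P where P: "prime_of R P" "I \<subseteq> P"
        using ex_prime_containing[OF step.hyps(1,2) False] by auto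
      have "\<not> conductor R \<subseteq> P" using i P prime_not_both[OF P(1), of i] by blast
      then have rP: "reg_prime P" using P by (simp add: reg_prime_def)
      define J where "J = inv_of P \<star> I"
      have PJ: "P \<star> J = I"
        unfolding J_def imul_assoc[symmetric] reg_prime_imul_inv[OF rP] by (rule imul_R[OF sI(1)])
      have J: "submod R J" unfolding J_def by (intro submod_imul2 submod_inv_of sI)
      have JR: "J \<subseteq> R" unfolding J_def
        by (rule imul_subset[OF submod_R]) (use P in \<open>auto simp: inv_of_def\<close>)
      have one: "1 \<in> inv_of P" using prime_subset_R[OF P(1)] by (auto simp: inv_of_def)
      have IJ: "I \<subseteq> J" unfolding J_def using imulI[OF one] by fastforce
      have "I \<noteq> J"
      proof
        assume eq: "I = J"
        \<comment> \<open>If division did not enlarge \<open>I\<close>, every \<open>x\<close> in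
          \<open>inv_of P\<close> would stabilize \<open>I\<close>. The splitting
          \<open>x = (1 - i) * x + x * i\<close> then puts it into \<open>R\<close>, so that
          \<open>P\<close> could not be invertible.\<close>
        have "x \<in> R" if x: "x \<in> inv_of P" for x
        proof -
          have st: "x * y \<in> I" if "y \<in> I" for y
          proof -
            have "x * y \<in> J" unfolding J_def by (rule imulI[OF x that])
            then show ?thesis by (simp only: eq[symmetric])
          qed
          have "(1 - i) * x \<in> R" using stable_ideal_conductor[OF sI step.hyps(2) st i(2)] .
          then have "(1 - i) * x + x * i \<in> R" using st[OF i(1)] sI by (intro R_add) auto
          then show ?thesis by (simp add: algebra_simps)
        qed
        then have "P \<star> inv_of P \<subseteq> P"
          using submod_mult[OF prime_submod[OF P(1)]]
          by (intro imul_subset[OF prime_submod[OF P(1)]]) (metis mult.commute)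
        then show False using reg_prime_imul_inv[OF rP] R1 prime_1[OF P(1)] by auto
      qed
      then have "I \<subset> J" using IJ by auto
      moreover have "J \<noteq> {0}" using IJ step.hyps submod_0[OF sI(1)] by auto
      ultimately have "coprime_conductor J" "Q J"
        using i IJ J JR step.IH[of J] by (auto simp: coprime_conductor_def ideal_of_def)
      then show ?thesis using Q_P[OF rP, of J] PJ by simp
    qed
  qed
qed

end

subsection \<open>Fractional ideals\<close>

lemma (in comm_group) subgroup_imp_comm_group:
  assumes "subgroup H G" shows "comm_group (G\<lparr>carrier := H\<rparr>)"
  using subgroup.subset[OF assms]
  by (intro group.group_comm_groupI subgroup_imp_group assms) (auto intro: m_comm)

section \<open>Translation of the algebraic structures into subsets of the field\<close>

lemma ring_on_simps [simp]:
  "carrier (ring_on R) = R" "mult (ring_on R) = (*)" "one (ring_on R) = 1"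
  "zero (ring_on R) = 0" "add (ring_on R) = (+)"
  by (simp_all add: ring_on_def)

lemma (in subring_set) cring_ring_on: "cring (ring_on R)"
proof (rule cringI)
  show "abelian_group (ring_on R)"
    by (rule abelian_groupI) (auto simp: R_add R0 ac_simps intro!: bexI[of _ "- _"] R_minus)
  show "Group.comm_monoid (ring_on R)"
    by (rule comm_monoidI) (auto simp: R_mult R1 ac_simps)
qed (simp add: distrib_right)

lemma subring_set_UNIV: "subring_set UNIV"
  by unfold_locales auto

lemma cring_ring_on_UNIV: "cring (ring_on (UNIV :: 'a::field_char_0 set))"
  by (rule subring_set.cring_ring_on[OF subring_set_UNIV])

lemma (in subring_set) a_inv_ring_on:
  assumes "x \<in> R" shows "inv\<^bsub>add_monoid (ring_on R)\<^esub> x = - x"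
proof -
  interpret C: cring "ring_on R" by (rule cring_ring_on)
  have "\<ominus>\<^bsub>ring_on R\<^esub> x = - x"
    by (rule C.minus_equality) (use assms R_minus in auto)
  then show ?thesis by (simp add: a_inv_def)
qed

lemma (in subring_set) subgroup_ring_on:
  assumes "submod R I" "I \<subseteq> R" shows "subgroup I (add_monoid (ring_on R))"
proof (rule subgroup.intro)
  fix x assume "x \<in> I"
  then show "inv\<^bsub>add_monoid (ring_on R)\<^esub> x \<in> I"
    using a_inv_ring_on[of x] assms submod_diff[OF subring_set_axioms assms(1) submod_0[OF assms(1)], of x]
    by auto
qed (use assms in \<open>auto simp: submod_def\<close>)

lemma subring_set_if_subring:
  assumes "subring R (ring_on (UNIV :: 'a::field_char_0 set))"
  shows "subring_set R"
proof -
  interpret C: cring "ring_on (UNIV :: 'a set)" by (rule cring_ring_on_UNIV)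
  interpret subring R "ring_on (UNIV :: 'a set)" by (rule assms)
  interpret U: subring_set "UNIV :: 'a set" by (rule subring_set_UNIV)
  note E = subringE[OF assms]
  show ?thesis
  proof
    show "- x \<in> R" if "x \<in> R" for x
      using E(5)[OF that] U.a_inv_ring_on[of x] by (simp add: a_inv_def)
  qed (use E in auto)
qed

lemma (in subring_set) fractional_ideal_iff:
  "fractional_ideal R I \<longleftrightarrow> submod R I \<and> I \<noteq> {0} \<and> (\<exists>d\<in>R - {0}. \<forall>x\<in>I. d * x \<in> R)"
proof -
  interpret U: subring_set "UNIV :: 'a set" by (rule subring_set_UNIV)
  have "additive_subgroup I (ring_on UNIV)" if "submod R I"
  proof (intro additive_subgroup.intro subgroup.intro)
    fix x assume "x \<in> I"
    then show "inv\<^bsub>add_monoid (ring_on UNIV)\<^esub> x \<in> I"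
      using U.a_inv_ring_on[of x] submod_mult[OF that R_minus[OF R1], of x] by auto
  qed (use that in \<open>auto simp: submod_def\<close>)
  moreover have "0 \<in> I \<and> (\<forall>x\<in>I. \<forall>y\<in>I. x + y \<in> I)" if "additive_subgroup I (ring_on UNIV)"
    using additive_subgroup.zero_closed[OF that] additive_subgroup.a_closed[OF that] by auto
  ultimately show ?thesis unfolding fractional_ideal_def submod_def by blast
qed

lemma (in subring_set) primeideal_ring_on_iff:
  "primeideal P (ring_on R) \<longleftrightarrow> ideal_of R P \<and> 1 \<notin> P \<and> (\<forall>x\<in>R. \<forall>y\<in>R. x * y \<in> P \<longrightarrow> x \<in> P \<or> y \<in> P)"
proof
  assume P: "primeideal P (ring_on R)"
  interpret P: primeideal P "ring_on R" by (rule P)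
  have id: "ideal_of R P"
    unfolding ideal_of_def submod_def
    using additive_subgroup.zero_closed[OF P.additive_subgroup_axioms] additive_subgroup.a_closed[OF P.additive_subgroup_axioms] P.I_l_closed P.a_subset by auto
  moreover have "1 \<notin> P" using P.one_imp_carrier P.I_notcarr by auto
  ultimately show "ideal_of R P \<and> 1 \<notin> P \<and> (\<forall>x\<in>R. \<forall>y\<in>R. x * y \<in> P \<longrightarrow> x \<in> P \<or> y \<in> P)"
    using P.I_prime by auto
next
  assume P: "ideal_of R P \<and> 1 \<notin> P \<and> (\<forall>x\<in>R. \<forall>y\<in>R. x * y \<in> P \<longrightarrow> x \<in> P \<or> y \<in> P)"
  interpret C: cring "ring_on R" by (rule cring_ring_on)
  have "ideal P (ring_on R)"
  proof (rule idealI[OF C.ring_axioms subgroup_ring_on])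
    fix a x assume "a \<in> P" "x \<in> carrier (ring_on R)"
    then have "x * a \<in> P" using P by (auto simp: ideal_of_def submod_def)
    then show "x \<otimes>\<^bsub>ring_on R\<^esub> a \<in> P" "a \<otimes>\<^bsub>ring_on R\<^esub> x \<in> P"
      by (simp_all add: mult.commute)
  qed (use P in \<open>auto simp: ideal_of_def\<close>)
  then show "primeideal P (ring_on R)"
    using P R1 by (intro primeidealI) (auto simp: C.cring_axioms)
qed

lemma (in subring_set) nonzero_primes_iff: "P \<in> nonzero_primes R \<longleftrightarrow> prime_of R P"
  by (auto simp: nonzero_primes_def prime_of_def primeideal_ring_on_iff)

lemma comaximal_iff: "comaximal R I J \<longleftrightarrow> {i + j | i j. i \<in> I \<and> j \<in> J} = R"
  by (auto simp: comaximal_def set_add_def set_mult_def)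

context nf_subring
begin

text \<open>A proper sum \<open>D + M\<close> would lie in a prime containing both. Applied to an
  ideal of denominators, this produces denominators congruent to 1.\<close>

lemma ideals_comaximal:
  assumes D: "ideal_of R D" "D \<noteq> {0}" and M: "ideal_of R M"
    and disj: "\<And>P. prime_of R P \<Longrightarrow> M \<subseteq> P \<Longrightarrow> D \<subseteq> P \<Longrightarrow> False"
  obtains s where "s \<in> D" "1 - s \<in> M"
proof -
  define E where "E = {d + m | d m. d \<in> D \<and> m \<in> M}"
  have sD: "submod R D" and sM: "submod R M" using D M by (auto simp: ideal_of_def)
  have E: "ideal_of R E"
    using submod_plus[OF sD sM] D M by (auto simp: E_def ideal_of_def intro!: R_add)
  have DE: "D \<subseteq> E" using submod_0[OF sM] by (force simp: E_def)
  have ME: "M \<subseteq> E" using submod_0[OF sD] by (force simp: E_def)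
  have "E \<noteq> {0}" using DE D(2) submod_0[OF sD] by auto
  then have "1 \<in> E" using ex_prime_containing[OF E] disj DE ME by blast
  then obtain d m where dm: "d \<in> D" "m \<in> M" "1 = d + m" by (auto simp: E_def)
  then have "1 - d = m" by (metis add_diff_cancel_left')
  then show ?thesis using that dm by blast
qed

lemma comaximal_iff_one:
  assumes "ideal_of R I" "ideal_of R J"
  shows "comaximal R I J \<longleftrightarrow> (\<exists>i\<in>I. 1 - i \<in> J)"
proof
  assume "comaximal R I J"
  then have "1 \<in> {i + j | i j. i \<in> I \<and> j \<in> J}" using R1 by (simp add: comaximal_iff)
  then obtain i j where ij: "i \<in> I" "j \<in> J" "1 = i + j" by auto
  then have "1 - i = j" by (metis add_diff_cancel_left')
  then show "\<exists>i\<in>I. 1 - i \<in> J" using ij by (intro bexI[of _ i]) simp_all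
next
  assume "\<exists>i\<in>I. 1 - i \<in> J"
  then obtain i where i: "i \<in> I" "1 - i \<in> J" by auto
  show "comaximal R I J" unfolding comaximal_iff
  proof
    show "{i + j | i j. i \<in> I \<and> j \<in> J} \<subseteq> R" using assms by (auto simp: ideal_of_def intro: R_intros)
    show "R \<subseteq> {i + j | i j. i \<in> I \<and> j \<in> J}"
    proof
      fix r assume r: "r \<in> R"
      have "r = r * i + r * (1 - i)" by (simp add: algebra_simps)
      moreover have "r * i \<in> I" "r * (1 - i) \<in> J"
        using assms i r by (auto simp: ideal_of_def submod_def)
      ultimately show "r \<in> {i + j | i j. i \<in> I \<and> j \<in> J}" by blast
    qed
  qed
qed

lemma ideal_conductor: "ideal_of R (conductor R)"
  using submod_conductor conductor_subset by (simp add: ideal_of_def)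

text \<open>Since \<open>P\<close> is maximal, a prime containing both \<open>P\<close> and the
  conductor can only be \<open>P\<close> itself.\<close>

lemma reg_prime_iff: "reg_prime P \<longleftrightarrow> P \<in> nonzero_primes R \<and> comaximal R P (conductor R)"
proof -
  have "(\<exists>i\<in>P. 1 - i \<in> conductor R) \<longleftrightarrow> \<not> conductor R \<subseteq> P" if P: "prime_of R P"
  proof
    show "\<exists>i\<in>P. 1 - i \<in> conductor R" if "\<not> conductor R \<subseteq> P"
      using ideals_comaximal[OF prime_ideal[OF P] _ ideal_conductor] prime_subset_eq[OF P] P that
      by (metis prime_of_def)
  qed (use prime_not_both[OF P] in blast)
  then show ?thesis
    using comaximal_iff_one[OF prime_ideal ideal_conductor] nonzero_primes_iff reg_prime_def by blast
qed

definition frac_ideal :: "'a set \<Rightarrow> bool" where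
  "frac_ideal I \<longleftrightarrow> fractional_ideal R I"

lemma frac_ideal_submod: "frac_ideal I \<Longrightarrow> submod R I"
  and frac_ideal_nonzero: "frac_ideal I \<Longrightarrow> I \<noteq> {0}"
  and frac_ideal_denom: "frac_ideal I \<Longrightarrow> \<exists>d\<in>R - {0}. \<forall>x\<in>I. d * x \<in> R"
  by (auto simp: frac_ideal_def fractional_ideal_iff)

lemma frac_idealI: "submod R I \<Longrightarrow> I \<noteq> {0} \<Longrightarrow> d \<in> R \<Longrightarrow> d \<noteq> 0 \<Longrightarrow> (\<And>x. x \<in> I \<Longrightarrow> d * x \<in> R) \<Longrightarrow> frac_ideal I"
  by (auto simp: frac_ideal_def fractional_ideal_iff)

lemma ideal_frac_ideal: "ideal_of R I \<Longrightarrow> I \<noteq> {0} \<Longrightarrow> frac_ideal I"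
  using R1 by (intro frac_idealI[of _ 1]) (auto simp: ideal_of_def)

lemma frac_ideal_R: "frac_ideal R"
  by (rule ideal_frac_ideal[OF ideal_R]) (use R1 in auto)

lemma imul_nonzero: "submod R I \<Longrightarrow> submod R J \<Longrightarrow> I \<noteq> {0} \<Longrightarrow> J \<noteq> {0} \<Longrightarrow> I \<star> J \<noteq> {0}"
proof
  assume "submod R I" "submod R J" "I \<noteq> {0}" "J \<noteq> {0}" "I \<star> J = {0}"
  then obtain a b where "a \<in> I" "a \<noteq> 0" "b \<in> J" "b \<noteq> 0" by (metis nonzero_ideal_elem)
  then show False using imulI[of a I b J] \<open>I \<star> J = {0}\<close> by auto
qed

lemma frac_ideal_imul: "frac_ideal I \<Longrightarrow> frac_ideal J \<Longrightarrow> frac_ideal (I \<star> J)"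
proof -
  assume I: "frac_ideal I" and J: "frac_ideal J"
  obtain d e where de: "d \<in> R - {0}" "\<forall>x\<in>I. d * x \<in> R" "e \<in> R - {0}" "\<forall>x\<in>J. e * x \<in> R"
    using I J frac_ideal_denom by metis
  have "I \<star> J \<subseteq> {x. d * e * x \<in> R}"
  proof (rule imul_subset)
    show "submod R {x. d * e * x \<in> R}"
      by (auto simp: submod_def distrib_left intro: R_intros) (metis R_mult mult.left_commute)
    fix a b assume "a \<in> I" "b \<in> J"
    then have "(d * a) * (e * b) \<in> R" using R_mult[of "d * a" "e * b"] de by simp
    then show "a * b \<in> {x. d * e * x \<in> R}" by (simp add: ac_simps)
  qed
  then have denom: "d * e * x \<in> R" if "x \<in> I \<star> J" for x using that by blast
  have "d * e \<in> R" "d * e \<noteq> 0" using de R_mult by auto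
  moreover have "submod R (I \<star> J)" using I J by (intro submod_imul2 frac_ideal_submod)
  moreover have "I \<star> J \<noteq> {0}" using I J by (intro imul_nonzero frac_ideal_submod frac_ideal_nonzero)
  ultimately show ?thesis using frac_idealI[of "I \<star> J" "d * e"] denom by blast
qed

lemma frac_ideals_simps [simp]:
  "carrier (fractional_ideals R) = {I. frac_ideal I}"
  "mult (fractional_ideals R) = (\<star>)" "one (fractional_ideals R) = R"
  by (auto simp: fractional_ideals_def frac_ideal_def)

lemma comm_monoid_fractional_ideals: "Group.comm_monoid (fractional_ideals R)"
  by (rule comm_monoidI)
     (simp_all add: frac_ideal_imul frac_ideal_R imul_assoc imul_R frac_ideal_submod, rule imul_commute)

lemma principal_nonzero: "x \<noteq> 0 \<Longrightarrow> principal R x \<noteq> {0}"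
  using self_in_principal by fastforce

lemma frac_ideal_principal: "x \<noteq> 0 \<Longrightarrow> frac_ideal (principal R x)"
proof -
  assume x: "x \<noteq> 0"
  obtain a b where "a \<in> R" "b \<in> R" "b \<noteq> 0" "x = a / b" using frac[of x] by auto
  then show ?thesis using x
    by (intro frac_idealI[of _ b] submod_principal principal_nonzero) (auto simp: principal_def intro: R_mult)
qed

lemma imul_principal: "submod R I \<Longrightarrow> principal R x \<star> I = (*) x ` I"
proof
  assume I: "submod R I"
  show "principal R x \<star> I \<subseteq> (*) x ` I"
  proof
    fix y assume "y \<in> principal R x \<star> I"
    then show "y \<in> (*) x ` I"
    proof (induction rule: imul_induct)
      case (prod a b)
      then show ?case using submod_mult[OF I] by (auto simp: principal_def mult.assoc)
    next
      case (add u v)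
      then show ?case using submod_add[OF I] by (auto simp: distrib_left[symmetric])
    qed
  qed
  show "(*) x ` I \<subseteq> principal R x \<star> I" using imulI[OF self_in_principal] by auto
qed

lemma principal_mult: "principal R (x * y) = principal R x \<star> principal R y"
  by (simp add: imul_principal submod_principal) (auto simp: principal_def image_image mult.assoc)

lemma principal_one: "principal R 1 = R"
  by (simp add: principal_def)

lemma Units_fractional_ideals_iff:
  "I \<in> Units (fractional_ideals R) \<longleftrightarrow> frac_ideal I \<and> (\<exists>J. frac_ideal J \<and> I \<star> J = R)"
proof -
  have "(x \<star> I = R \<and> I \<star> x = R) = (I \<star> x = R)" for x by (metis imul_commute)
  then show ?thesis by (simp add: Units_def)
qed

lemma frac_ideal_inv_of: "ideal_of R I \<Longrightarrow> I \<noteq> {0} \<Longrightarrow> frac_ideal (inv_of I)"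
proof -
  assume I: "ideal_of R I" "I \<noteq> {0}"
  obtain d where d: "d \<in> I" "d \<noteq> 0" using I nonzero_ideal_elem unfolding ideal_of_def by blast
  have "1 \<in> inv_of I" using I by (auto simp: inv_of_def ideal_of_def)
  then have "inv_of I \<noteq> {0}" by auto
  then show ?thesis using d I submod_inv_of
    by (intro frac_idealI[of _ d]) (auto simp: inv_of_def ideal_of_def mult.commute)
qed

lemma reg_prime_unit: "reg_prime P \<Longrightarrow> P \<in> Units (fractional_ideals R)"
  unfolding Units_fractional_ideals_iff
  using reg_prime_imul_inv[of P] frac_ideal_inv_of[of P] ideal_frac_ideal[of P]
  by (auto simp: reg_prime_def prime_of_def)

text \<open>This is what places the principal ideals coprime to the conductor in \<open>J_R\<close>,
  which is generated by primes.\<close>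

lemma coprime_conductor_generate:
  assumes "coprime_conductor I"
  shows "I \<in> generate (invertible_ideals R) {P. reg_prime P}"
  using assms
proof (induction rule: coprime_conductor_induct)
  case unit
  then show ?case using generate.one[of "invertible_ideals R"] by (simp add: units_of_one)
next
  case (prime P J)
  then show ?case
    using generate.eng[OF generate.incl[of P "{P. reg_prime P}" "invertible_ideals R"] prime(3)]
    by (simp add: units_of_mult)
qed

end

subsection \<open>The ring of integers\<close>

lemma (in rat_basis) nf_subring_integers: "nf_subring \<B> co (ring_of_integers :: 'a set)"
proof
  fix x :: 'a
  obtain N :: int where N: "N > 0" "algebraic_int (of_int N * x)" by (rule ex_int_multiple_algebraic_int)
  then show "\<exists>a\<in>ring_of_integers. \<exists>b\<in>ring_of_integers - {0}. x = a / b"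
    by (intro bexI[of _ "of_int N * x"] bexI[of _ "of_int N"])
       (auto simp: ring_of_integers_def int_imp_algebraic_int)
qed (auto simp: ring_of_integers_def algebraic_int_add algebraic_int_mult int_imp_algebraic_int)

text \<open>Everything shown for \<open>R\<close> becomes available for the integers. Their
  conductor is the whole ring, so every prime is regular and the factorization covers all nonzero
  ideals.\<close>

sublocale rat_basis \<subseteq> OK: nf_subring \<B> co "ring_of_integers"
  by (rule nf_subring_integers)

context rat_basis
begin

abbreviation ringO :: "'a set" (\<open>\<O>\<close>) where "\<O> \<equiv> ring_of_integers"

text \<open>A nonzero ideal of \<open>\<O>\<close> is a finitely generated abelian group, so the
  eigenvalue argument applies to an element that stabilizes it.\<close>

lemma integers_stable:
  assumes I: "submod \<O> I" "I \<subseteq> \<O>" "I \<noteq> {0}" and x: "\<And>y. y \<in> I \<Longrightarrow> x * y \<in> I"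
  shows "x \<in> \<O>"
proof -
  obtain b where b: "b \<in> I" "b \<noteq> 0" using OK.nonzero_ideal_elem[OF I(1,3)] by auto
  have int_I: "of_int k * y \<in> I" if "y \<in> I" for k y
    using submod_mult[OF I(1) OK.R_of_int that] .
  obtain C :: "'a set" where C: "finite C" "\<O> \<subseteq> zspan C"
    using algebraic_ints_in_zspan unfolding ring_of_integers_def by metis
  have "\<exists>N::int. N > 0 \<and> of_int N * y \<in> I" for y
  proof -
    obtain n :: nat and r where n: "n > 0" "r \<in> \<O>" "of_nat n = b * r"
      using OK.ex_int_multiple_of[of b] b I by blast
    obtain N :: int where N: "N > 0" "of_int N * y \<in> \<O>" using OK.ex_int_multiple_in_R by blast
    have "of_int (int n * N) * y = of_nat n * (of_int N * y)" by simp
    also have "\<dots> = (of_int N * y * r) * b" unfolding n(3) by (simp only: ac_simps)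
    finally have "of_int (int n * N) * y = (of_int N * y * r) * b" .
    moreover have "(of_int N * y * r) * b \<in> I"
      by (rule submod_mult[OF I(1) OK.R_mult[OF N(2) n(2)] b(1)])
    ultimately have "of_int (int n * N) * y \<in> I" by (simp only:)
    moreover have "int n * N > 0" using n(1) N(1) by simp
    ultimately show ?thesis by blast
  qed
  then obtain N :: int where N: "N > 0" "\<forall>c\<in>C. of_int N * c \<in> I"
    using ex_common_int_multiple[OF C(1), of I] int_I by blast
  obtain F where F: "finite F" "F \<subseteq> \<O>" "\<forall>y\<in>\<O>. \<exists>z\<in>F. \<exists>r\<in>\<O>. y = z + of_nat (nat N) * r"
    using OK.finite_reps[of "nat N"] N(1) by auto
  \<comment> \<open>\<open>N\<close> multiplies the generators \<open>C\<close> into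
    \<open>I\<close>. The elements \<open>N c\<close> span a group containing \<open>N \<O>\<close>;
    together with the representatives modulo \<open>N\<close> that lie in \<open>I\<close> they
    generate \<open>I\<close>.\<close>
  define D where "D = (F \<inter> I) \<union> (\<lambda>c. of_int N * c) ` C"
  have fD: "finite D" using F C by (simp add: D_def)
  have DI: "D \<subseteq> I" using N by (auto simp: D_def)
  have spD: "zspan D \<subseteq> I"
    by (rule zspan_minimal) (use DI int_I submod_0[OF I(1)] submod_add[OF I(1)] in auto)
  have "I \<subseteq> zspan D"
  proof
    fix y assume y: "y \<in> I"
    then obtain z r where zr: "z \<in> F" "r \<in> \<O>" "y = z + of_int N * r"
      using F(3) I(2) N(1) by (metis nat_0_le less_imp_le of_int_of_nat_eq subset_iff)
    have "of_int N * r \<in> zspan D"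
    proof (rule zspan_mult_closed)
      show "r \<in> zspan C" using zr C by auto
      show "of_int N * c \<in> zspan D" if "c \<in> C" for c
        using that by (intro zspan_base[OF fD]) (auto simp: D_def)
    qed
    moreover have "z = y - of_int N * r" using zr by simp
    then have "z \<in> I" using submod_diff[OF OK.subring_set_axioms I(1) y] spD \<open>of_int N * r \<in> zspan D\<close> by auto
    then have "z \<in> zspan D" using zr by (intro zspan_base[OF fD]) (auto simp: D_def)
    ultimately show "y \<in> zspan D" unfolding zr(3) by (intro zspan_add)
  qed
  then have ID: "I = zspan D" using spD by auto
  have "\<exists>d\<in>D. d \<noteq> 0"
  proof (rule ccontr)
    assume "\<not> (\<exists>d\<in>D. d \<noteq> 0)"
    then have "zspan D \<subseteq> {0}" by (intro zspan_minimal) auto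
    then show False using b ID by auto
  qed
  then obtain d where "d \<in> D" "d \<noteq> 0" by auto
  then have "algebraic_int x"
    using fD x DI ID by (intro algebraic_int_if_zspan_stable[of D d]) auto
  then show ?thesis by (simp add: ring_of_integers_def)
qed

text \<open>The integers \<open>y\<close> for which all \<open>y * x ^ n\<close> are integral form
  an ideal stabilized by \<open>x\<close>; it is nonzero because the powers of \<open>x\<close> have
  a common denominator.\<close>

lemma integral_closure_integers: "integral_closure \<O> = \<O>"
proof
  show "integral_closure \<O> \<subseteq> \<O>"
  proof
    fix x assume "x \<in> integral_closure \<O>"
    then obtain d where d: "d \<in> \<O>" "d \<noteq> 0" "\<And>n. d * x ^ n \<in> \<O>"
      using OK.integral_imp_bounded_powers by metis
    define I where "I = {y\<in>\<O>. \<forall>n. y * x ^ n \<in> \<O>}"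
    have "submod \<O> I"
      by (auto simp: I_def submod_def distrib_right mult.assoc intro: OK.R_intros)
    moreover have "d \<in> I" using d by (auto simp: I_def)
    moreover have "x * y \<in> I" if "y \<in> I" for y
    proof -
      have "y * x ^ n \<in> \<O>" for n using that by (simp add: I_def)
      from this[of 1] this[of "Suc n" for n] show ?thesis by (auto simp: I_def ac_simps)
    qed
    ultimately show "x \<in> \<O>" using integers_stable[of I x] d by (auto simp: I_def)
  qed
qed (rule OK.R_subset_integral_closure)

lemma conductor_integers: "conductor \<O> = \<O>"
  using OK.conductor_subset by (auto simp: conductor_def integral_closure_integers intro: OK.R_mult)

lemma OK_reg_prime: "OK.reg_prime P \<longleftrightarrow> prime_of \<O> P"
  using OK.R1 by (auto simp: OK.reg_prime_def conductor_integers dest: OK.prime_1)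

lemma OK_coprime_conductor: "OK.coprime_conductor I \<longleftrightarrow> ideal_of \<O> I \<and> I \<noteq> {0}"
  using submod_0 OK.R1 by (fastforce simp: OK.coprime_conductor_def conductor_integers ideal_of_def)

lemma integral_ideal_induct [consumes 2, case_names unit prime]:
  assumes "ideal_of \<O> I" "I \<noteq> {0}" "Q \<O>"
    and "\<And>P J. prime_of \<O> P \<Longrightarrow> ideal_of \<O> J \<Longrightarrow> J \<noteq> {0} \<Longrightarrow> Q J \<Longrightarrow> Q (P \<star> J)"
  shows "Q I"
  using assms OK.coprime_conductor_induct[of I Q] by (auto simp: OK_coprime_conductor OK_reg_prime)

lemma ideal_imul: "ideal_of \<O> I \<Longrightarrow> ideal_of \<O> J \<Longrightarrow> ideal_of \<O> (I \<star> J)"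
  unfolding ideal_of_def
proof (intro conjI)
  assume I: "submod \<O> I \<and> I \<subseteq> \<O>" and J: "submod \<O> J \<and> J \<subseteq> \<O>"
  then show "submod \<O> (I \<star> J)" by (intro submod_imul2) auto
  show "I \<star> J \<subseteq> \<O>" by (rule imul_subset[OF OK.submod_R]) (use I J OK.R_mult in auto)
qed

lemma imul_subset_right: "ideal_of \<O> I \<Longrightarrow> submod \<O> J \<Longrightarrow> I \<star> J \<subseteq> J"
  by (rule imul_subset) (auto simp: ideal_of_def submod_def)

lemma prime_imul_subset:
  assumes "prime_of \<O> P" "ideal_of \<O> I" "ideal_of \<O> J" "I \<star> J \<subseteq> P"
  shows "I \<subseteq> P \<or> J \<subseteq> P"
proof (rule ccontr)
  assume "\<not> (I \<subseteq> P \<or> J \<subseteq> P)"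
  then obtain a b where "a \<in> I" "a \<notin> P" "b \<in> J" "b \<notin> P" by auto
  then show False using OK.prime_mult[OF assms(1), of a b] imulI[of a I b J] assms by (auto simp: ideal_of_def)
qed

lemma ideal_principal: "d \<in> \<O> \<Longrightarrow> ideal_of \<O> (principal \<O> d)"
  unfolding ideal_of_def using OK.submod_principal by (auto simp: principal_def intro: OK.R_mult)

lemma scaled_ideal:
  assumes "OK.frac_ideal I" "\<And>x. x \<in> I \<Longrightarrow> d * x \<in> \<O>"
  shows "ideal_of \<O> (principal \<O> d \<star> I)"
  unfolding ideal_of_def
proof
  show "submod \<O> (principal \<O> d \<star> I)"
    using assms(1) by (intro submod_imul2 OK.submod_principal OK.frac_ideal_submod)
  show "principal \<O> d \<star> I \<subseteq> \<O>"
    unfolding OK.imul_principal[OF OK.frac_ideal_submod[OF assms(1)]] using assms(2) by auto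
qed

lemma OK_frac_ideal_clear_denominator:
  assumes "OK.frac_ideal I"
  obtains d where "d \<in> \<O>" "d \<noteq> 0" "ideal_of \<O> (principal \<O> d \<star> I)" "principal \<O> d \<star> I \<noteq> {0}"
proof -
  obtain d where d: "d \<in> \<O> - {0}" "\<forall>x\<in>I. d * x \<in> \<O>" using OK.frac_ideal_denom[OF assms] by blast
  show ?thesis
  proof (rule that[of d])
    show "ideal_of \<O> (principal \<O> d \<star> I)"
      using scaled_ideal[OF assms] d by blast
    show "principal \<O> d \<star> I \<noteq> {0}"
      by (rule OK.imul_nonzero[OF OK.submod_principal OK.frac_ideal_submod[OF assms]
            OK.principal_nonzero OK.frac_ideal_nonzero[OF assms]]) (use d in auto)
  qed (use d in auto)
qed

lemma integral_ideal_unit: "ideal_of \<O> I \<Longrightarrow> I \<noteq> {0} \<Longrightarrow> \<exists>K. OK.frac_ideal K \<and> I \<star> K = \<O>"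
proof (induction rule: integral_ideal_induct)
  case unit
  then show ?case using OK.frac_ideal_R OK.imul_R[OF OK.submod_R] by blast
next
  case (prime P J)
  then obtain K where K: "OK.frac_ideal K" "J \<star> K = \<O>" by auto
  have P: "P \<star> OK.inv_of P = \<O>" using OK.reg_prime_imul_inv prime OK_reg_prime by auto
  have "OK.frac_ideal (OK.inv_of P)" using prime by (intro OK.frac_ideal_inv_of) (auto simp: prime_of_def)
  moreover have "P \<star> J \<star> (OK.inv_of P \<star> K) = (P \<star> OK.inv_of P) \<star> (J \<star> K)"
    by (simp only: imul_ac)
  ultimately show ?case using K P OK.imul_R[OF OK.submod_R]
    by (intro exI[of _ "OK.inv_of P \<star> K"]) (auto intro: OK.frac_ideal_imul)
qed

lemma OK_frac_ideal_unit: "OK.frac_ideal I \<Longrightarrow> \<exists>K. OK.frac_ideal K \<and> I \<star> K = \<O>"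
proof -
  assume "OK.frac_ideal I"
  then obtain d where d: "d \<in> \<O>" "d \<noteq> 0" "ideal_of \<O> (principal \<O> d \<star> I)" "principal \<O> d \<star> I \<noteq> {0}"
    by (rule OK_frac_ideal_clear_denominator)
  obtain K where K: "OK.frac_ideal K" "principal \<O> d \<star> I \<star> K = \<O>" using integral_ideal_unit d by blast
  then show ?thesis using OK.frac_ideal_imul[OF OK.frac_ideal_principal[OF d(2)] K(1)]
    by (metis imul_assoc imul_commute)
qed

lemma comm_group_fractional_ideals: "comm_group (fractional_ideals \<O>)"
proof -
  interpret M: Group.comm_monoid "fractional_ideals \<O>" by (rule OK.comm_monoid_fractional_ideals)
  show ?thesis
    by (intro comm_group.intro M.comm_monoid_axioms group.intro group_axioms.intro M.monoid_axioms subsetI)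
       (auto simp: OK.Units_fractional_ideals_iff OK_frac_ideal_unit)
qed

sublocale G: comm_group "fractional_ideals \<O>"
  by (rule comm_group_fractional_ideals)

abbreviation "\<G> \<equiv> fractional_ideals \<O>"
abbreviation ideal_pow (infixr \<open>\<up>\<close> 80) where "P \<up> n \<equiv> P [^]\<^bsub>\<G>\<^esub> n"

subsection \<open>Unique factorization\<close>

lemma prime_carrier: "prime_of \<O> P \<Longrightarrow> P \<in> carrier \<G>"
  using OK.ideal_frac_ideal by (auto simp: prime_of_def)

text \<open>The index set is independent of the exponents, so factorizations with different supports
  can be compared over a common set.\<close>

definition prime_prod :: "'a set set \<Rightarrow> ('a set \<Rightarrow> int) \<Rightarrow> 'a set" where
  "prime_prod S u = (\<Otimes>\<^bsub>\<G>\<^esub>P\<in>S. P \<up> u P)"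

abbreviation primes :: "'a set set" where "primes \<equiv> {P. prime_of \<O> P}"

lemma prime_factorization_of_iff:
  assumes "finite S" "S \<subseteq> primes" "{P. v P \<noteq> 0} \<subseteq> S"
  shows "prime_factorization_of I v \<longleftrightarrow> I = prime_prod S v"
proof -
  have "(\<Otimes>\<^bsub>\<G>\<^esub>P\<in>{P. v P \<noteq> 0}. P \<up> v P) = prime_prod S v"
    unfolding prime_prod_def
  proof (rule G.finprod_mono_neutral_cong_left)
    show "(\<lambda>P. P \<up> v P) \<in> S \<rightarrow> carrier \<G>"
      using assms(2) prime_carrier by (intro Pi_I G.int_pow_closed) auto
  qed (use assms in auto)
  then show ?thesis
    using assms finite_subset[OF assms(3,1)] OK.nonzero_primes_iff
    unfolding prime_factorization_of_def by auto
qed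

lemma prime_prod_closed: "S \<subseteq> primes \<Longrightarrow> prime_prod S u \<in> carrier \<G>"
  unfolding prime_prod_def using prime_carrier by (intro G.finprod_closed Pi_I G.int_pow_closed) auto

lemma prime_prod_add:
  assumes "S \<subseteq> primes"
  shows "prime_prod S (\<lambda>P. u P + w P) = prime_prod S u \<star> prime_prod S w"
proof -
  have "prime_prod S (\<lambda>P. u P + w P) = (\<Otimes>\<^bsub>\<G>\<^esub>P\<in>S. P \<up> u P \<otimes>\<^bsub>\<G>\<^esub> P \<up> w P)"
    unfolding prime_prod_def
  proof (rule G.finprod_cong')
    show "P \<up> (u P + w P) = P \<up> u P \<otimes>\<^bsub>\<G>\<^esub> P \<up> w P" if "P \<in> S" for P
      using that assms by (intro G.int_pow_mult prime_carrier) auto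
    show "(\<lambda>P. P \<up> u P \<otimes>\<^bsub>\<G>\<^esub> P \<up> w P) \<in> S \<rightarrow> carrier \<G>"
      using assms prime_carrier by (intro Pi_I G.m_closed G.int_pow_closed) auto
  qed simp
  also have "\<dots> = prime_prod S u \<otimes>\<^bsub>\<G>\<^esub> prime_prod S w"
    unfolding prime_prod_def
    using assms prime_carrier by (intro G.finprod_multf Pi_I G.int_pow_closed) auto
  finally show ?thesis by simp
qed

lemma prime_prod_0: "prime_prod S (\<lambda>_. 0) = \<O>"
proof -
  have "prime_prod S (\<lambda>_. 0) = (\<Otimes>\<^bsub>\<G>\<^esub>P\<in>S. \<one>\<^bsub>\<G>\<^esub>)" by (simp only: prime_prod_def int_pow_0)
  also have "\<dots> = \<one>\<^bsub>\<G>\<^esub>" by (rule G.finprod_one)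
  finally show ?thesis by (simp only: OK.frac_ideals_simps)
qed

lemma prime_prod_insert:
  assumes "finite S" "P \<notin> S" "insert P S \<subseteq> primes"
  shows "prime_prod (insert P S) u = (P \<up> u P) \<star> prime_prod S u"
proof -
  have "prime_prod (insert P S) u = (P \<up> u P) \<otimes>\<^bsub>\<G>\<^esub> prime_prod S u"
    unfolding prime_prod_def
    using assms prime_carrier by (intro G.finprod_insert Pi_I G.int_pow_closed) auto
  then show ?thesis by simp
qed

lemma prime_pow_Suc: "P \<up> Suc n = (P \<up> n) \<star> P"
  by (simp add: G.nat_pow_Suc)

lemma prime_pow_ideal: "prime_of \<O> P \<Longrightarrow> ideal_of \<O> (P \<up> (n::nat))"
proof (induction n)
  case 0 then show ?case using OK.ideal_R by (simp add: G.nat_pow_0)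
next
  case (Suc n) then show ?case unfolding prime_pow_Suc by (intro ideal_imul) (auto intro: OK.prime_ideal)
qed

lemma prime_pow_subset:
  assumes "prime_of \<O> P" "prime_of \<O> Q" "(Q \<up> (n::nat)) \<subseteq> P"
  shows "n > 0 \<and> Q = P"
  using assms(3)
proof (induction n)
  case 0 then show ?case using OK.prime_1[OF assms(1)] OK.R1 by (auto simp: G.nat_pow_0)
next
  case (Suc n)
  then have "(Q \<up> n) \<subseteq> P \<or> Q \<subseteq> P"
    unfolding prime_pow_Suc using prime_imul_subset[OF assms(1) prime_pow_ideal[OF assms(2)] OK.prime_ideal[OF assms(2)]] by auto
  then show ?case
  proof
    assume "Q \<subseteq> P"
    then show ?thesis using OK.prime_subset_eq[OF assms(2,1)] by simp
  qed (use Suc.IH in auto)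
qed

lemma int_pow_nonneg: "k \<ge> 0 \<Longrightarrow> P \<up> (k::int) = P \<up> nat k"
  using int_pow_int[of \<G> P "nat k"] by simp

lemma prime_prod_insert_nonneg:
  assumes "finite S" "P \<notin> S" "insert P S \<subseteq> primes" "u P \<ge> 0"
  shows "prime_prod (insert P S) u = (P \<up> nat (u P)) \<star> prime_prod S u"
  unfolding prime_prod_insert[OF assms(1-3)] int_pow_nonneg[OF assms(4)] ..

lemma prime_prod_ideal:
  assumes "finite S" "S \<subseteq> primes" "\<And>Q. Q \<in> S \<Longrightarrow> u Q \<ge> 0"
  shows "ideal_of \<O> (prime_prod S u)"
  using assms
proof (induction S)
  case empty then show ?case using OK.ideal_R by (simp add: prime_prod_def)
next
  case (insert P S)
  then have P: "prime_of \<O> P" and S: "ideal_of \<O> (prime_prod S u)" by auto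
  have eq: "prime_prod (insert P S) u = (P \<up> nat (u P)) \<star> prime_prod S u"
    using insert by (intro prime_prod_insert_nonneg) auto
  show ?case unfolding eq by (rule ideal_imul[OF prime_pow_ideal[OF P] S])
qed

lemma prime_prod_subsetD:
  assumes "finite S" "S \<subseteq> primes" "\<And>Q. Q \<in> S \<Longrightarrow> u Q \<ge> 0" "prime_of \<O> P" "prime_prod S u \<subseteq> P"
  shows "P \<in> S \<and> u P > 0"
  using assms
proof (induction S)
  case empty then show ?case using OK.prime_1[OF assms(4)] OK.R1 by (auto simp: prime_prod_def)
next
  case (insert Q S)
  have "prime_prod (insert Q S) u = (Q \<up> nat (u Q)) \<star> prime_prod S u"
    using insert by (intro prime_prod_insert_nonneg) auto
  then have "(Q \<up> nat (u Q)) \<subseteq> P \<or> prime_prod S u \<subseteq> P"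
    using insert by (intro prime_imul_subset prime_pow_ideal prime_prod_ideal) auto
  then show ?case
  proof
    assume "(Q \<up> nat (u Q)) \<subseteq> P"
    then show ?thesis using prime_pow_subset[of P Q "nat (u Q)"] insert by auto
  qed (use insert in auto)
qed

lemma prime_prod_subsetI:
  assumes "finite S" "S \<subseteq> primes" "\<And>Q. Q \<in> S \<Longrightarrow> u Q \<ge> 0" "P \<in> S" "u P > 0"
  shows "prime_prod S u \<subseteq> P"
proof -
  have P: "prime_of \<O> P" using assms by auto
  have S: "insert P (S - {P}) = S" using assms by auto
  obtain n where n: "nat (u P) = Suc n" using assms(5) by (cases "nat (u P)") auto
  have "prime_prod S u = (P \<up> nat (u P)) \<star> prime_prod (S - {P}) u"
    using prime_prod_insert_nonneg[of "S - {P}" P u] S assms by auto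
  also have "\<dots> = ((P \<up> n) \<star> prime_prod (S - {P}) u) \<star> P"
    unfolding n prime_pow_Suc by (simp only: imul_ac)
  also have "\<dots> \<subseteq> P"
    using assms P by (intro imul_subset_right ideal_imul prime_pow_ideal prime_prod_ideal OK.prime_submod) auto
  finally show ?thesis .
qed

text \<open>Splitting the exponents into positive and negative parts gives two equal integral
  products. A prime of positive exponent contains the first, hence the second, where its exponent is
  0. Applying this to \<open>u\<close> and to its negative excludes both signs.\<close>

lemma prime_prod_eq_one:
  assumes "finite S" "S \<subseteq> primes" "prime_prod S u = \<O>" "P \<in> S"
  shows "u P = 0"
proof -
  have not_pos: "\<not> w P > 0" if w: "prime_prod S w = \<O>" for w
  proof
    assume pos: "w P > 0"
    define a where "a Q = max (w Q) 0" for Q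
    define b where "b Q = max (- w Q) 0" for Q
    have "a = (\<lambda>Q. w Q + b Q)" by (auto simp: a_def b_def fun_eq_iff)
    then have "prime_prod S a = \<O> \<star> prime_prod S b" using prime_prod_add[OF assms(2)] w by simp
    also have "\<dots> = prime_prod S b"
      using prime_prod_closed[OF assms(2)] OK.frac_ideal_submod by (intro OK.imul_R) simp
    finally have "prime_prod S b \<subseteq> P"
      using prime_prod_subsetI[OF assms(1,2) _ assms(4), of a] pos by (simp add: a_def)
    then have "b P > 0" using prime_prod_subsetD[OF assms(1,2), of b P] assms by (auto simp: b_def)
    then show False using pos by (simp add: b_def)
  qed
  have "\<O> = prime_prod S (\<lambda>P. u P + - u P)" by (simp add: prime_prod_0)
  also have "\<dots> = \<O> \<star> prime_prod S (\<lambda>P. - u P)" unfolding prime_prod_add[OF assms(2)] assms(3) ..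
  also have "\<dots> = prime_prod S (\<lambda>P. - u P)"
    using prime_prod_closed[OF assms(2)] OK.frac_ideal_submod by (intro OK.imul_R) simp
  finally have "prime_prod S (\<lambda>P. - u P) = \<O>" by simp
  then show ?thesis using not_pos[OF assms(3)] not_pos[of "\<lambda>P. - u P"] by simp
qed

lemma prime_factorizationD:
  assumes "prime_factorization_of (I :: 'a set) v"
  shows "finite {P. v P \<noteq> 0}" "{P. v P \<noteq> 0} \<subseteq> primes"
  using assms OK.nonzero_primes_iff unfolding prime_factorization_of_def by auto

lemma prime_factorization_mult:
  assumes v: "prime_factorization_of (I :: 'a set) v" and w: "prime_factorization_of J w"
  shows "prime_factorization_of (I \<star> J) (\<lambda>P. v P + w P)"
proof -
  define S where "S = {P. v P \<noteq> 0} \<union> {P. w P \<noteq> 0}"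
  have S: "finite S" "S \<subseteq> primes" using prime_factorizationD[OF v] prime_factorizationD[OF w] by (auto simp: S_def)
  have "I = prime_prod S v" "J = prime_prod S w"
    using prime_factorization_of_iff[OF S] v w by (auto simp: S_def)
  moreover have "{P. v P + w P \<noteq> 0} \<subseteq> S" by (auto simp: S_def)
  ultimately show ?thesis using prime_factorization_of_iff[OF S, of "\<lambda>P. v P + w P"] prime_prod_add[OF S(2)] by simp
qed

lemma prime_factorization_one: "prime_factorization_of \<O> (\<lambda>_. 0)"
  using prime_factorization_of_iff[of "{}" "\<lambda>_. 0" \<O>] by (simp add: prime_prod_0)

lemma prime_factorization_prime:
  assumes "prime_of \<O> P" shows "prime_factorization_of P (\<lambda>Q. if Q = P then 1 else 0)"
proof -
  have "prime_prod {P} (\<lambda>Q. if Q = P then 1 else 0) = (P \<up> (1::int)) \<star> \<O>"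
    using prime_prod_insert[of "{}" P] assms by (simp add: prime_prod_def)
  also have "\<dots> = P"
    using G.int_pow_1[OF prime_carrier[OF assms]] OK.imul_R[OF OK.prime_submod[OF assms]] imul_commute[of P \<O>] by simp
  finally show ?thesis using prime_factorization_of_iff[of "{P}" "\<lambda>Q. if Q = P then 1 else 0" P] assms by auto
qed

text \<open>The quotient of two factorizations, taken over the union of their supports, is a
  factorization of the unit ideal.\<close>

lemma prime_factorization_unique:
  assumes v: "prime_factorization_of (I :: 'a set) v" and w: "prime_factorization_of I w"
  shows "v = w"
proof -
  define S where "S = {P. v P \<noteq> 0} \<union> {P. w P \<noteq> 0}"
  have S: "finite S" "S \<subseteq> primes" using prime_factorizationD[OF v] prime_factorizationD[OF w] by (auto simp: S_def)
  have I: "I = prime_prod S v" "I = prime_prod S w"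
    using prime_factorization_of_iff[OF S] v w by (auto simp: S_def)
  have "prime_prod S v = prime_prod S (\<lambda>P. (v P - w P) + w P)" by simp
  also have "\<dots> = prime_prod S (\<lambda>P. v P - w P) \<otimes>\<^bsub>\<G>\<^esub> prime_prod S w"
    unfolding prime_prod_add[OF S(2)] by simp
  finally have "prime_prod S (\<lambda>P. v P - w P) \<otimes>\<^bsub>\<G>\<^esub> I = I" using I by simp
  moreover have "I \<in> carrier \<G>" unfolding I(1) by (rule prime_prod_closed[OF S(2)])
  ultimately have "prime_prod S (\<lambda>P. v P - w P) = \<one>\<^bsub>\<G>\<^esub>"
    using G.r_cancel_one[OF _ prime_prod_closed[OF S(2)]] by blast
  then have "v P - w P = 0" if "P \<in> S" for P
    using prime_prod_eq_one[OF S _ that, of "\<lambda>P. v P - w P"] by simp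
  then have "v P = w P" for P by (cases "P \<in> S") (auto simp: S_def)
  then show ?thesis by blast
qed

lemma ex_prime_factorization_integral: "ideal_of \<O> I \<Longrightarrow> I \<noteq> {0} \<Longrightarrow> \<exists>v. prime_factorization_of I v"
proof (induction rule: integral_ideal_induct)
  case unit show ?case using prime_factorization_one by blast
next
  case (prime P J)
  then show ?case using prime_factorization_mult[OF prime_factorization_prime] by blast
qed

lemma prime_factorization_inverse:
  assumes v: "prime_factorization_of I v" and J: "OK.frac_ideal J" "I \<star> J = \<O>"
  shows "prime_factorization_of J (\<lambda>P. - v P)"
proof -
  define S where "S = {P. v P \<noteq> 0}"
  have S: "finite S" "S \<subseteq> primes" using prime_factorizationD[OF v] by (auto simp: S_def)
  have I: "I = prime_prod S v" using prime_factorization_of_iff[OF S] v by (auto simp: S_def)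
  define X where "X = prime_prod S (\<lambda>P. - v P)"
  have "I \<star> X = prime_prod S (\<lambda>P. v P + - v P)" unfolding I X_def by (rule prime_prod_add[OF S(2), symmetric])
  then have IX: "I \<star> X = \<O>" by (simp add: prime_prod_0)
  have X: "OK.frac_ideal X" using prime_prod_closed[OF S(2)] by (simp add: X_def)
  have "X = X \<star> (I \<star> J)" using OK.imul_R[OF OK.frac_ideal_submod[OF X]] J(2) imul_commute by metis
  also have "\<dots> = (I \<star> X) \<star> J" by (simp only: imul_ac)
  also have "\<dots> = J" using IX OK.imul_R[OF OK.frac_ideal_submod[OF J(1)]] by simp
  finally show ?thesis using prime_factorization_of_iff[OF S, of "\<lambda>P. - v P" J] by (auto simp: X_def S_def)
qed

lemma ex_prime_factorization: "OK.frac_ideal I \<Longrightarrow> \<exists>v. prime_factorization_of I v"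
proof -
  assume I: "OK.frac_ideal I"
  then obtain d where d: "d \<in> \<O>" "d \<noteq> 0" "ideal_of \<O> (principal \<O> d \<star> I)" "principal \<O> d \<star> I \<noteq> {0}"
    by (rule OK_frac_ideal_clear_denominator)
  obtain v where v: "prime_factorization_of (principal \<O> d \<star> I) v" using ex_prime_factorization_integral d by blast
  obtain w where w: "prime_factorization_of (principal \<O> d) w"
    using ex_prime_factorization_integral[OF ideal_principal[OF d(1)] OK.principal_nonzero[OF d(2)]] by blast
  obtain K where K: "OK.frac_ideal K" "principal \<O> d \<star> K = \<O>"
    using OK_frac_ideal_unit[OF OK.frac_ideal_principal[OF d(2)]] by blast
  have "K \<star> (principal \<O> d \<star> I) = (principal \<O> d \<star> K) \<star> I" by (simp only: imul_ac)
  also have "\<dots> = I" using K OK.imul_R[OF OK.frac_ideal_submod[OF I]] by simp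
  finally show ?thesis using prime_factorization_mult[OF prime_factorization_inverse[OF w K] v] by auto
qed

section \<open>Orders of ideals and elements at a prime\<close>

text \<open>Uniqueness resolves the definite description in \<open>ideal_ord\<close>; from here on
  an order is computed by exhibiting a factorization.\<close>

lemma ideal_ord_eq: "prime_factorization_of (I :: 'a set) v \<Longrightarrow> ideal_ord P I = v P"
  unfolding ideal_ord_def using prime_factorization_unique by (subst the_equality) auto

lemma ideal_ord_factorization: "OK.frac_ideal I \<Longrightarrow> prime_factorization_of I (\<lambda>P. ideal_ord P I)"
  using ex_prime_factorization[of I] ideal_ord_eq by (metis ext)

lemma ideal_ord_mult: "OK.frac_ideal I \<Longrightarrow> OK.frac_ideal J \<Longrightarrow> ideal_ord P (I \<star> J) = ideal_ord P I + ideal_ord P J"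
  by (rule ideal_ord_eq[OF prime_factorization_mult]) (auto intro: ideal_ord_factorization)

lemma ideal_ord_one: "ideal_ord P \<O> = 0"
  by (rule ideal_ord_eq[OF prime_factorization_one])

lemma ideal_ord_prime: "prime_of \<O> Q \<Longrightarrow> ideal_ord P Q = (if P = Q then 1 else 0)"
  by (rule ideal_ord_eq[OF prime_factorization_prime])

lemma ideal_ord_integral:
  assumes P: "prime_of \<O> P" and "ideal_of \<O> I" "I \<noteq> {0}"
  shows "ideal_ord P I \<ge> 0 \<and> (I \<subseteq> P \<longleftrightarrow> ideal_ord P I > 0)"
  using assms(2,3)
proof (induction rule: integral_ideal_induct)
  case unit then show ?case using OK.prime_1[OF P] OK.R1 by (auto simp: ideal_ord_one)
next
  case (prime Q J)
  have v: "ideal_ord P (Q \<star> J) = (if P = Q then 1 else 0) + ideal_ord P J"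
    using prime by (simp add: ideal_ord_mult ideal_ord_prime OK.ideal_frac_ideal prime_of_def)
  have "Q \<star> J \<subseteq> P \<longleftrightarrow> Q = P \<or> J \<subseteq> P"
  proof
    assume "Q \<star> J \<subseteq> P"
    then have "Q \<subseteq> P \<or> J \<subseteq> P" using prime_imul_subset[OF P OK.prime_ideal[OF prime(1)] prime(2)] by auto
    then show "Q = P \<or> J \<subseteq> P" using OK.prime_subset_eq[OF prime(1) P] by auto
  next
    assume "Q = P \<or> J \<subseteq> P"
    moreover have "J \<star> Q \<subseteq> Q" using prime by (intro imul_subset_right OK.prime_submod)
    moreover have "Q \<star> J \<subseteq> J"
      using prime(2) by (intro imul_subset_right OK.prime_ideal[OF prime(1)]) (simp add: ideal_of_def)
    ultimately show "Q \<star> J \<subseteq> P" using imul_commute[of J Q] by blast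
  qed
  then show ?case using v prime.IH by auto
qed

text \<open>The product of the primes of negative order, with multiplicity, clears \<open>I\<close>
  and is not contained in \<open>P\<close>, so it supplies a denominator for the whole ideal.
  Conversely such a denominator has order 0 at \<open>P\<close> and makes \<open>I\<close>
  integral.\<close>

lemma ideal_ord_nonneg_iff:
  assumes P: "prime_of \<O> P" and I: "OK.frac_ideal I"
  shows "ideal_ord P I \<ge> 0 \<longleftrightarrow> (\<exists>s\<in>\<O> - P. \<forall>x\<in>I. s * x \<in> \<O>)"
proof
  assume "\<exists>s\<in>\<O> - P. \<forall>x\<in>I. s * x \<in> \<O>"
  then obtain s where s: "s \<in> \<O>" "s \<notin> P" "\<forall>x\<in>I. s * x \<in> \<O>" by auto
  have s0: "s \<noteq> 0" using s submod_0[OF OK.prime_submod[OF P]] by auto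
  have "ideal_of \<O> (principal \<O> s \<star> I)"
    using scaled_ideal[OF I] s by blast
  moreover have "principal \<O> s \<star> I \<noteq> {0}"
    using s0 by (intro OK.imul_nonzero OK.submod_principal OK.principal_nonzero OK.frac_ideal_submod[OF I] OK.frac_ideal_nonzero[OF I])
  ultimately have "ideal_ord P (principal \<O> s \<star> I) \<ge> 0" using ideal_ord_integral[OF P] by auto
  moreover have "ideal_ord P (principal \<O> s) = 0"
    using ideal_ord_integral[OF P ideal_principal[OF s(1)] OK.principal_nonzero[OF s0]] OK.self_in_principal[of s] s(2) by force
  ultimately show "ideal_ord P I \<ge> 0"
    using ideal_ord_mult[OF OK.frac_ideal_principal[OF s0] I] by simp
next
  assume pos: "ideal_ord P I \<ge> 0"
  define S where "S = {Q. ideal_ord Q I \<noteq> 0}"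
  define a where "a Q = max (ideal_ord Q I) 0" for Q
  define b where "b Q = max (- ideal_ord Q I) 0" for Q
  note v = ideal_ord_factorization[OF I]
  have S: "finite S" "S \<subseteq> primes" using prime_factorizationD[OF v] by (auto simp: S_def)
  have "I = prime_prod S (\<lambda>Q. ideal_ord Q I)"
    using prime_factorization_of_iff[OF S, of "\<lambda>Q. ideal_ord Q I" I] v by (simp add: S_def)
  moreover have "a = (\<lambda>Q. b Q + ideal_ord Q I)" by (auto simp: a_def b_def fun_eq_iff)
  ultimately have "prime_prod S b \<star> I = prime_prod S a" using prime_prod_add[OF S(2)] by simp
  moreover have "ideal_of \<O> (prime_prod S a)" "ideal_of \<O> (prime_prod S b)"
    by (rule prime_prod_ideal[OF S], simp add: a_def b_def)+
  ultimately have sub: "prime_prod S b \<star> I \<subseteq> \<O>" "prime_prod S b \<subseteq> \<O>" by (auto simp: ideal_of_def)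
  have "\<not> prime_prod S b \<subseteq> P" using prime_prod_subsetD[OF S _ P, of b] pos by (auto simp: b_def)
  then obtain s where "s \<in> prime_prod S b" "s \<notin> P" by auto
  then show "\<exists>s\<in>\<O> - P. \<forall>x\<in>I. s * x \<in> \<O>" using sub imulI[of s "prime_prod S b"] by blast
qed

text \<open>The localization of the integers at \<open>P\<close>, that is, the valuation ring of
  \<open>P\<close>.\<close>

definition local_at :: "'a set \<Rightarrow> 'a set" where
  "local_at P = {x. \<exists>s\<in>\<O> - P. s * x \<in> \<O>}"

lemma elem_ord_nonneg_iff:
  assumes P: "prime_of \<O> P" and x: "x \<noteq> 0"
  shows "elem_ord P x \<ge> 0 \<longleftrightarrow> x \<in> local_at P"
proof -
  have "(\<forall>y\<in>principal \<O> x. s * y \<in> \<O>) \<longleftrightarrow> s * x \<in> \<O>" for s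
  proof
    assume "s * x \<in> \<O>"
    then show "\<forall>y\<in>principal \<O> x. s * y \<in> \<O>"
      using OK.R_mult[of "s * x"] by (auto simp: principal_def mult.assoc)
  qed (use OK.self_in_principal[of x] in blast)
  then show ?thesis
    unfolding elem_ord_def ideal_ord_nonneg_iff[OF P OK.frac_ideal_principal[OF x]] local_at_def by simp
qed

lemma elem_ord_mult: "(x :: 'a) \<noteq> 0 \<Longrightarrow> y \<noteq> 0 \<Longrightarrow> elem_ord P (x * y) = elem_ord P x + elem_ord P y"
  unfolding elem_ord_def OK.principal_mult by (intro ideal_ord_mult OK.frac_ideal_principal)

lemma elem_ord_1: "elem_ord P (1 :: 'a) = 0"
  by (simp add: elem_ord_def OK.principal_one ideal_ord_one)

lemma elem_ord_power: "(x :: 'a) \<noteq> 0 \<Longrightarrow> elem_ord P (x ^ n) = int n * elem_ord P x"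
  by (induction n) (auto simp: elem_ord_mult elem_ord_1 algebra_simps)

lemma frac_ideal_generate:
  assumes I: "OK.frac_ideal I" and X: "X \<subseteq> primes" "\<And>P. prime_of \<O> P \<Longrightarrow> ideal_ord P I \<noteq> 0 \<Longrightarrow> P \<in> X"
  shows "I \<in> generate \<G> X"
proof -
  have XG: "X \<subseteq> carrier \<G>" using X prime_carrier by auto
  have sg: "subgroup (generate \<G> X) \<G>" by (rule G.generate_is_subgroup[OF XG])
  have gen: "prime_prod S u \<in> generate \<G> X" if "finite S" "S \<subseteq> X" for S u
    using that
  proof (induction S)
    case empty then show ?case using generate.one[of \<G> X] by (simp add: prime_prod_def)
  next
    case (insert P S)
    have "P \<in> generate \<G> X" using insert by (auto intro: generate.incl)
    then have "P \<up> u P \<in> generate \<G> X" using G.subgroup_int_pow_closed[OF sg] by blast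
    moreover have "prime_prod S u \<in> generate \<G> X" using insert by simp
    moreover have "prime_prod (insert P S) u = (P \<up> u P) \<otimes>\<^bsub>\<G>\<^esub> prime_prod S u"
      using prime_prod_insert[OF insert.hyps, of u] insert.prems X(1) by auto
    ultimately show ?case by (simp only: generate.eng)
  qed
  have v: "prime_factorization_of I (\<lambda>P. ideal_ord P I)" by (rule ideal_ord_factorization[OF I])
  have "{P. ideal_ord P I \<noteq> 0} \<subseteq> X" using prime_factorizationD[OF v] X by auto
  moreover have "I = prime_prod {P. ideal_ord P I \<noteq> 0} (\<lambda>P. ideal_ord P I)"
    using prime_factorization_of_iff[of "{P. ideal_ord P I \<noteq> 0}" "\<lambda>P. ideal_ord P I" I] prime_factorizationD[OF v] v by auto
  ultimately show ?thesis using gen prime_factorizationD(1)[OF v] by metis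
qed

subsection \<open>Poles\<close>

lemma local_at_integers: "prime_of \<O> P \<Longrightarrow> \<O> \<subseteq> local_at P"
  using OK.R1 OK.prime_1[of P] by (auto simp: local_at_def intro!: bexI[of _ 1])

lemma local_at_subring: "prime_of \<O> P \<Longrightarrow> subring_set (local_at P)"
proof
  assume P: "prime_of \<O> P"
  have mem: "x \<in> local_at P" if "x \<in> \<O>" for x using local_at_integers[OF P] that by auto
  show "0 \<in> local_at P" "1 \<in> local_at P" by (auto intro: mem OK.R0 OK.R1)
  fix x y assume "x \<in> local_at P" "y \<in> local_at P"
  then obtain s t where st: "s \<in> \<O>" "s \<notin> P" "s * x \<in> \<O>" "t \<in> \<O>" "t \<notin> P" "t * y \<in> \<O>"
    by (auto simp: local_at_def)
  have "s * t \<in> \<O> - P" using st OK.prime_mult[OF P] OK.R_mult by auto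
  moreover have "s * t * (x + y) = t * (s * x) + s * (t * y)" "s * t * (x * y) = (s * x) * (t * y)"
    by (simp_all add: algebra_simps)
  then have "s * t * (x + y) \<in> \<O>" "s * t * (x * y) \<in> \<O>"
    using st by (auto simp only: intro: OK.R_add OK.R_mult)
  ultimately show "x + y \<in> local_at P" "x * y \<in> local_at P"
    unfolding local_at_def by blast+
next
  fix x assume "x \<in> local_at P"
  then obtain s where "s \<in> \<O> - P" "s * x \<in> \<O>" by (auto simp: local_at_def)
  then show "- x \<in> local_at P" using OK.R_minus[of "s * x"] by (auto simp: local_at_def intro!: bexI[of _ s])
qed

text \<open>\<open>I\<close> is the inverse of \<open>P\<close> times \<open>D\<close>; were it
  inside \<open>D\<close>, cancellation would give \<open>P = \<O>\<close>. The last clause either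
  supplies an element of \<open>I\<close> outside \<open>D\<close> or is contradicted by an argument
  that keeps \<open>I\<close> inside \<open>D\<close>.\<close>

lemma ideal_quotient_by_prime:
  assumes P: "prime_of \<O> P" and D: "ideal_of \<O> D" "D \<noteq> {0}" "D \<subseteq> P"
  obtains I where "ideal_of \<O> I" "P \<star> I = D" "\<not> I \<subseteq> D"
proof -
  define I where "I = OK.inv_of P \<star> D"
  have PI: "P \<star> I = D"
    unfolding I_def imul_assoc[symmetric] using OK.reg_prime_imul_inv[of P] P D(1) OK_reg_prime
    by (simp add: OK.imul_R ideal_of_def)
  have "submod \<O> I" unfolding I_def using D by (intro submod_imul2 OK.submod_inv_of) (simp add: ideal_of_def)
  moreover have "I \<subseteq> \<O>"
    unfolding I_def by (rule imul_subset[OF OK.submod_R]) (use D in \<open>auto simp: OK.inv_of_def\<close>)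
  ultimately have I: "ideal_of \<O> I" by (simp add: ideal_of_def)
  have I0: "I \<noteq> {0}"
  proof
    assume "I = {0}"
    then have "D \<subseteq> {0}" unfolding PI[symmetric] by (intro imul_subset[of \<O>]) (auto simp: submod_def)
    then show False using D submod_0[of \<O> D] by (auto simp: ideal_of_def)
  qed
  have "\<not> I \<subseteq> D"
  proof
    assume "I \<subseteq> D"
    moreover have "D \<subseteq> I" unfolding PI[symmetric]
      using I by (intro imul_subset_right OK.prime_ideal[OF P]) (simp add: ideal_of_def)
    ultimately have "P \<otimes>\<^bsub>\<G>\<^esub> I = I" using PI by simp
    moreover have "I \<in> carrier \<G>" using OK.ideal_frac_ideal[OF I I0] by simp
    ultimately have "P = \<one>\<^bsub>\<G>\<^esub>" using G.r_cancel_one[of I P] prime_carrier[OF P] by blast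
    then show False using OK.prime_1[OF P] OK.R1 by simp
  qed
  then show ?thesis using I PI that by blast
qed

lemma ideal_common_denominators:
  assumes "OK.frac_ideal A"
  shows "ideal_of \<O> {s \<in> \<O>. \<forall>a\<in>A. s * a \<in> \<O>}" "{s \<in> \<O>. \<forall>a\<in>A. s * a \<in> \<O>} \<noteq> {0}"
proof -
  show "ideal_of \<O> {s \<in> \<O>. \<forall>a\<in>A. s * a \<in> \<O>}"
    unfolding ideal_of_def submod_def by (auto simp: distrib_right mult.assoc intro: OK.R_intros)
  show "{s \<in> \<O>. \<forall>a\<in>A. s * a \<in> \<O>} \<noteq> {0}" using OK.frac_ideal_denom[OF assms] by auto
qed

lemma ideal_denominators: "submod \<O> M \<Longrightarrow> ideal_of \<O> {s \<in> \<O>. s * y \<in> M}"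
  unfolding ideal_of_def submod_def by (auto simp: distrib_right mult.assoc intro: OK.R_intros)

lemma denominators_nonzero: "\<O> \<subseteq> M \<Longrightarrow> {s \<in> \<O>. s * y \<in> M} \<noteq> {0}"
proof
  assume M: "\<O> \<subseteq> M" and eq: "{s \<in> \<O>. s * y \<in> M} = {0}"
  obtain N :: int where "N > 0" "of_int N * y \<in> \<O>" using OK.ex_int_multiple_in_R by blast
  then have "of_int N \<in> {s \<in> \<O>. s * y \<in> M}" using M OK.R_of_int by auto
  then show False using eq \<open>N > 0\<close> by simp
qed

text \<open>If \<open>y\<close> has a pole at \<open>P\<close>, some multiple of it has a simple pole there and no other pole.\<close>

lemma pole_generates_unit:
  assumes P: "prime_of \<O> P" and y: "y \<notin> local_at P"
  obtains i p where "i \<in> \<O>" "p \<in> P" "1 - i * y * p \<in> P"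
proof -
  define D where "D = {s \<in> \<O>. s * y \<in> \<O>}"
  have D: "ideal_of \<O> D" "D \<noteq> {0}" "D \<subseteq> P"
    using ideal_denominators[OF OK.submod_R] denominators_nonzero[OF subset_refl] y
    by (auto simp: D_def local_at_def)
  obtain I where I: "ideal_of \<O> I" "P \<star> I = D" "\<not> I \<subseteq> D"
    using ideal_quotient_by_prime[OF P D] by blast
  then obtain i where i: "i \<in> I" "i \<notin> D" by auto
  have iO: "i \<in> \<O>" using i I by (auto simp: ideal_of_def)
  have notO: "i * y \<notin> \<O>" using i iO by (auto simp: D_def)
  have sub: "i * y * p \<in> \<O>" if "p \<in> P" for p
    using imulI[OF that i(1)] I(2) by (auto simp: D_def ac_simps)
  \<comment> \<open>If \<open>i * y\<close> mapped \<open>P\<close> into itself, it would be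
    integral. A product leaving \<open>P\<close> can then be inverted modulo
    \<open>P\<close>.\<close>
  have "\<exists>p\<in>P. i * y * p \<notin> P"
  proof (rule ccontr)
    assume "\<not> ?thesis"
    then have "i * y \<in> \<O>"
      using P by (intro integers_stable[of P]) (auto simp: prime_of_def ideal_of_def)
    then show False using notO by simp
  qed
  then obtain p where p: "p \<in> P" "i * y * p \<notin> P" by auto
  obtain r where r: "r \<in> \<O>" "1 - r * (i * y * p) \<in> P" using OK.prime_unit[OF P sub[OF p(1)] p(2)] by blast
  show ?thesis
    using that[OF iO submod_mult[OF OK.prime_submod[OF P] r(1) p(1)]] r(2) by (simp add: ac_simps)
qed

text \<open>Membership in \<open>local_at P\<close> only gives denominators element by element. But
  1 is a finite sum of products \<open>a * b\<close>, and a denominator of \<open>a\<close> clears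
  \<open>a * b * x = a * (x * b)\<close> for all \<open>x\<close> in \<open>A\<close> at
  once.\<close>

lemma local_denominator_of_unit:
  assumes P: "prime_of \<O> P" and A: "A \<subseteq> local_at P" "A \<star> B = \<O>"
  shows "\<exists>s\<in>\<O> - P. \<forall>a\<in>A. s * a \<in> \<O>"
proof -
  have "\<exists>s\<in>\<O> - P. \<forall>a\<in>A. s * (z * a) \<in> \<O>" if "z \<in> A \<star> B" for z
    using that
  proof (induction rule: imul_induct)
    case (prod a b)
    then obtain s where s: "s \<in> \<O> - P" "s * a \<in> \<O>" using A by (auto simp: local_at_def)
    have "s * (a * b * x) \<in> \<O>" if "x \<in> A" for x
      using OK.R_mult[OF s(2), of "x * b"] imulI[OF that prod(2)] A(2) by (simp add: ac_simps)
    then show ?case using s by blast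
  next
    case (add u v)
    then obtain s t where st: "s \<in> \<O> - P" "\<forall>a\<in>A. s * (u * a) \<in> \<O>" "t \<in> \<O> - P" "\<forall>a\<in>A. t * (v * a) \<in> \<O>" by blast
    have "s * t \<in> \<O> - P" using st OK.prime_mult[OF P] OK.R_mult by auto
    moreover have "s * t * ((u + v) * a) \<in> \<O>" if "a \<in> A" for a
    proof -
      have "s * t * ((u + v) * a) = t * (s * (u * a)) + s * (t * (v * a))" by (simp add: algebra_simps)
      moreover have "t * (s * (u * a)) \<in> \<O>" by (rule OK.R_mult) (use st that in auto)
      moreover have "s * (t * (v * a)) \<in> \<O>" by (rule OK.R_mult) (use st that in auto)
      ultimately show ?thesis by (simp only: OK.R_add)
    qed
    ultimately show ?case by blast
  qed
  from this[of 1] show ?thesis using A(2) OK.R1 by simp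
qed

end

section \<open>The integral closure of \<open>R\<close> as the compositum of \<open>\<O>\<close> and
  \<open>R\<close>\<close>

context nf_subring
begin

abbreviation "Cl \<equiv> integral_closure R"
abbreviation "\<ff> \<equiv> conductor R"
abbreviation "polar \<equiv> polar_primes R"
abbreviation "\<mm> \<equiv> subring_modulus R"

lemma polar_iff: "P \<in> polar \<longleftrightarrow> prime_of \<O> P \<and> \<not> R \<subseteq> local_at P"
proof -
  have "0 \<in> local_at P" if "prime_of \<O> P" using subring_set.R0[OF local_at_subring[OF that]] .
  then show ?thesis
    using elem_ord_nonneg_iff unfolding polar_primes_def OK.nonzero_primes_iff
    by (auto simp: subset_iff not_less[symmetric]) (metis not_less)+
qed

lemma OR_mult: "x \<in> \<O> \<star> R \<Longrightarrow> y \<in> \<O> \<star> R \<Longrightarrow> x * y \<in> \<O> \<star> R"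
proof -
  assume "x \<in> \<O> \<star> R" "y \<in> \<O> \<star> R"
  then have "x * y \<in> \<O> \<star> R \<star> (\<O> \<star> R)" by (rule imulI)
  also have "\<O> \<star> R \<star> (\<O> \<star> R) = (\<O> \<star> \<O>) \<star> (R \<star> R)" by (simp only: imul_ac)
  finally show ?thesis by (simp only: imul_R[OF submod_R] OK.imul_R[OF OK.submod_R])
qed

lemma O_subset_OR: "\<O> \<subseteq> \<O> \<star> R" using imulI[of _ \<O> 1 R] R1 by auto
lemma R_subset_OR: "R \<subseteq> \<O> \<star> R" using imulI[of 1 \<O> _ R] OK.R1 by auto

lemma submod_O_OR: "submod \<O> (\<O> \<star> R)" by (rule submod_imul[OF OK.submod_R R0])

lemma ex_int_OR: "\<exists>N::int. N > 0 \<and> (\<forall>y\<in>\<O> \<star> R. of_int N * y \<in> R)"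
proof -
  obtain N :: int where N: "N > 0" "\<forall>y. algebraic_int y \<longrightarrow> of_int N * y \<in> R" using ex_int_conductor by blast
  have "\<O> \<star> R \<subseteq> {y. of_int N * y \<in> R}"
  proof (rule imul_subset)
    show "submod \<int> {y. of_int N * y \<in> R}"
      by (auto simp: submod_def distrib_left mult.left_commute elim!: Ints_cases intro: R_intros)
    fix a b assume "a \<in> \<O>" "b \<in> R"
    then have "of_int N * a * b \<in> R" using R_mult[of "of_int N * a" b] N by (simp add: ring_of_integers_def)
    then show "a * b \<in> {y. of_int N * y \<in> R}" by (simp add: mult.assoc)
  qed
  then show ?thesis using N(1) by blast
qed

lemma OR_subset_Cl: "\<O> \<star> R \<subseteq> Cl"
proof
  fix z assume z: "z \<in> \<O> \<star> R"
  obtain N :: int where N: "N > 0" "\<forall>y\<in>\<O> \<star> R. of_int N * y \<in> R" using ex_int_OR by blast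
  have "z ^ n \<in> \<O> \<star> R" for n
    by (induction n) (use z OR_mult R_subset_OR R1 in auto)
  then show "z \<in> Cl" using N by (intro bounded_powers_imp_integral[of "of_int N"]) auto
qed

text \<open>An element of \<open>R\<close> with a pole at \<open>P\<close> has an
  \<open>\<O>\<close>-multiple whose product with some element of \<open>P\<close> is 1 modulo
  \<open>P\<close>; hence \<open>P\<close> generates the unit ideal.\<close>

lemma polar_unit_OR: "P \<in> polar \<Longrightarrow> 1 \<in> P \<star> (\<O> \<star> R)"
proof -
  assume "P \<in> polar"
  then obtain r where P: "prime_of \<O> P" and r: "r \<in> R" "r \<notin> local_at P" by (auto simp: polar_iff)
  obtain i p where ip: "i \<in> \<O>" "p \<in> P" "1 - i * r * p \<in> P" using pole_generates_unit[OF P r(2)] by blast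
  have "p * (i * r) + (1 - i * r * p) * 1 \<in> P \<star> (\<O> \<star> R)"
    using imul_add[OF imulI[OF ip(2) imulI[OF ip(1) r(1)]] imulI[OF ip(3), of 1 "\<O> \<star> R"]]
      O_subset_OR OK.R1 by blast
  then show ?thesis by (simp add: algebra_simps)
qed

text \<open>The ideal of denominators of \<open>y\<close> relative to \<open>\<O> \<star> R\<close>
  lies in no prime \<open>P\<close>. A polar \<open>P\<close> can be cancelled, as it generates the
  unit ideal. For any other \<open>P\<close> the valuation ring contains \<open>R\<close> and hence
  the integral element \<open>y\<close>.\<close>

lemma Cl_eq: "Cl = \<O> \<star> R"
proof
  show "Cl \<subseteq> \<O> \<star> R"
  proof
    fix y assume y: "y \<in> Cl"
    define D where "D = {s \<in> \<O>. s * y \<in> \<O> \<star> R}"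
    have D: "ideal_of \<O> D" "D \<noteq> {0}"
      unfolding D_def by (rule ideal_denominators[OF submod_O_OR], rule denominators_nonzero[OF O_subset_OR])
    have "1 \<in> D"
    proof (rule ccontr)
      assume "1 \<notin> D"
      then obtain P where P: "prime_of \<O> P" "D \<subseteq> P" using OK.ex_prime_containing[OF D] by blast
      show False
      proof (cases "P \<in> polar")
        case True
        obtain I where I: "ideal_of \<O> I" "P \<star> I = D" "\<not> I \<subseteq> D"
          using ideal_quotient_by_prime[OF P(1) D P(2)] by blast
        have "i \<in> D" if i: "i \<in> I" for i
        proof -
          have "i * y * z \<in> \<O> \<star> R" if "z \<in> P \<star> (\<O> \<star> R)" for z
            using that
          proof (induction rule: imul_induct)
            case (prod p s)
            then have "p * i \<in> D" using imulI[OF _ i] I(2) by blast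
            then have "p * i * y * s \<in> \<O> \<star> R" using OR_mult prod by (auto simp: D_def)
            then show ?case by (simp add: ac_simps)
          qed (simp add: distrib_left imul_add)
          from this[OF polar_unit_OR[OF True]] show ?thesis using i I(1) by (auto simp: D_def ideal_of_def)
        qed
        then show False using I(3) by auto
      next
        case False
        then have Rl: "R \<subseteq> local_at P" using P by (auto simp: polar_iff)
        have y0: "y \<noteq> 0"
        proof
          assume "y = 0"
          then have "1 \<in> D" using O_subset_OR OK.R0 OK.R1 by (auto simp: D_def)
          then show False using \<open>1 \<notin> D\<close> by simp
        qed
        obtain d where d: "d \<in> R" "d \<noteq> 0" "\<And>n. d * y ^ n \<in> R"
          using integral_imp_bounded_powers[OF y] by metis
        \<comment> \<open>A negative order of \<open>y\<close> would make \<open>d * y ^ n\<close>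
          negative as soon as \<open>n\<close> exceeds the order of \<open>d\<close>; this is why
          \<open>n\<close> is taken one larger below.\<close>
        have "elem_ord P d + int n * elem_ord P y \<ge> 0" for n
          using elem_ord_nonneg_iff[OF P(1), of "d * y ^ n"] d Rl y0
          by (auto simp: elem_ord_mult elem_ord_power)
        from this[of "nat (elem_ord P d) + 1"] this[of 0] have "elem_ord P y \<ge> 0"
        proof -
          assume a: "elem_ord P d + int (nat (elem_ord P d) + 1) * elem_ord P y \<ge> 0"
            and b: "elem_ord P d + int 0 * elem_ord P y \<ge> 0"
          show ?thesis
          proof (rule ccontr)
            assume "\<not> elem_ord P y \<ge> 0"
            then have "int (nat (elem_ord P d) + 1) * elem_ord P y \<le> int (nat (elem_ord P d) + 1) * (-1)"
              by (intro mult_left_mono) auto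
            then show False using a b by simp
          qed
        qed
        then obtain s where "s \<in> \<O>" "s \<notin> P" "s * y \<in> \<O>"
          using elem_ord_nonneg_iff[OF P(1) y0] by (auto simp: local_at_def)
        then have "s \<in> D" using O_subset_OR by (auto simp: D_def)
        then show False using \<open>s \<notin> P\<close> P(2) by auto
      qed
    qed
    then show "y \<in> \<O> \<star> R" by (simp add: D_def)
  qed
qed (rule OR_subset_Cl)

lemma Cl_mult: "x \<in> Cl \<Longrightarrow> y \<in> Cl \<Longrightarrow> x * y \<in> Cl"
  and Cl_add: "x \<in> Cl \<Longrightarrow> y \<in> Cl \<Longrightarrow> x + y \<in> Cl"
  and O_subset_Cl: "\<O> \<subseteq> Cl"
  and submod_O_Cl: "submod \<O> Cl"
  unfolding Cl_eq using OR_mult imul_add O_subset_OR submod_O_OR by auto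

lemma Cl_1: "1 \<in> Cl" using O_subset_Cl OK.R1 by auto
lemma Cl_0: "0 \<in> Cl" using O_subset_Cl OK.R0 by auto

lemma submod_Cl: "submod Cl Cl"
  by (auto simp: submod_def Cl_add Cl_mult Cl_0)

lemma Cl_imul_O: "\<O> \<star> Cl = Cl" by (rule OK.imul_R[OF submod_O_Cl])

lemma Cl_imul_Cl: "Cl \<star> Cl = Cl"
proof
  show "Cl \<star> Cl \<subseteq> Cl" by (rule imul_subset[OF submod_Cl]) (rule Cl_mult)
  show "Cl \<subseteq> Cl \<star> Cl" using imulI[OF Cl_1] by fastforce
qed

lemma polar_unit: "P \<in> polar \<Longrightarrow> 1 \<in> P \<star> Cl"
  using polar_unit_OR by (simp add: Cl_eq)

lemma Cl_local_at: "prime_of \<O> P \<Longrightarrow> P \<notin> polar \<Longrightarrow> Cl \<subseteq> local_at P"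
proof -
  assume P: "prime_of \<O> P" "P \<notin> polar"
  interpret L: subring_set "local_at P" by (rule local_at_subring[OF P(1)])
  show ?thesis unfolding Cl_eq
    by (rule imul_subset[OF L.submod_R]) (use P local_at_integers[OF P(1)] polar_iff L.R_mult in blast)
qed

section \<open>The conductor and the primes dividing the modulus\<close>

lemma conductor_mult_Cl: "c \<in> \<ff> \<Longrightarrow> y \<in> Cl \<Longrightarrow> c * y \<in> \<ff>"
  using Cl_mult by (auto simp: conductor_def mult.assoc)

lemma conductor_mult_R: "c \<in> \<ff> \<Longrightarrow> y \<in> Cl \<Longrightarrow> c * y \<in> R"
  by (auto simp: conductor_def)

text \<open>The uniform denominator of \<open>\<O> \<star> R\<close> lies in the conductor because
  this ring is the integral closure. In particular the conductor is nonzero.\<close>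

lemma ex_int_in_conductor: "\<exists>N::int. N > 0 \<and> of_int N \<in> \<ff>"
  using ex_int_OR by (auto simp: conductor_def Cl_eq)

text \<open>The paper's ideal \<open>f\<close> with a tilde.\<close>

definition fin_conductor :: "'a set" where "fin_conductor = \<ff> \<inter> \<O>"

lemma fin_conductor_ideal: "ideal_of \<O> fin_conductor" "fin_conductor \<noteq> {0}"
proof -
  have "submod \<O> \<ff>"
    unfolding submod_def
  proof (intro conjI ballI)
    fix r x assume "r \<in> \<O>" "x \<in> \<ff>"
    then show "r * x \<in> \<ff>" using conductor_mult_Cl[of x r] O_subset_Cl by (auto simp: mult.commute)
  qed (use submod_0[OF submod_conductor] submod_add[OF submod_conductor] in auto)
  then show "ideal_of \<O> fin_conductor"
    unfolding ideal_of_def fin_conductor_def using submod_Int[OF _ OK.submod_R] by blast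
  obtain N :: int where "N > 0" "of_int N \<in> \<ff>" using ex_int_in_conductor by blast
  then have "of_int N \<in> fin_conductor" using OK.R_of_int by (simp add: fin_conductor_def)
  then show "fin_conductor \<noteq> {0}" using \<open>N > 0\<close> by auto
qed

text \<open>The primes not dividing the modulus, by the last part of \<open>modulus_props\<close>;
  this form refers to \<open>R\<close> directly instead of to a product over the polar
  primes.\<close>

definition good_prime :: "'a set \<Rightarrow> bool" where
  "good_prime P \<longleftrightarrow> prime_of \<O> P \<and> P \<notin> polar \<and> \<not> fin_conductor \<subseteq> P"

lemma modulus_props:
  assumes "finite polar"
  shows "ideal_of \<O> (\<mm>)" "\<mm> \<noteq> {0}"
    "\<mm> \<subseteq> fin_conductor"
    "\<And>P. prime_of \<O> P \<Longrightarrow> \<mm> \<subseteq> P \<longleftrightarrow> \<not> good_prime P"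
proof -
  define X where "X = prime_prod polar (\<lambda>_. 1)"
  have pol: "polar \<subseteq> primes" by (auto simp: polar_iff)
  have "(\<Otimes>\<^bsub>\<G>\<^esub>P\<in>polar. P) = X"
    unfolding X_def prime_prod_def
    by (rule G.finprod_cong') (use pol prime_carrier G.int_pow_1 in \<open>auto intro!: G.int_pow_closed\<close>)
  then have m: "\<mm> = fin_conductor \<star> X"
    by (simp add: subring_modulus_def fin_conductor_def)
  have X: "ideal_of \<O> X" unfolding X_def by (rule prime_prod_ideal[OF assms pol]) simp
  have X0: "X \<noteq> {0}" using prime_prod_closed[OF pol, of "\<lambda>_. 1"] OK.frac_ideal_nonzero by (simp add: X_def)
  show "ideal_of \<O> (\<mm>)" unfolding m by (rule ideal_imul[OF fin_conductor_ideal(1) X])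
  show "\<mm> \<noteq> {0}" unfolding m
    using fin_conductor_ideal X X0 by (intro OK.imul_nonzero) (auto simp: ideal_of_def)
  have sub1: "\<mm> \<subseteq> fin_conductor" unfolding m
    using imul_subset_right[OF X, of fin_conductor] fin_conductor_ideal(1) imul_commute[of X]
    by (simp add: ideal_of_def)
  then show "\<mm> \<subseteq> fin_conductor" .
  have sub2: "\<mm> \<subseteq> X" unfolding m
    using imul_subset_right[OF fin_conductor_ideal(1), of X] X by (simp add: ideal_of_def)
  fix P assume P: "prime_of \<O> P"
  have "X \<subseteq> P \<longleftrightarrow> P \<in> polar"
    using prime_prod_subsetD[OF assms pol _ P, of "\<lambda>_. 1"] prime_prod_subsetI[OF assms pol, of "\<lambda>_. 1" P]
    by (auto simp: X_def)
  then show "\<mm> \<subseteq> P \<longleftrightarrow> \<not> good_prime P"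
    using sub1 sub2 prime_imul_subset[OF P fin_conductor_ideal(1) X] P unfolding m good_prime_def by blast
qed

subsection \<open>The homomorphism between the ideal groups\<close>

definition JK :: "'a set set" where
  "JK = {I. OK.frac_ideal I \<and> (\<forall>P. prime_of \<O> P \<longrightarrow> good_prime P \<or> ideal_ord P I = 0)}"

definition conductor_local :: "'a set" where
  "conductor_local = {x. \<exists>t\<in>R. 1 - t \<in> \<ff> \<and> t * x \<in> R}"

text \<open>For integral \<open>A\<close> coprime to the modulus this is \<open>A Cl \<inter> R\<close>; the localization
  \<open>conductor_local\<close> makes the formula correct for fractional \<open>A\<close>.\<close>

definition contract :: "'a set \<Rightarrow> 'a set" where
  "contract A = (A \<star> Cl) \<inter> conductor_local"

lemma one_mod_conductor_mult:
  assumes "t \<in> R" "1 - t \<in> \<ff>" "s \<in> R" "1 - s \<in> \<ff>"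
  shows "t * s \<in> R" "1 - t * s \<in> \<ff>"
proof -
  show "t * s \<in> R" using assms by (intro R_mult)
  have "1 - t * s = (1 - t) + t * (1 - s)" by (simp add: algebra_simps)
  also have "\<dots> \<in> \<ff>" using assms by (intro submod_add[OF submod_conductor] submod_mult[OF submod_conductor])
  finally show "1 - t * s \<in> \<ff>" .
qed

lemma R_subset_conductor_local: "R \<subseteq> conductor_local"
  using R1 submod_0[OF submod_conductor] by (auto simp: conductor_local_def intro!: bexI[of _ 1])

lemma conductor_local_closed:
  assumes "x \<in> conductor_local" "y \<in> conductor_local"
  shows "x + y \<in> conductor_local" "x * y \<in> conductor_local"
proof -
  obtain s t where st: "s \<in> R" "1 - s \<in> \<ff>" "s * x \<in> R" "t \<in> R" "1 - t \<in> \<ff>" "t * y \<in> R"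
    using assms by (auto simp: conductor_local_def)
  have "s * t * (x + y) = t * (s * x) + s * (t * y)" "s * t * (x * y) = (s * x) * (t * y)"
    by (simp_all add: algebra_simps)
  then have "s * t * (x + y) \<in> R" "s * t * (x * y) \<in> R"
    using st by (auto simp only: intro: R_add R_mult)
  then show "x + y \<in> conductor_local" "x * y \<in> conductor_local"
    using one_mod_conductor_mult[OF st(1,2,4,5)] unfolding conductor_local_def by blast+
qed

text \<open>In \<open>x = t * x + (1 - t) * x\<close> the second term is in \<open>R\<close> because
  the conductor multiplies the integral \<open>x\<close> into \<open>R\<close>.\<close>

lemma Cl_conductor_local: "Cl \<inter> conductor_local = R"
proof
  show "Cl \<inter> conductor_local \<subseteq> R"
  proof
    fix x assume "x \<in> Cl \<inter> conductor_local"
    then obtain t where t: "x \<in> Cl" "1 - t \<in> \<ff>" "t * x \<in> R" by (auto simp: conductor_local_def)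
    have "t * x + (1 - t) * x \<in> R" using R_add[OF t(3) conductor_mult_R[OF t(2,1)]] by blast
    then show "x \<in> R" by (simp add: algebra_simps)
  qed
qed (use R_subset_conductor_local R_subset_integral_closure in auto)

lemma contract_one: "contract \<O> = R"
  unfolding contract_def Cl_imul_O by (rule Cl_conductor_local)

lemma submod_imul_Cl: "submod Cl (A \<star> Cl)" if "0 \<in> A"
  using submod_imul[OF submod_Cl that] imul_commute[of A] by simp

lemma scale_imul_Cl:
  assumes "\<And>a. a \<in> A \<Longrightarrow> s * a \<in> \<O>" "y \<in> A \<star> Cl" shows "s * y \<in> Cl"
  using assms(2)
proof (induction rule: imul_induct)
  case (prod a b)
  then show ?case using Cl_mult[of "s * a" b] assms(1) O_subset_Cl by (auto simp: mult.assoc)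
qed (simp add: distrib_left Cl_add)

lemma submod_contract: "0 \<in> A \<Longrightarrow> submod R (contract A)"
  unfolding contract_def
proof (rule submod_Int)
  assume "0 \<in> A"
  then show "submod R (A \<star> Cl)" using submod_mono[OF submod_imul_Cl R_subset_integral_closure] by blast
  show "submod R conductor_local"
    using R_subset_conductor_local conductor_local_closed R0 by (auto simp: submod_def)
qed

lemma JK_inverse:
  assumes A: "A \<in> JK" obtains B where "B \<in> JK" "A \<star> B = \<O>"
proof -
  have fA: "OK.frac_ideal A" using A by (simp add: JK_def)
  obtain B where B: "OK.frac_ideal B" "A \<star> B = \<O>" using OK_frac_ideal_unit[OF fA] by blast
  have "ideal_ord P A + ideal_ord P B = 0" for P
    using ideal_ord_mult[OF fA B(1), of P] B(2) by (simp add: ideal_ord_one)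
  then have "B \<in> JK" using A B by (auto simp: JK_def) (metis add_0)
  then show ?thesis using that B by blast
qed

text \<open>At a prime dividing the modulus \<open>A\<close> has order 0, hence a denominator
  outside that prime. So no prime contains both the modulus and all denominators of
  \<open>A\<close>.\<close>

lemma JK_denominator:
  assumes fin: "finite polar" and A: "A \<in> JK"
  obtains s where "s \<in> \<O>" "1 - s \<in> \<mm>" "\<And>a. a \<in> A \<Longrightarrow> s * a \<in> \<O>"
proof -
  note m = modulus_props[OF fin]
  have fA: "OK.frac_ideal A" using A by (simp add: JK_def)
  define D where "D = {s \<in> \<O>. \<forall>a\<in>A. s * a \<in> \<O>}"
  obtain s where "s \<in> D" "1 - s \<in> \<mm>"
  proof (rule OK.ideals_comaximal[OF ideal_common_denominators[OF fA, folded D_def] m(1)])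
    fix P assume P: "prime_of \<O> P" "\<mm> \<subseteq> P" "D \<subseteq> P"
    then have "ideal_ord P A = 0" using m(4) A by (auto simp: JK_def)
    then obtain s where "s \<in> \<O> - P" "\<forall>x\<in>A. s * x \<in> \<O>"
      using ideal_ord_nonneg_iff[OF P(1) fA] by auto
    then show False using P(3) by (auto simp: D_def)
  qed
  then show ?thesis using that by (auto simp: D_def)
qed

text \<open>A denominator \<open>s\<close> of the inverse ideal works: 1 is a sum of products
  \<open>a * b\<close>, and each \<open>s * (a * b)\<close> lies in \<open>A\<close>.\<close>

lemma JK_one_mod:
  assumes fin: "finite polar" and A: "A \<in> JK"
  obtains u where "u \<in> A" "u \<in> \<O>" "1 - u \<in> \<mm>"
proof -
  have sA: "submod \<O> A" using A OK.frac_ideal_submod by (simp add: JK_def)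
  obtain B where B: "B \<in> JK" "A \<star> B = \<O>" using JK_inverse[OF A] by blast
  obtain s where s: "s \<in> \<O>" "1 - s \<in> \<mm>" "\<And>b. b \<in> B \<Longrightarrow> s * b \<in> \<O>"
    using JK_denominator[OF fin B(1)] by blast
  have "s * z \<in> A" if "z \<in> A \<star> B" for z
    using that
  proof (induction rule: imul_induct)
    case (prod a b)
    then show ?case using submod_mult[OF sA s(3)[OF prod(2)] prod(1)] by (simp add: ac_simps)
  qed (simp add: distrib_left submod_add[OF sA])
  from this[of 1] show ?thesis using that s B(2) OK.R1 by simp
qed

lemma one_mod_in_R:
  assumes "finite polar" "1 - s \<in> \<mm>"
  shows "s \<in> R" "1 - s \<in> \<ff>"
proof -
  show c: "1 - s \<in> \<ff>" using modulus_props(3)[OF assms(1)] assms(2) by (auto simp: fin_conductor_def)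
  then have "1 - (1 - s) \<in> R" using conductor_subset by (blast intro: R_diff[OF R1])
  then show "s \<in> R" by simp
qed

text \<open>The inclusion of the contraction in the product is the substantial one. With
  \<open>w\<close> in the product and congruent to 1, and \<open>t\<close> a denominator of
  \<open>x\<close>, the element \<open>e = 1 - t * w\<close> is in the conductor and
  \<open>x = e * e * x + (1 + e) * (1 - e) * x\<close>. The first term is in the product because the
  conductor carries each extension into its contraction, the second because
  \<open>(1 - e) * x\<close> equals \<open>t * x * w\<close>.\<close>

lemma contract_mult:
  assumes fin: "finite polar" and A: "A \<in> JK" and B: "B \<in> JK"
  shows "contract (A \<star> B) = contract A \<star> contract B"
proof
  have A0: "0 \<in> A" and B0: "0 \<in> B"
    using A B OK.frac_ideal_submod submod_0 by (auto simp: JK_def)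
  have AB: "A \<star> B \<star> Cl = (A \<star> Cl) \<star> (B \<star> Cl)"
  proof -
    have "(A \<star> Cl) \<star> (B \<star> Cl) = A \<star> B \<star> (Cl \<star> Cl)" by (simp only: imul_ac)
    then show ?thesis by (simp only: Cl_imul_Cl)
  qed
  have AB0: "0 \<in> A \<star> B" using imulI[OF A0 B0] by simp
  show "contract A \<star> contract B \<subseteq> contract (A \<star> B)"
  proof (rule imul_subset[OF submod_contract[OF AB0]])
    fix a b assume "a \<in> contract A" "b \<in> contract B"
    then show "a * b \<in> contract (A \<star> B)"
      unfolding contract_def AB using imulI conductor_local_closed(2) by blast
  qed
  have sm: "submod R (contract A \<star> contract B)"
    by (intro submod_imul2 submod_contract A0 B0)
  show "contract (A \<star> B) \<subseteq> contract A \<star> contract B"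
  proof
    fix x assume x: "x \<in> contract (A \<star> B)"
    obtain sA where sA: "sA \<in> \<O>" "1 - sA \<in> \<mm>" "\<And>a. a \<in> A \<Longrightarrow> sA * a \<in> \<O>"
      using JK_denominator[OF fin A] by blast
    obtain sB where sB: "sB \<in> \<O>" "1 - sB \<in> \<mm>" "\<And>a. a \<in> B \<Longrightarrow> sB * a \<in> \<O>"
      using JK_denominator[OF fin B] by blast
    obtain uA where uA: "uA \<in> A" "uA \<in> \<O>" "1 - uA \<in> \<mm>" using JK_one_mod[OF fin A] by blast
    obtain uB where uB: "uB \<in> B" "uB \<in> \<O>" "1 - uB \<in> \<mm>" using JK_one_mod[OF fin B] by blast
    have mem: "u \<in> contract I" if "u \<in> I" "1 - u \<in> \<mm>" for u I
      using imulI[OF that(1) Cl_1] one_mod_in_R[OF fin that(2)] R_subset_conductor_local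
      by (auto simp: contract_def)
    define w where "w = uA * uB"
    have w: "w \<in> contract A \<star> contract B" unfolding w_def using uA uB by (intro imulI mem)
    have wR: "w \<in> R" "1 - w \<in> \<ff>"
      unfolding w_def using one_mod_conductor_mult one_mod_in_R[OF fin uA(3)] one_mod_in_R[OF fin uB(3)] by auto
    obtain t where t: "t \<in> R" "1 - t \<in> \<ff>" "t * x \<in> R" using x by (auto simp: contract_def conductor_local_def)
    define e where "e = 1 - t * w"
    have e: "e \<in> \<ff>" unfolding e_def using one_mod_conductor_mult(2)[OF t(1,2) wR] .
    \<comment> \<open>One factor \<open>e\<close> is spent on each ideal. As \<open>s * y\<close> is
      in the integral closure, \<open>s * (e * y) = e * (s * y)\<close> is in \<open>R\<close>, so
      \<open>s\<close> is an admissible denominator of \<open>e * y\<close>.\<close>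
    have eI: "e * y \<in> contract I" if I: "y \<in> I \<star> Cl" "s \<in> \<O>" "1 - s \<in> \<mm>"
      "\<And>a. a \<in> I \<Longrightarrow> s * a \<in> \<O>" "0 \<in> I" for y I s
    proof -
      have "s * y \<in> Cl" using scale_imul_Cl[OF I(4,1)] .
      then have "s * (e * y) \<in> R" using conductor_mult_R[OF e, of "s * y"] by (simp add: ac_simps)
      then have "e * y \<in> conductor_local"
        using one_mod_in_R[OF fin I(3)] by (auto simp: conductor_local_def)
      moreover have "e \<in> Cl" using e conductor_subset R_subset_integral_closure by auto
      then have "e * y \<in> I \<star> Cl" using submod_mult[OF submod_imul_Cl[OF I(5)] _ I(1)] by auto
      ultimately show ?thesis by (simp add: contract_def)
    qed
    have "z \<in> (A \<star> Cl) \<star> (B \<star> Cl) \<Longrightarrow> e * e * z \<in> contract A \<star> contract B" for z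
    proof (induction rule: imul_induct)
      case (prod a b)
      have "(e * a) * (e * b) \<in> contract A \<star> contract B"
        using eI[OF prod(1) sA(1,2,3) A0] eI[OF prod(2) sB(1,2,3) B0] by (intro imulI) auto
      then show ?case by (simp add: ac_simps)
    qed (simp add: distrib_left imul_add)
    then have "e * e * x \<in> contract A \<star> contract B" using x unfolding contract_def AB by blast
    moreover have "(1 + e) * (t * x) * w \<in> contract A \<star> contract B"
      using e conductor_subset by (intro submod_mult[OF sm R_mult[OF R_add[OF R1] t(3)] w]) auto
    ultimately have "e * e * x + (1 + e) * (t * x) * w \<in> contract A \<star> contract B" by (rule submod_add[OF sm])
    moreover have "e * e * x + (1 + e) * (t * x) * w = x" by (simp add: e_def algebra_simps)
    ultimately show "x \<in> contract A \<star> contract B" by simp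
  qed
qed

subsection \<open>Correspondence of primes\<close>

text \<open>The maximal ideal of the valuation ring \<open>local_at P\<close>.\<close>

definition max_at :: "'a set \<Rightarrow> 'a set" where
  "max_at P = {x. \<exists>s\<in>\<O> - P. s * x \<in> P}"

lemma max_at_integers:
  assumes P: "prime_of \<O> P" and x: "x \<in> \<O>"
  shows "x \<in> max_at P \<longleftrightarrow> x \<in> P"
  using OK.prime_mult[OF P _ x] OK.R1 OK.prime_1[OF P]
  by (auto simp: max_at_def intro!: bexI[of _ 1])

lemma submod_max_at:
  assumes P: "prime_of \<O> P"
  shows "submod (local_at P) (max_at P)"
  unfolding submod_def
proof (intro conjI ballI)
  note sP = OK.prime_submod[OF P]
  show "0 \<in> max_at P" using max_at_integers[OF P OK.R0] submod_0[OF sP] by simp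
  fix x assume "x \<in> max_at P"
  then obtain s where s: "s \<in> \<O>" "s \<notin> P" "s * x \<in> P" by (auto simp: max_at_def)
  { fix y assume "y \<in> max_at P"
    then obtain t where t: "t \<in> \<O>" "t \<notin> P" "t * y \<in> P" by (auto simp: max_at_def)
    have "s * t \<in> \<O> - P" using s t OK.prime_mult[OF P] OK.R_mult by auto
    moreover have "s * t * (x + y) = t * (s * x) + s * (t * y)" by (simp add: algebra_simps)
    then have "s * t * (x + y) \<in> P"
      using submod_add[OF sP submod_mult[OF sP t(1) s(3)] submod_mult[OF sP s(1) t(3)]] by simp
    ultimately show "x + y \<in> max_at P" unfolding max_at_def by blast }
  { fix r assume "r \<in> local_at P"
    then obtain t where t: "t \<in> \<O>" "t \<notin> P" "t * r \<in> \<O>" by (auto simp: local_at_def)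
    have "t * s \<in> \<O> - P" using s t OK.prime_mult[OF P] OK.R_mult by auto
    moreover have "t * s * (r * x) = (t * r) * (s * x)" by (simp add: algebra_simps)
    then have "t * s * (r * x) \<in> P" using submod_mult[OF sP t(3) s(3)] by (simp only:)
    ultimately show "r * x \<in> max_at P" unfolding max_at_def by blast }
qed

text \<open>The extension of \<open>P\<close> lies in the maximal ideal of the valuation ring.
  Conversely, if \<open>s * x\<close> is in \<open>P\<close> and \<open>r\<close> inverts
  \<open>s\<close> modulo \<open>P\<close>, then \<open>x = (s * x) * r + (1 - r * s) * x\<close>
  lies in the extension.\<close>

lemma contract_good_prime:
  assumes P: "good_prime P"
  shows "contract P = max_at P \<inter> R"
proof
  have P': "prime_of \<O> P" "P \<notin> polar" using P by (auto simp: good_prime_def)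
  have PO: "P \<subseteq> \<O>" using OK.prime_subset_R[OF P'(1)] .
  have "P \<star> Cl \<subseteq> Cl \<star> Cl" using PO O_subset_Cl by (intro imul_mono) auto
  then have PC: "P \<star> Cl \<subseteq> Cl" by (simp only: Cl_imul_Cl)
  have "P \<star> Cl \<subseteq> max_at P"
  proof (rule imul_subset[OF submod_max_at[OF P'(1)]])
    fix p c assume pc: "p \<in> P" "c \<in> Cl"
    then have "p \<in> max_at P" using max_at_integers[OF P'(1)] PO by auto
    then have "c * p \<in> max_at P"
      using submod_mult[OF submod_max_at[OF P'(1)]] Cl_local_at[OF P'] pc by blast
    then show "p * c \<in> max_at P" by (simp add: mult.commute)
  qed
  then show "contract P \<subseteq> max_at P \<inter> R"
    using PC Cl_conductor_local unfolding contract_def by blast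
  show "max_at P \<inter> R \<subseteq> contract P"
  proof
    fix x assume x: "x \<in> max_at P \<inter> R"
    then obtain s where s: "s \<in> \<O>" "s \<notin> P" "s * x \<in> P" by (auto simp: max_at_def)
    obtain r where r: "r \<in> \<O>" "1 - r * s \<in> P" using OK.prime_unit[OF P'(1) s(1,2)] by blast
    have xC: "x \<in> Cl" using x R_subset_integral_closure by auto
    have "(s * x) * r + (1 - r * s) * x \<in> P \<star> Cl"
      using r O_subset_Cl by (intro imul_add imulI[OF s(3)] imulI[OF r(2) xC]) auto
    moreover have "(s * x) * r + (1 - r * s) * x = x" by (simp add: algebra_simps)
    ultimately show "x \<in> contract P" using x R_subset_conductor_local by (auto simp: contract_def)
  qed
qed

text \<open>The contraction is the center on \<open>R\<close> of the valuation of \<open>P\<close>.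
  Primality is checked after clearing denominators outside \<open>P\<close>, and an integral element
  of the conductor outside \<open>P\<close> stays outside the contraction.\<close>

lemma contract_good_prime_reg:
  assumes P: "good_prime P"
  shows "reg_prime (contract P)"
proof -
  have P': "prime_of \<O> P" "R \<subseteq> local_at P" "\<not> fin_conductor \<subseteq> P"
    using P by (auto simp: good_prime_def polar_iff)
  note sP = OK.prime_submod[OF P'(1)]
  have eq: "contract P = max_at P \<inter> R" by (rule contract_good_prime[OF P])
  have "submod R (contract P)"
    unfolding eq by (intro submod_Int submod_R submod_mono[OF submod_max_at[OF P'(1)] P'(2)])
  moreover have "contract P \<noteq> {0}"
  proof -
    obtain n :: nat where n: "n > 0" "of_nat n \<in> P" using OK.prime_contains_nat[OF P'(1)] by blast
    then have "of_nat n \<in> contract P"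
      unfolding eq using max_at_integers[OF P'(1) OK.R_of_nat] R_of_nat by auto
    then show ?thesis using n(1) by auto
  qed
  moreover have "1 \<notin> contract P"
    unfolding eq using max_at_integers[OF P'(1) OK.R1] OK.prime_1[OF P'(1)] by auto
  moreover have "x \<in> contract P \<or> y \<in> contract P" if xy: "x \<in> R" "y \<in> R" "x * y \<in> contract P" for x y
  proof -
    obtain s where s: "s \<in> \<O>" "s \<notin> P" "s * (x * y) \<in> P" using xy by (auto simp: eq max_at_def)
    obtain t where t: "t \<in> \<O>" "t \<notin> P" "t * x \<in> \<O>" using xy P'(2) by (auto simp: local_at_def)
    obtain u where u: "u \<in> \<O>" "u \<notin> P" "u * y \<in> \<O>" using xy P'(2) by (auto simp: local_at_def)
    have "(t * u) * (s * (x * y)) \<in> P" using submod_mult[OF sP OK.R_mult[OF t(1) u(1)] s(3)] .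
    then have "s * ((t * x) * (u * y)) \<in> P" by (simp add: ac_simps)
    then have "t * x \<in> P \<or> u * y \<in> P"
      using OK.prime_mult[OF P'(1) s(1) OK.R_mult[OF t(3) u(3)]] OK.prime_mult[OF P'(1) t(3) u(3)] s(2) by blast
    then show ?thesis using t u xy by (auto simp: eq max_at_def)
  qed
  moreover have "\<not> \<ff> \<subseteq> contract P"
  proof -
    obtain c where c: "c \<in> fin_conductor" "c \<notin> P" using P'(3) by auto
    then have "c \<notin> contract P" unfolding eq using max_at_integers[OF P'(1), of c] by (auto simp: fin_conductor_def)
    then show ?thesis using c by (auto simp: fin_conductor_def)
  qed
  ultimately show ?thesis
    unfolding reg_prime_def prime_of_def ideal_of_def by (simp add: eq)
qed

text \<open>For \<open>c\<close> in the conductor but not in \<open>P\<close>, each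
  \<open>y * c\<close> with \<open>y\<close> integral lies in \<open>R\<close>, and \<open>c\<close>
  is a unit at \<open>P\<close>. So the localization of \<open>R\<close> at \<open>P\<close>
  contains the integers, and \<open>Q\<close> is the contraction of its maximal ideal to
  them.\<close>

lemma reg_prime_is_contract:
  assumes "reg_prime P"
  obtains Q where "good_prime Q" "contract Q = P"
proof -
  have P: "prime_of R P" using assms by (simp add: reg_prime_def)
  note sP = prime_submod[OF P]
  obtain c where c: "c \<in> \<ff>" "c \<notin> P" using assms by (auto simp: reg_prime_def)
  have cR: "c \<in> R" using c conductor_subset by auto
  have fR: "y * c \<in> R" if "y \<in> Cl" for y using conductor_mult_R[OF c(1) that] by (simp add: mult.commute)
  have OR: "y * c \<in> R" if "y \<in> \<O>" for y using fR that O_subset_Cl by auto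
  have cancel: "y \<in> P" if "y \<in> R" "c * y \<in> P" for y using prime_mult[OF P cR that(1)] that(2) c(2) by simp
  define Q where "Q = {x \<in> \<O>. x * c \<in> P}"
  have sQ: "submod \<O> Q" unfolding submod_def Q_def
  proof (intro conjI ballI)
    show "0 \<in> {x \<in> \<O>. x * c \<in> P}" using OK.R0 submod_0[OF sP] by simp
  next
    fix x y assume "x \<in> {x \<in> \<O>. x * c \<in> P}" "y \<in> {x \<in> \<O>. x * c \<in> P}"
    then show "x + y \<in> {x \<in> \<O>. x * c \<in> P}" using OK.R_add submod_add[OF sP] by (simp add: distrib_right)
  next
    fix r x assume "r \<in> \<O>" and x: "x \<in> {x \<in> \<O>. x * c \<in> P}"
    then have "(r * c) * (x * c) \<in> P" using submod_mult[OF sP OR] by simp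
    then have "c * (r * x * c) \<in> P" by (simp add: ac_simps)
    then have "r * x * c \<in> P" using cancel OR[OF OK.R_mult[of r x]] \<open>r \<in> \<O>\<close> x by simp
    then show "r * x \<in> {x \<in> \<O>. x * c \<in> P}" using \<open>r \<in> \<O>\<close> x OK.R_mult by simp
  qed
  have "x \<in> Q \<or> y \<in> Q" if xy: "x \<in> \<O>" "y \<in> \<O>" "x * y \<in> Q" for x y
  proof -
    have "c * (x * y * c) \<in> P" using submod_mult[OF sP cR, of "x * y * c"] xy by (simp add: Q_def)
    then have "(x * c) * (y * c) \<in> P" by (simp add: ac_simps)
    then show ?thesis using prime_mult[OF P OR[OF xy(1)] OR[OF xy(2)]] xy by (auto simp: Q_def)
  qed
  moreover have "1 \<notin> Q" using c by (simp add: Q_def)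
  moreover have "Q \<noteq> {0}"
  proof -
    obtain n :: nat where n: "n > 0" "of_nat n \<in> P" using prime_contains_nat[OF P] by blast
    have "of_nat n * c \<in> P" using submod_mult[OF sP cR n(2)] by (simp add: mult.commute)
    then have "of_nat n \<in> Q" using OK.R_of_nat by (simp add: Q_def)
    then show ?thesis using n(1) by auto
  qed
  ultimately have Q: "prime_of \<O> Q"
    unfolding prime_of_def ideal_of_def using sQ by (auto simp: Q_def)
  \<comment> \<open>A pole of \<open>R\<close> at \<open>Q\<close> would put both
    \<open>i * r * q * c\<close> and \<open>(1 - i * r * q) * c\<close> into \<open>P\<close>, hence
    also their sum \<open>c\<close>.\<close>
  have Rl: "R \<subseteq> local_at Q"
  proof (rule ccontr)
    assume "\<not> R \<subseteq> local_at Q"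
    then obtain r where r: "r \<in> R" "r \<notin> local_at Q" by auto
    obtain i q where iq: "i \<in> \<O>" "q \<in> Q" "1 - i * r * q \<in> Q" using pole_generates_unit[OF Q r(2)] by blast
    have "i * r * q \<in> Cl"
      using iq r O_subset_Cl R_subset_integral_closure by (intro Cl_mult) (auto simp: Q_def)
    then have R': "i * r * q * c \<in> R" by (rule fR)
    have "(i * c * r) * (q * c) \<in> P"
      using submod_mult[OF sP R_mult[OF OR[OF iq(1)] r(1)], of "q * c"] iq(2) by (simp add: Q_def)
    then have "c * (i * r * q * c) \<in> P" by (simp add: ac_simps)
    then have "i * r * q * c \<in> P" using cancel[OF R'] by simp
    moreover have "(1 - i * r * q) * c \<in> P" using iq by (simp add: Q_def)
    ultimately have "i * r * q * c + (1 - i * r * q) * c \<in> P" by (rule submod_add[OF sP])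
    then show False using c(2) by (simp add: algebra_simps)
  qed
  \<comment> \<open>Clearing the denominator of \<open>c\<close> at \<open>Q\<close> yields an
    integral element of the conductor outside \<open>Q\<close>.\<close>
  then obtain s where s: "s \<in> \<O>" "s \<notin> Q" "s * c \<in> \<O>" using cR by (auto simp: local_at_def)
  have scP: "t * c \<notin> P" if "t \<in> \<O>" "t \<notin> Q" for t using that by (simp add: Q_def)
  have "s * c \<in> fin_conductor"
    using conductor_mult_Cl[OF c(1), of s] s O_subset_Cl by (auto simp: fin_conductor_def mult.commute)
  moreover have "s * c \<notin> Q"
    using scP[OF s(1,2)] prime_mult[OF P OR[OF s(1)] cR] c(2) by (simp add: Q_def)
  ultimately have good: "good_prime Q" using Q Rl by (auto simp: good_prime_def polar_iff)
  have "max_at Q \<inter> R = P"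
  proof (intro equalityI subsetI)
    fix x assume "x \<in> max_at Q \<inter> R"
    then obtain t where t: "t \<in> \<O>" "t \<notin> Q" "t * x \<in> Q" "x \<in> R" by (auto simp: max_at_def)
    then have "(t * c) * x \<in> P" by (simp add: Q_def ac_simps)
    then show "x \<in> P" using prime_mult[OF P OR[OF t(1)] t(4)] scP[OF t(1,2)] by simp
  next
    fix x assume x: "x \<in> P"
    then have xR: "x \<in> R" using prime_subset_R[OF P] by auto
    then obtain t where t: "t \<in> \<O>" "t \<notin> Q" "t * x \<in> \<O>" using Rl by (auto simp: local_at_def)
    have "(t * c) * x \<in> P" by (rule submod_mult[OF sP OR[OF t(1)] x])
    then have "t * x \<in> Q" using t by (simp add: Q_def ac_simps)
    then show "x \<in> max_at Q \<inter> R" using t xR by (auto simp: max_at_def)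
  qed
  then show ?thesis using that[OF good] contract_good_prime[OF good] by simp
qed

lemma good_prime_JK: "good_prime P \<Longrightarrow> P \<in> JK"
  using prime_carrier by (auto simp: JK_def good_prime_def ideal_ord_prime)

lemma JK_closed: "A \<in> JK \<Longrightarrow> B \<in> JK \<Longrightarrow> A \<star> B \<in> JK"
  unfolding JK_def using OK.frac_ideal_imul ideal_ord_mult[of A B] by fastforce

lemma JK_one: "\<O> \<in> JK"
  by (simp add: JK_def OK.frac_ideal_R ideal_ord_one)

lemma contract_frac_ideal:
  assumes fin: "finite polar" and A: "A \<in> JK"
  shows "frac_ideal (contract A)"
proof -
  have fA: "OK.frac_ideal A" using A by (simp add: JK_def)
  obtain B where B: "B \<in> JK" "A \<star> B = \<O>" using JK_inverse[OF A] by blast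
  have g: "contract A \<star> contract B = R" using contract_mult[OF fin A B(1)] contract_one B(2) by simp
  have A0: "0 \<in> A" using submod_0[OF OK.frac_ideal_submod[OF fA]] .
  have nz: "contract A \<noteq> {0}"
  proof
    assume "contract A = {0}"
    then have "contract A \<star> contract B \<subseteq> {0}" by (intro imul_subset[of R]) (auto simp: submod_def)
    then show False using g R1 by auto
  qed
  obtain d where d: "d \<in> \<O>" "d \<noteq> 0" "\<And>x. x \<in> A \<Longrightarrow> d * x \<in> \<O>" using OK.frac_ideal_denom[OF fA] by blast
  obtain N :: int where N: "N > 0" "of_int N \<in> \<ff>" using ex_int_in_conductor by blast
  have "of_int N * d * x \<in> R" if "x \<in> contract A" for x
    using that conductor_mult_R[OF N(2) scale_imul_Cl[OF d(3)]] by (auto simp: contract_def mult.assoc)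
  moreover have "of_int N * d \<in> R" using conductor_mult_R[OF N(2), of d] d O_subset_Cl by auto
  ultimately show ?thesis
    using nz submod_contract[OF A0] N(1) d(2) by (intro frac_idealI[of _ "of_int N * d"]) auto
qed

lemma contract_unit:
  assumes fin: "finite polar" and A: "A \<in> JK"
  shows "contract A \<in> Units (fractional_ideals R)"
proof -
  obtain B where B: "B \<in> JK" "A \<star> B = \<O>" using JK_inverse[OF A] by blast
  have "contract A \<star> contract B = R" using contract_mult[OF fin A B(1)] contract_one B(2) by simp
  then show ?thesis
    using contract_frac_ideal[OF fin A] contract_frac_ideal[OF fin B(1)]
    unfolding Units_fractional_ideals_iff by blast
qed

text \<open>Integrality is tested prime by prime: at a good prime the integral closure lies in the
  valuation ring, and at every other prime \<open>A\<close> has order 0.\<close>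

lemma JK_subset_integers:
  assumes fin: "finite polar" and A: "A \<in> JK" "A \<subseteq> Cl"
  shows "A \<subseteq> \<O>"
proof -
  have fA: "OK.frac_ideal A" using A by (simp add: JK_def)
  obtain B where B: "B \<in> JK" "A \<star> B = \<O>" using JK_inverse[OF A(1)] by blast
  define D where "D = {s \<in> \<O>. \<forall>a\<in>A. s * a \<in> \<O>}"
  note D = ideal_common_denominators[OF fA, folded D_def]
  have "1 \<in> D"
  proof (rule ccontr)
    assume "1 \<notin> D"
    then obtain P where P: "prime_of \<O> P" "D \<subseteq> P" using OK.ex_prime_containing[OF D] by blast
    have "\<exists>s\<in>\<O> - P. \<forall>a\<in>A. s * a \<in> \<O>"
    proof (cases "good_prime P")
      case True
      then have "A \<subseteq> local_at P" using A(2) Cl_local_at[OF P(1)] by (auto simp: good_prime_def)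
      then show ?thesis using local_denominator_of_unit[OF P(1) _ B(2)] by blast
    next
      case False
      then have "ideal_ord P A = 0" using A(1) P(1) by (auto simp: JK_def)
      then show ?thesis using ideal_ord_nonneg_iff[OF P(1) fA] by auto
    qed
    then show False using P(2) by (auto simp: D_def)
  qed
  then show ?thesis by (auto simp: D_def)
qed

text \<open>If \<open>A\<close> contracts to \<open>R\<close>, so does its inverse. Both then
  generate the unit ideal in the integral closure, which forces both to be contained in it. By
  \<open>JK_subset_integers\<close> both are integral, and mutually inverse integral ideals are
  trivial.\<close>

lemma contract_kernel:
  assumes fin: "finite polar" and A: "A \<in> JK" and g: "contract A = R"
  shows "A = \<O>"
proof -
  obtain B where B: "B \<in> JK" "A \<star> B = \<O>" using JK_inverse[OF A] by blast
  have B0: "0 \<in> B" using B OK.frac_ideal_submod submod_0 by (auto simp: JK_def)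
  have "R \<star> contract B = R" using contract_mult[OF fin A B(1)] contract_one B(2) g by simp
  then have gB: "contract B = R" using imul_R[OF submod_contract[OF B0]] by simp
  have sub: "X \<subseteq> Cl" if "1 \<in> Y \<star> Cl" "X \<star> Y = \<O>" for X Y
  proof
    fix x assume "x \<in> X"
    then have "x * 1 \<in> X \<star> (Y \<star> Cl)" using that(1) by (rule imulI)
    also have "X \<star> (Y \<star> Cl) = Cl" unfolding imul_assoc[symmetric] that(2) by (rule Cl_imul_O)
    finally show "x \<in> Cl" by simp
  qed
  have "1 \<in> A \<star> Cl" "1 \<in> B \<star> Cl" using g gB R1 by (auto simp: contract_def)
  then have AO: "A \<subseteq> \<O>" and BO: "B \<subseteq> \<O>"
    using sub[OF _ B(2)] sub[of A B] B imul_commute[of A B] JK_subset_integers[OF fin] A by auto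
  have "\<O> \<subseteq> A \<star> \<O>" using imul_mono[OF subset_refl BO, of A] B(2) by simp
  also have "A \<star> \<O> = A"
    using OK.imul_R[of A] imul_commute[of A] A OK.frac_ideal_submod by (simp add: JK_def)
  finally show ?thesis using AO by blast
qed

subsection \<open>Principal ideals\<close>

text \<open>Each prime factor of \<open>D\<close> is polar and generates the unit ideal in the
  integral closure, so the product does as well.\<close>

lemma polar_denominators_unit:
  assumes "ideal_of \<O> D" "D \<noteq> {0}" "\<And>P. prime_of \<O> P \<Longrightarrow> D \<subseteq> P \<Longrightarrow> P \<in> polar"
  shows "1 \<in> D \<star> Cl"
  using assms
proof (induction rule: integral_ideal_induct)
  case unit then show ?case using Cl_imul_O Cl_1 by simp
next
  case (prime P J)
  have PJ: "P \<star> J \<subseteq> P" "P \<star> J \<subseteq> J"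
    using imul_subset_right[OF prime(2) OK.prime_submod[OF prime(1)]] imul_commute[of P J]
      imul_subset_right[OF OK.prime_ideal[OF prime(1)], of J] prime(2) by (auto simp: ideal_of_def)
  have "1 \<in> J \<star> Cl" using prime.IH prime.prems PJ by blast
  moreover have "1 \<in> P \<star> Cl" using polar_unit prime PJ by blast
  ultimately have "1 * 1 \<in> (P \<star> Cl) \<star> (J \<star> Cl)" by (intro imulI)
  also have "(P \<star> Cl) \<star> (J \<star> Cl) = P \<star> J \<star> (Cl \<star> Cl)" by (simp only: imul_ac)
  finally show ?case by (simp only: Cl_imul_Cl mult_1)
qed

text \<open>The generators of \<open>P_KR R\<close> are the sets \<open>integral_part \<alpha>\<close>.\<close>

definition integral_part :: "'a \<Rightarrow> 'a set" where
  "integral_part \<alpha> = principal Cl \<alpha> \<inter> \<O>"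

lemma denominator_prime_polar:
  assumes "y \<in> Cl" "prime_of \<O> P" "{s \<in> \<O>. s * y \<in> \<O>} \<subseteq> P"
  shows "P \<in> polar"
proof (rule ccontr)
  assume "P \<notin> polar"
  then have "y \<in> local_at P" using Cl_local_at assms by blast
  then show False using assms(3) by (auto simp: local_at_def)
qed

lemma submod_principal_Cl: "submod Cl (principal Cl \<alpha>)"
  unfolding submod_def principal_def
proof (intro conjI ballI)
  show "0 \<in> (*) \<alpha> ` Cl" using Cl_0 by (intro image_eqI[of _ _ 0]) auto
qed (auto simp: distrib_left[symmetric] mult.left_commute[of _ \<alpha>] intro: Cl_add Cl_mult)

lemma integral_part_ideal:
  assumes "\<alpha> \<noteq> 0"
  shows "ideal_of \<O> (integral_part \<alpha>)" "integral_part \<alpha> \<noteq> {0}"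
proof -
  show "ideal_of \<O> (integral_part \<alpha>)"
    unfolding ideal_of_def integral_part_def
    using submod_Int[OF submod_mono[OF submod_principal_Cl O_subset_Cl] OK.submod_R] by blast
  obtain N :: int where N: "N > 0" "of_int N * \<alpha> \<in> \<O>" using OK.ex_int_multiple_in_R by blast
  have "of_int N * \<alpha> \<in> principal Cl \<alpha>"
    unfolding principal_def mult.commute[of "of_int N" \<alpha>]
    by (rule imageI[OF subsetD[OF O_subset_Cl OK.R_of_int]])
  then have "of_int N * \<alpha> \<in> integral_part \<alpha>"
    unfolding integral_part_def using N(2) by (rule IntI)
  moreover have "of_int N * \<alpha> \<noteq> 0" using N(1) assms by simp
  ultimately show "integral_part \<alpha> \<noteq> {0}" by blast
qed

text \<open>The denominators of an element \<open>y\<close> of the integral closure generate the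
  unit ideal there, since only polar primes divide them. Writing 1 as a sum of products
  \<open>s * c\<close> expresses \<open>y\<close> through the multiples \<open>s * y\<close>, which
  lie in the integral part.\<close>

lemma integral_part_imul_Cl:
  assumes "\<alpha> \<in> Cl"
  shows "integral_part \<alpha> \<star> Cl = principal Cl \<alpha>"
proof
  show "integral_part \<alpha> \<star> Cl \<subseteq> principal Cl \<alpha>"
  proof (rule imul_subset[OF submod_principal_Cl])
    fix a b assume "a \<in> integral_part \<alpha>" "b \<in> Cl"
    then have "b * a \<in> principal Cl \<alpha>"
      using submod_mult[OF submod_principal_Cl] by (auto simp: integral_part_def)
    then show "a * b \<in> principal Cl \<alpha>" by (simp only: mult.commute)
  qed
  show "principal Cl \<alpha> \<subseteq> integral_part \<alpha> \<star> Cl"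
  proof
    fix y assume y: "y \<in> principal Cl \<alpha>"
    then have yC: "y \<in> Cl" using assms Cl_mult by (auto simp: principal_def)
    define D where "D = {s \<in> \<O>. s * y \<in> \<O>}"
    have "1 \<in> D \<star> Cl"
    proof (rule polar_denominators_unit)
      show "ideal_of \<O> D" unfolding D_def by (rule ideal_denominators[OF OK.submod_R])
      show "D \<noteq> {0}" unfolding D_def by (rule denominators_nonzero) simp
    qed (use denominator_prime_polar[OF yC] in \<open>auto simp: D_def\<close>)
    moreover have "y * z \<in> integral_part \<alpha> \<star> Cl" if "z \<in> D \<star> Cl" for z
      using that
    proof (induction rule: imul_induct)
      case (prod s c)
      have "s * y \<in> integral_part \<alpha>"
        using prod(1) submod_mult[OF submod_principal_Cl _ y, of s] O_subset_Cl
        by (auto simp: D_def integral_part_def)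
      then have "(s * y) * c \<in> integral_part \<alpha> \<star> Cl" using prod(2) by (rule imulI)
      then show ?case by (simp add: ac_simps)
    qed (simp add: distrib_left imul_add)
    ultimately show "y \<in> integral_part \<alpha> \<star> Cl" by force
  qed
qed

text \<open>With \<open>i = \<alpha> * r\<close> and \<open>x = \<alpha> * y\<close> in
  \<open>R\<close>, the identity \<open>x = \<alpha> * (r * x + (1 - i) * y)\<close> replaces the
  integral cofactor by one in \<open>R\<close>.\<close>

lemma contract_integral_part:
  assumes \<alpha>: "\<alpha> \<in> R" and cop: "i \<in> principal R \<alpha>" "1 - i \<in> \<ff>"
  shows "contract (integral_part \<alpha>) = principal R \<alpha>"
proof -
  have \<alpha>C: "\<alpha> \<in> Cl" using \<alpha> R_subset_integral_closure by auto
  obtain r where r: "r \<in> R" "i = \<alpha> * r" using cop(1) by (auto simp: principal_def)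
  have sub: "principal Cl \<alpha> \<subseteq> Cl" using \<alpha>C Cl_mult by (auto simp: principal_def)
  have "principal Cl \<alpha> \<inter> conductor_local = principal R \<alpha>"
  proof
    show "principal Cl \<alpha> \<inter> conductor_local \<subseteq> principal R \<alpha>"
    proof
      fix x assume x: "x \<in> principal Cl \<alpha> \<inter> conductor_local"
      then have xR: "x \<in> R" using sub Cl_conductor_local by blast
      obtain y where y: "y \<in> Cl" "x = \<alpha> * y" using x by (auto simp: principal_def)
      have "x = \<alpha> * (r * x + (1 - i) * y)"
        using y(2) r(2) by (simp add: algebra_simps)
      moreover have "r * x + (1 - i) * y \<in> R"
        using R_add[OF R_mult[OF r(1) xR] conductor_mult_R[OF cop(2) y(1)]] .
      ultimately show "x \<in> principal R \<alpha>" by (auto simp: principal_def)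
    qed
    show "principal R \<alpha> \<subseteq> principal Cl \<alpha> \<inter> conductor_local"
      using R_subset_integral_closure R_subset_conductor_local \<alpha> R_mult by (auto simp: principal_def)
  qed
  then show ?thesis unfolding contract_def integral_part_imul_Cl[OF \<alpha>C] .
qed

text \<open>A polar prime containing the ideal could be divided out without leaving the ideal, since
  it generates the unit ideal after extension. A nonpolar prime dividing the modulus contains
  \<open>fin_conductor\<close>; for a denominator \<open>s\<close> of \<open>1 - i\<close> outside
  it, both summands of \<open>s = s * (1 - i) + s * i\<close> would lie in it.\<close>

lemma integral_part_JK:
  assumes \<alpha>: "\<alpha> \<in> R" "\<alpha> \<noteq> 0" and cop: "i \<in> principal R \<alpha>" "1 - i \<in> \<ff>"
  shows "integral_part \<alpha> \<in> JK"
proof -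
  note A = integral_part_ideal[OF \<alpha>(2)]
  have \<alpha>C: "\<alpha> \<in> Cl" using \<alpha> R_subset_integral_closure by auto
  have "ideal_ord P (integral_part \<alpha>) = 0" if P: "prime_of \<O> P" "\<not> good_prime P" for P
  proof -
    have "\<not> integral_part \<alpha> \<subseteq> P"
    proof
      assume sub: "integral_part \<alpha> \<subseteq> P"
      show False
      proof (cases "P \<in> polar")
        case True
        obtain I where I: "ideal_of \<O> I" "P \<star> I = integral_part \<alpha>" "\<not> I \<subseteq> integral_part \<alpha>"
          using ideal_quotient_by_prime[OF P(1) A sub] by blast
        have "x \<in> integral_part \<alpha>" if x: "x \<in> I" for x
        proof -
          have "x * 1 \<in> I \<star> (P \<star> Cl)" using x polar_unit[OF True] by (rule imulI)
          also have "I \<star> (P \<star> Cl) = (P \<star> I) \<star> Cl" by (simp only: imul_ac)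
          also have "\<dots> = principal Cl \<alpha>" unfolding I(2) by (rule integral_part_imul_Cl[OF \<alpha>C])
          finally show ?thesis using x I(1) by (auto simp: integral_part_def ideal_of_def)
        qed
        then show False using I(3) by auto
      next
        case False
        then have fP: "fin_conductor \<subseteq> P" using P by (auto simp: good_prime_def)
        have Rl: "R \<subseteq> local_at P" using False P(1) by (auto simp: polar_iff)
        have "1 - i \<in> local_at P" using Rl cop(2) conductor_subset by auto
        then obtain s where s: "s \<in> \<O>" "s \<notin> P" "s * (1 - i) \<in> \<O>" by (auto simp: local_at_def)
        have sC: "s \<in> Cl" using s O_subset_Cl by auto
        have 1: "s * (1 - i) \<in> P"
          using conductor_mult_Cl[OF cop(2) sC] s(3) fP by (auto simp: fin_conductor_def mult.commute)
        obtain r where r: "r \<in> R" "i = \<alpha> * r" using cop(1) by (auto simp: principal_def)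
        have "s * i = \<alpha> * (s * r)" using r by (simp add: ac_simps)
        then have "s * i \<in> principal Cl \<alpha>"
          using Cl_mult[OF sC, of r] r(1) R_subset_integral_closure unfolding principal_def by blast
        moreover have "s * i = s - s * (1 - i)" by (simp add: algebra_simps)
        then have "s * i \<in> \<O>" using OK.R_diff[OF s(1,3)] by simp
        ultimately have "s * i \<in> P" using sub by (auto simp: integral_part_def)
        then have "s * (1 - i) + s * i \<in> P" using 1 by (intro submod_add[OF OK.prime_submod[OF P(1)]])
        then show False using s(2) by (simp add: algebra_simps)
      qed
    qed
    then show ?thesis using ideal_ord_integral[OF P(1) A] by auto
  qed
  then show ?thesis using OK.ideal_frac_ideal[OF A] by (auto simp: JK_def)
qed

text \<open>If \<open>\<alpha> * y\<close> is integral, \<open>\<alpha>\<close> is a denominator of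
  \<open>y\<close>. A prime containing all denominators of \<open>y\<close> is polar, hence divides
  the modulus, and \<alpha> is 1 modulo it: a contradiction, so \<open>y\<close> is integral. The
  polar factor of the modulus serves this purpose.\<close>

lemma integral_part_one_mod:
  assumes fin: "finite polar" and \<alpha>: "\<alpha> \<in> \<O>" "\<alpha> - 1 \<in> \<mm>"
  shows "integral_part \<alpha> = principal \<O> \<alpha>"
proof
  show "principal \<O> \<alpha> \<subseteq> integral_part \<alpha>"
    using O_subset_Cl \<alpha> OK.R_mult by (auto simp: principal_def integral_part_def)
  note m = modulus_props[OF fin]
  show "integral_part \<alpha> \<subseteq> principal \<O> \<alpha>"
  proof
    fix x assume "x \<in> integral_part \<alpha>"
    then obtain y where y: "y \<in> Cl" "x = \<alpha> * y" "x \<in> \<O>" by (auto simp: integral_part_def principal_def)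
    define D where "D = {s \<in> \<O>. s * y \<in> \<O>}"
    have D: "ideal_of \<O> D" unfolding D_def by (rule ideal_denominators[OF OK.submod_R])
    have D0: "D \<noteq> {0}" unfolding D_def by (rule denominators_nonzero) simp
    have "1 \<in> D"
    proof (rule ccontr)
      assume "1 \<notin> D"
      then obtain P where P: "prime_of \<O> P" "D \<subseteq> P" using OK.ex_prime_containing[OF D D0] by blast
      then have "P \<in> polar" using denominator_prime_polar[OF y(1)] by (auto simp: D_def)
      then have "\<alpha> - 1 \<in> P" using m(4)[OF P(1)] \<alpha>(2) by (auto simp: good_prime_def)
      moreover have "\<alpha> \<in> P" using P(2) y \<alpha>(1) by (auto simp: D_def)
      ultimately have "\<alpha> - (\<alpha> - 1) \<in> P"
        using submod_diff[OF OK.subring_set_axioms OK.prime_submod[OF P(1)]] by blast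
      moreover have "\<alpha> - (\<alpha> - 1) = 1" by simp
      ultimately show False using OK.prime_1[OF P(1)] by simp
    qed
    then show "x \<in> principal \<O> \<alpha>" using y by (auto simp: D_def principal_def)
  qed
qed

section \<open>The ideal groups and their quotients\<close>

lemma subgroup_JK: "subgroup JK \<G>"
proof (rule G.subgroupI)
  show "JK \<subseteq> carrier \<G>" by (auto simp: JK_def)
  show "JK \<noteq> {}" using JK_one by blast
  show "A \<otimes>\<^bsub>\<G>\<^esub> B \<in> JK" if "A \<in> JK" "B \<in> JK" for A B using JK_closed[OF that] by simp
  fix A assume A: "A \<in> JK"
  obtain B where B: "B \<in> JK" "A \<star> B = \<O>" using JK_inverse[OF A] by blast
  have "inv\<^bsub>\<G>\<^esub> A = B"
    by (rule G.inv_equality) (use A B imul_commute[of A B] in \<open>auto simp: JK_def\<close>)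
  then show "inv\<^bsub>\<G>\<^esub> A \<in> JK" using B by simp
qed

lemma J_K_eq:
  assumes "finite polar"
  shows "J_K (\<mm>) = \<G>\<lparr>carrier := JK\<rparr>"
proof -
  note m = modulus_props[OF assms]
  have "ideal_ord P (\<mm>) = 0 \<longleftrightarrow> good_prime P" if "prime_of \<O> P" for P
    using ideal_ord_integral[OF that m(1,2)] m(4)[OF that] by auto
  then have "{I. fractional_ideal \<O> I \<and>
      (\<forall>P\<in>nonzero_primes \<O>. ideal_ord P (\<mm>) = 0 \<or> ideal_ord P I = 0)} = JK"
    unfolding JK_def OK.frac_ideal_def using OK.nonzero_primes_iff by blast
  then show ?thesis unfolding J_K_def by simp
qed

text \<open>This allows the image of \<open>contract\<close> to be computed on primes.\<close>

lemma JK_generated: "JK = generate \<G> {P. good_prime P}"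
proof
  show "JK \<subseteq> generate \<G> {P. good_prime P}"
    by (auto simp: JK_def good_prime_def intro!: frac_ideal_generate)
  show "generate \<G> {P. good_prime P} \<subseteq> JK"
    using good_prime_JK by (intro G.generate_subgroup_incl[OF _ subgroup_JK]) auto
qed

lemma ideal_principal_R: "\<alpha> \<in> R \<Longrightarrow> ideal_of R (principal R \<alpha>)"
  unfolding ideal_of_def using submod_principal by (auto simp: principal_def intro: R_mult)

lemma comaximal_principal_iff:
  "\<alpha> \<in> R \<Longrightarrow> comaximal R (principal R \<alpha>) \<ff> \<longleftrightarrow> (\<exists>i\<in>principal R \<alpha>. 1 - i \<in> \<ff>)"
  by (rule comaximal_iff_one[OF ideal_principal_R ideal_conductor])

text \<open>\<open>contract\<close> is an isomorphism of the ideal groups that carries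
  \<open>P_KR R\<close> onto \<open>P_R R\<close> of the conductor. It is set up with values in all
  invertible ideals, where the image is determined from generators, and then restricted to that
  image.\<close>

theorem class_group_iso:
  assumes fin: "finite polar"
  shows "(P_K1 (\<mm>) \<subseteq> P_KR R \<and>
          P_KR R \<subseteq> carrier (J_K (\<mm>)) \<and>
          P_KR R \<lhd> J_K (\<mm>)) \<and>
         (P_R R \<ff> \<lhd> J_R R \<ff> \<and> Pic R \<ff> \<cong> J_K (\<mm>) Mod P_KR R)"
proof -
  define H where "H = J_K (\<mm>)"
  have H: "H = \<G>\<lparr>carrier := JK\<rparr>" unfolding H_def by (rule J_K_eq[OF fin])
  interpret H: comm_group H
    unfolding H using G.subgroup_imp_comm_group[OF subgroup_JK] by simp
  interpret M: Group.comm_monoid "fractional_ideals R" by (rule comm_monoid_fractional_ideals)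
  define U where "U = invertible_ideals R"
  interpret U: comm_group U unfolding U_def by (rule M.units_comm_group)
  \<comment> \<open>One index set for both families of principal generators, so that
    \<open>contract\<close> matches them term by term.\<close>
  define gens where "gens = {\<alpha>. \<alpha> \<in> R \<and> \<alpha> \<noteq> 0 \<and> comaximal R (principal R \<alpha>) \<ff>}"
  have cop: "\<exists>i\<in>principal R \<alpha>. 1 - i \<in> \<ff>" if "\<alpha> \<in> gens" for \<alpha>
    using that comaximal_principal_iff by (auto simp: gens_def)

  have ipJK: "integral_part ` gens \<subseteq> JK"
    using integral_part_JK cop by (fastforce simp: gens_def)
  have PKR_G: "P_KR R = generate \<G> (integral_part ` gens)"
    unfolding P_KR_def by (rule arg_cong[of _ _ "generate \<G>"]) (auto simp: gens_def integral_part_def)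
  then have PKR: "P_KR R = generate H (integral_part ` gens)"
    unfolding H using G.generate_consistent[OF ipJK subgroup_JK] by simp
  have carH: "carrier H = JK" by (simp add: H)
  have sub2: "P_KR R \<subseteq> carrier H"
    unfolding PKR by (rule H.generate_incl) (use ipJK carH in auto)
  have sgKR: "subgroup (P_KR R) H"
    unfolding PKR by (rule H.generate_is_subgroup) (use ipJK carH in auto)
  then have normKR: "P_KR R \<lhd> H" by (rule H.subgroup_imp_normal)

  \<comment> \<open>It suffices to compare generators: for \<alpha> congruent to 1 the ideal
    \<open>principal \<O> \<alpha>\<close> is \<open>integral_part \<alpha>\<close>.\<close>
  have sub1: "P_K1 (\<mm>) \<subseteq> P_KR R"
    unfolding P_K1_def PKR_G
  proof (rule G.mono_generate)
    show "{principal \<O> \<alpha> |\<alpha>. \<alpha> \<in> \<O> \<and> \<alpha> \<noteq> 0 \<and> \<alpha> - 1 \<in> \<mm>} \<subseteq> integral_part ` gens"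
    proof
      fix I assume "I \<in> {principal \<O> \<alpha> |\<alpha>. \<alpha> \<in> \<O> \<and> \<alpha> \<noteq> 0 \<and> \<alpha> - 1 \<in> \<mm>}"
      then obtain \<alpha> where \<alpha>: "\<alpha> \<in> \<O>" "\<alpha> \<noteq> 0" "\<alpha> - 1 \<in> \<mm>" "I = principal \<O> \<alpha>" by blast
      have "1 - \<alpha> = (-1) * (\<alpha> - 1)" by simp
      also have "\<dots> \<in> \<mm>"
        using modulus_props(1)[OF fin] \<alpha>(3) OK.R_minus[OF OK.R1]
        unfolding ideal_of_def by (intro submod_mult[of \<O>]) auto
      finally have m: "1 - \<alpha> \<in> \<mm>" .
      have "\<alpha> \<in> gens"
        using one_mod_in_R[OF fin m] \<alpha>(2) comaximal_principal_iff self_in_principal[of \<alpha>] by (auto simp: gens_def)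
      then show "I \<in> integral_part ` gens" using integral_part_one_mod[OF fin \<alpha>(1,3)] \<alpha>(4) by auto
    qed
  qed

  have regU: "{P. reg_prime P} \<subseteq> carrier U"
    using reg_prime_unit by (auto simp: U_def units_of_carrier)
  define JR where "JR = generate U {P. reg_prime P}"
  have sgJR: "subgroup JR U" unfolding JR_def by (rule U.generate_is_subgroup[OF regU])
  define J where "J = U\<lparr>carrier := JR\<rparr>"
  have J_R: "J_R R \<ff> = J"
    unfolding J_R_def J_def JR_def U_def reg_prime_iff ..
  have carJ: "carrier J = JR" by (simp add: J_def)
  interpret J: comm_group J unfolding J_def by (rule U.subgroup_imp_comm_group[OF sgJR])
  have prinJR: "principal R ` gens \<subseteq> JR"
  proof
    fix I assume "I \<in> principal R ` gens"
    then obtain \<alpha> where \<alpha>: "\<alpha> \<in> gens" "I = principal R \<alpha>" by blast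
    then have "coprime_conductor I"
      using cop[OF \<alpha>(1)] ideal_principal_R principal_nonzero by (auto simp: coprime_conductor_def gens_def)
    then show "I \<in> JR" unfolding JR_def U_def by (rule coprime_conductor_generate)
  qed
  have PR_U: "P_R R \<ff> = generate U (principal R ` gens)"
    unfolding P_R_def U_def by (rule arg_cong[of _ _ "generate _"]) (auto simp: gens_def)
  then have PR: "P_R R \<ff> = generate (J) (principal R ` gens)"
    unfolding J_def using U.generate_consistent[OF prinJR sgJR] by simp
  have sgR: "subgroup (P_R R \<ff>) (J)"
    unfolding PR by (rule J.generate_is_subgroup) (use prinJR carJ in auto)
  then have normR: "P_R R \<ff> \<lhd> J" by (rule J.subgroup_imp_normal)

  have homU: "contract \<in> hom H U"
    using contract_unit[OF fin] contract_mult[OF fin]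
    by (auto simp: hom_def H U_def units_of_carrier units_of_mult)
  interpret gU: group_hom H U contract
    by (intro group_hom.intro group_hom_axioms.intro H.group_axioms U.group_axioms homU)
  have good_sub: "{P. good_prime P} \<subseteq> JK" using good_prime_JK by auto
  have "JK = generate H {P. good_prime P}"
    unfolding H G.generate_consistent[OF good_sub subgroup_JK] by (rule JK_generated)
  \<comment> \<open>The image of a generated subgroup is generated by the images of the generators,
    and the correspondence of primes identifies these as the regular primes.\<close>
  then have "contract ` JK = generate U (contract ` {P. good_prime P})"
    using gU.generate_img[of "{P. good_prime P}"] good_sub carH by simp
  also have "contract ` {P. good_prime P} = {P. reg_prime P}"
    using contract_good_prime_reg reg_prime_is_contract by blast
  finally have img: "contract ` JK = JR" unfolding JR_def .
  have imgP: "contract ` P_KR R = P_R R \<ff>"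
  proof -
    have "contract ` P_KR R = generate U (contract ` integral_part ` gens)"
      unfolding PKR using gU.generate_img[of "integral_part ` gens"] ipJK carH by simp
    also have "contract ` integral_part ` gens = principal R ` gens"
    proof -
      have "contract (integral_part \<alpha>) = principal R \<alpha>" if "\<alpha> \<in> gens" for \<alpha>
        using cop[OF that] contract_integral_part that by (auto simp: gens_def)
      then show ?thesis by (simp add: image_image)
    qed
    finally show ?thesis unfolding PR_U .
  qed
  have inj: "inj_on contract JK"
  proof -
    have "kernel H U contract = {\<one>\<^bsub>H\<^esub>}"
      using contract_kernel[OF fin] contract_one JK_one
      by (auto simp: kernel_def H U_def units_of_one)
    then show ?thesis using gU.trivial_ker_imp_inj carH by simp
  qed

  interpret N: normal "P_R R \<ff>" "J" by (rule normR)
  define \<pi> where "\<pi> A = P_R R \<ff> #>\<^bsub>J\<^esub> contract A" for A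
  have homJ: "contract \<in> hom H J"
    using homU img carH by (auto simp: hom_def J_def)
  have "\<pi> = (\<lambda>x. P_R R \<ff> #>\<^bsub>J\<^esub> x) \<circ> contract"
    by (rule ext) (simp only: \<pi>_def comp_def)
  then have hom\<pi>: "\<pi> \<in> hom H (J Mod P_R R \<ff>)"
    using Group.hom_compose[OF homJ N.r_coset_hom_Mod] by (simp only:)
  interpret Q: group "J Mod P_R R \<ff>" by (rule N.factorgroup_is_group)
  interpret pi: group_hom H "J Mod P_R R \<ff>" \<pi>
    by (intro group_hom.intro group_hom_axioms.intro H.group_axioms Q.group_axioms hom\<pi>)
  have surj: "\<pi> ` carrier H = carrier (J Mod P_R R \<ff>)"
    unfolding carH using img by (auto simp: carJ \<pi>_def FactGroup_def RCOSETS_def)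
  have "kernel H (J Mod P_R R \<ff>) \<pi> = P_KR R"
  proof -
    have "\<pi> A = P_R R \<ff> \<longleftrightarrow> A \<in> P_KR R" if A: "A \<in> JK" for A
    proof -
      have cA: "contract A \<in> carrier J" using A img carJ by auto
      have "\<pi> A = P_R R \<ff> \<longleftrightarrow> contract A \<in> P_R R \<ff>"
        unfolding \<pi>_def using J.coset_join1[OF _ cA sgR] J.coset_join2[OF cA sgR] N.subset by blast
      \<comment> \<open>\<open>P_R\<close> is the image of \<open>P_KR R\<close>, so injectivity of
        \<open>contract\<close> reflects membership.\<close>
      also have "\<dots> \<longleftrightarrow> A \<in> P_KR R"
        unfolding imgP[symmetric] using inj A sub2 carH by (auto simp: inj_on_def)
      finally show ?thesis .
    qed
    then show ?thesis using sub2 carH by (auto simp: kernel_def FactGroup_def)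
  qed
  then have "H Mod P_KR R \<cong> J Mod P_R R \<ff>"
    using pi.FactGroup_iso[OF surj] by simp
  then have "J Mod P_R R \<ff> \<cong> H Mod P_KR R"
    using group.iso_sym[OF normal.factorgroup_is_group[OF normKR]] by blast
  then show ?thesis
    using sub1 sub2 normKR normR unfolding Pic_def J_R H_def by simp
qed

end

theorem theorem2p6:
  fixes R :: "'a::field_char_0 set"
  assumes "is_number_field TYPE('a)"
    and "subring R (ring_on UNIV)"
    and "has_fraction_field_K R"
    and "finite (polar_primes R)"
  shows "(P_K1 (subring_modulus R) \<subseteq> P_KR R \<and>
          P_KR R \<subseteq> carrier (J_K (subring_modulus R)) \<and>
          P_KR R \<lhd> J_K (subring_modulus R)) \<and>
         (P_R R (conductor R) \<lhd> J_R R (conductor R) \<and>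
          Pic R (conductor R) \<cong> J_K (subring_modulus R) Mod P_KR R)"
proof -
  obtain B :: "'a set" and co where "rat_basis B co"
    using number_field_rat_basis[OF assms(1)] by blast
  then interpret rat_basis B co .
  interpret subring_set R by (rule subring_set_if_subring[OF assms(2)])
  interpret nf_subring B co R
    by unfold_locales (use assms(3) in \<open>simp add: has_fraction_field_K_def\<close>)
  show ?thesis by (rule class_group_iso[OF assms(4)])
qed

end
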